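(* Let $k\geq 3$ be an integer and let $\hat{c}_k>k$ be the unique real number such that \[ \mathbb{P}\left[\mathrm{Poisson}(\hat{c}_k)\leq k-1\right]=(e\hat{c}_k)^{-1}. \] Let $c>\hat{c}_k$ be fixed, let $p=\frac{c}{n}$, let $G\sim G(n,p)$ and let $K$ be the $k$-core of $G$. Then $|V(K)|$ satisfies a central limit theorem, i.e. \[ \frac{|V(K)|-\mathbb{E}[|V(K)|]}{\sqrt{\operatorname{Var}(|V(K)|)}}\ \xrightarrow{d}\ \mathcal{N}(0,1)\qquad\text{as } n\to\infty . \]
   Context: $G(n,p)$ denotes the binomial random graph on $n$ vertices in which each edge is present independently with probability $p$. The $k$-core of a graph $G$ is the (unique) maximal subgraph of $G$ of minimum degree at least $k$ (possibly empty). $\xrightarrow{d}$ denotes convergence in distribution. *)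

theory Defs
  imports "HOL-Probability.Probability" "HOL-Library.Ramsey"
begin

section \<open>Graphs and k-cores\<close>

datatype 'a ugraph = Ugraph (verts: "'a set") (edges: "'a set set")

definition simple_graph :: "'a ugraph \<Rightarrow> bool" where
  "simple_graph G \<longleftrightarrow> finite (verts G) \<and> edges G \<subseteq> [verts G]\<^bsup>2\<^esup>"

definition is_subgraph :: "'a ugraph \<Rightarrow> 'a ugraph \<Rightarrow> bool" where
  "is_subgraph H G \<longleftrightarrow> simple_graph H \<and> simple_graph G \<and> verts H \<subseteq> verts G \<and> edges H \<subseteq> edges G"

definition degree :: "'a ugraph \<Rightarrow> 'a \<Rightarrow> nat" where
  "degree G v = card {e \<in> edges G. v \<in> e}"

text \<open>The graph without vertices satisfies this for every \<open>k\<close>, so the \<open>k\<close>-core may be empty.\<close>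

definition min_degree_at_least :: "nat \<Rightarrow> 'a ugraph \<Rightarrow> bool" where
  "min_degree_at_least k G \<longleftrightarrow> (\<forall>v\<in>verts G. k \<le> degree G v)"

definition is_k_core :: "nat \<Rightarrow> 'a ugraph \<Rightarrow> 'a ugraph \<Rightarrow> bool" where
  "is_k_core k G H \<longleftrightarrow> is_subgraph H G \<and> min_degree_at_least k H \<and>
     (\<forall>H'. is_subgraph H' G \<and> min_degree_at_least k H' \<and> is_subgraph H H' \<longrightarrow> H' = H)"

definition k_core :: "nat \<Rightarrow> 'a ugraph \<Rightarrow> 'a ugraph" where
  "k_core k G = (THE H. is_k_core k G H)"

lemma finite_edges: "simple_graph G \<Longrightarrow> finite (edges G)"
  unfolding simple_graph_def by (meson finite_imp_finite_nsets finite_subset)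

lemma degree_mono:
  assumes "is_subgraph H G" shows "degree H v \<le> degree G v"
proof -
  have "finite (edges G)" using assms finite_edges by (auto simp: is_subgraph_def)
  then show ?thesis unfolding degree_def
    using assms by (intro card_mono) (auto simp: is_subgraph_def)
qed

lemma ex1_k_core:
  assumes G: "simple_graph G"
  shows "\<exists>!H. is_k_core k G H"
proof -
  define S where "S = {H. is_subgraph H G \<and> min_degree_at_least k H}"
  define U where "U = Ugraph (\<Union>(verts ` S)) (\<Union>(edges ` S))"
  have sg: "simple_graph U"
  proof -
    have "verts U \<subseteq> verts G" by (auto simp: U_def S_def is_subgraph_def)
    moreover have "edges U \<subseteq> [verts U]\<^bsup>2\<^esup>"
    proof
      fix e assume "e \<in> edges U"
      then obtain H where H: "H \<in> S" "e \<in> edges H" by (auto simp: U_def)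
      then have "e \<in> [verts H]\<^bsup>2\<^esup>" by (auto simp: S_def is_subgraph_def simple_graph_def)
      moreover have "verts H \<subseteq> verts U" using H by (auto simp: U_def)
      ultimately show "e \<in> [verts U]\<^bsup>2\<^esup>" using nsets_mono by blast
    qed
    ultimately show ?thesis using G by (auto simp: simple_graph_def intro: finite_subset)
  qed
  have UG: "is_subgraph U G"
    using sg G by (auto simp: is_subgraph_def U_def S_def)
  have HU: "is_subgraph H U" if "H \<in> S" for H
    using that sg by (auto simp: is_subgraph_def S_def U_def)
  have "k \<le> degree U v" if v: "v \<in> verts U" for v
  proof -
    from v obtain H where H: "H \<in> S" "v \<in> verts H" by (auto simp: U_def)
    then have "k \<le> degree H v" by (auto simp: S_def min_degree_at_least_def)
    also have "\<dots> \<le> degree U v" using HU[OF H(1)] by (rule degree_mono)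
    finally show ?thesis .
  qed
  then have US: "U \<in> S" using UG by (simp add: S_def min_degree_at_least_def)
  have anti: "H = U" if "is_subgraph H U" "is_subgraph U H" for H
    using that by (auto simp: is_subgraph_def intro: ugraph.expand)
  have "is_k_core k G U"
    using US HU anti by (auto simp: is_k_core_def S_def)
  moreover have "H = U" if "is_k_core k G H" for H
  proof -
    have "H \<in> S" using that by (auto simp: is_k_core_def S_def)
    then show ?thesis using that US HU[of H] by (auto simp: is_k_core_def S_def)
  qed
  ultimately show ?thesis by blast
qed


section \<open>The binomial random graph\<close>

text \<open>\<^const>\<open>bernoulli_pmf\<close> truncates its parameter to the unit interval. With \<open>p = c / n\<close> this
  only affects the finitely many \<open>n < c\<close>.\<close>

definition gnp :: "nat \<Rightarrow> real \<Rightarrow> nat ugraph pmf" where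
  "gnp n p = map_pmf (\<lambda>f. Ugraph {..<n} {e \<in> [{..<n}]\<^bsup>2\<^esup>. f e})
     (Pi_pmf ([{..<n}]\<^bsup>2\<^esup>) False (\<lambda>_. bernoulli_pmf p))"

lemma simple_graph_gnp: "G \<in> set_pmf (gnp n p) \<Longrightarrow> simple_graph G"
  by (auto simp: gnp_def simple_graph_def)


section \<open>The threshold\<close>

definition c_hat :: "nat \<Rightarrow> real" where
  "c_hat k = (THE x. x > real k \<and> measure_pmf.prob (poisson_pmf x) {..k - 1} = inverse (exp 1 * x))"

lemma prob_poisson_atMost:
  assumes "x > 0" "k > 0"
  shows "measure_pmf.prob (poisson_pmf x) {..k - 1} = exp (-x) * (\<Sum>j<k. x ^ j / fact j)"
proof -
  have "{..k - 1} = {..<k}" using assms by auto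
  then show ?thesis
    using assms by (simp add: measure_measure_pmf_finite sum_distrib_left mult.commute)
qed

lemma fact_less_power:
  assumes "k \<ge> 2" shows "fact k < exp (1 - real k) * real k ^ (k + 1)"
  using assms
proof (induction k rule: dec_induct)
  case base
  have "exp 1 < (4::real)" using exp_le by simp
  then show ?case by (simp add: exp_minus field_simps fact_numeral)
next
  case (step k)
  have k: "real k > 0" using step by simp
  have "1 / (real k + 1) \<le> ln (1 + 1 / real k)"
  proof -
    have "ln (real k / (real k + 1)) \<le> real k / (real k + 1) - 1"
      using k by (intro ln_le_minus_one) auto
    moreover have "ln (real k / (real k + 1)) = - ln (1 + 1 / real k)"
      using k by (subst ln_inverse[symmetric]) (auto simp: field_simps)
    moreover have "real k / (real k + 1) - 1 = - (1 / (real k + 1))"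
      using k by (simp add: field_simps)
    ultimately show ?thesis by linarith
  qed
  then have "1 \<le> (real k + 1) * ln (1 + 1 / real k)"
    using k by (simp add: field_simps)
  then have "exp 1 \<le> exp ((real k + 1) * ln (1 + 1 / real k))" by simp
  also have "\<dots> = (1 + 1 / real k) ^ (k + 1)"
    using k exp_of_nat_mult[of "k + 1" "ln (1 + 1 / real k)"] by (simp add: add_pos_pos add.commute)
  also have "\<dots> = (real k + 1) ^ (k + 1) / real k ^ (k + 1)"
    using k by (subst power_divide[symmetric]) (simp add: field_simps)
  finally have *: "exp 1 * real k ^ (k + 1) \<le> (real k + 1) ^ (k + 1)"
    using k by (simp add: field_simps del: power_Suc)
  have "fact (Suc k) = (real k + 1) * fact k" by simp
  also have "\<dots> < (real k + 1) * (exp (1 - real k) * real k ^ (k + 1))"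
    using step k by (intro mult_strict_left_mono) auto
  also have "exp (1 - real k) = exp (- real k) * exp 1" by (simp add: exp_add[symmetric])
  also have "(real k + 1) * (exp (- real k) * exp 1 * real k ^ (k + 1)) =
      (real k + 1) * exp (- real k) * (exp 1 * real k ^ (k + 1))" by simp
  also have "\<dots> \<le> (real k + 1) * exp (- real k) * (real k + 1) ^ (k + 1)"
    using * k by (intro mult_left_mono) auto
  also have "\<dots> = exp (1 - real (Suc k)) * real (Suc k) ^ (Suc k + 1)"
    by (simp add: algebra_simps)
  finally show ?case .
qed

lemma ex1_c_hat:
  assumes k: "k \<ge> 3"
  shows "\<exists>!x. x > real k \<and> measure_pmf.prob (poisson_pmf x) {..k - 1} = inverse (exp 1 * x)"
proof -
  define S where "S = (\<lambda>x::real. \<Sum>j<k. x ^ j / fact j)"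
  define g where "g = (\<lambda>x::real. x * (exp (-x) * S x))"
  obtain m where m: "k = Suc m" using k by (cases k) auto
  have iff: "measure_pmf.prob (poisson_pmf x) {..k - 1} = inverse (exp 1 * x) \<longleftrightarrow> g x = exp (-1)"
    if "x > real k" for x
    using that k
    by (subst prob_poisson_atMost) (auto simp: g_def S_def exp_minus field_simps)
  have S': "(S has_real_derivative (S x - x ^ m / fact m)) (at x)" for x
  proof -
    have S_Suc: "S = (\<lambda>x. 1 + (\<Sum>j<m. x ^ Suc j / fact (Suc j)))"
      unfolding S_def m by (subst sum.lessThan_Suc_shift) simp
    have "((\<lambda>x. x ^ Suc j / fact (Suc j)) has_real_derivative x ^ j / fact j) (at x)" for j
    proof -
      have "((\<lambda>x. x ^ Suc j / fact (Suc j)) has_real_derivative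
          (real (Suc j) * x ^ j) / fact (Suc j)) (at x)"
        by (rule DERIV_cdivide) (use DERIV_pow[of "Suc j" x] in simp)
      then show ?thesis by (simp del: of_nat_Suc)
    qed
    then have "(S has_real_derivative 0 + (\<Sum>j<m. x ^ j / fact j)) (at x)"
      unfolding S_Suc by (intro DERIV_add DERIV_const DERIV_sum)
    moreover have "S x - x ^ m / fact m = (\<Sum>j<m. x ^ j / fact j)"
      unfolding S_def m by simp
    ultimately show ?thesis by simp
  qed
  have g': "(g has_real_derivative exp (-x) * (S x - x * (x ^ m / fact m))) (at x)" for x
    unfolding g_def
    by (rule derivative_eq_intros S' refl | simp)+ (simp add: algebra_simps)
  have neg: "exp (-x) * (S x - x * (x ^ m / fact m)) < 0" if x: "x > real k" for x
  proof -
    have x0: "x > 0" using x by linarith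
    have le: "x ^ (m - i) / fact (m - i) \<le> x ^ m / fact m" if "i \<le> m" for i
      using that
    proof (induction i)
      case (Suc i)
      define j where "j = m - Suc i"
      have j: "m - i = Suc j" using Suc by (auto simp: j_def)
      have "x ^ j / fact j \<le> x ^ Suc j / fact (Suc j)"
      proof -
        have "real (Suc j) \<le> x" using x m j by linarith
        then have "1 \<le> x / real (Suc j)" by simp
        then have "x ^ j / fact j * 1 \<le> x ^ j / fact j * (x / real (Suc j))"
          using x0 by (intro mult_left_mono) auto
        then show ?thesis by (simp add: mult_ac)
      qed
      then show ?case using Suc j by (simp add: j_def)
    qed simp
    have "x ^ j / fact j \<le> x ^ m / fact m" if "j < k" for j
      using le[of "m - j"] that m by simp
    then have "S x \<le> (\<Sum>j<k. x ^ m / fact m)"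
      unfolding S_def by (intro sum_mono) auto
    also have "\<dots> = real k * (x ^ m / fact m)" by simp
    also have "\<dots> < x * (x ^ m / fact m)"
      using x x0 by (intro mult_strict_right_mono) auto
    finally show ?thesis by (simp add: mult_pos_neg)
  qed
  have cont: "continuous_on A g" for A
    using g' by (meson DERIV_isCont continuous_at_imp_continuous_on)
  have decr: "g y < g x" if xy: "real k < x" "x < y" for x y
  proof (rule DERIV_neg_imp_decreasing[OF xy(2)])
    fix z assume "x \<le> z" "z \<le> y"
    then have "real k < z" using xy by linarith
    then show "\<exists>d. (g has_real_derivative d) (at z) \<and> d < 0"
      using g'[of z] neg[of z] by blast
  qed
  have start: "g (real k) > exp (-1)"
  proof -
    have "real k ^ k / fact (k - 1) * exp (- real k) \<le> g (real k)"
    proof -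
      have "real k ^ m / fact m \<le> S (real k)"
        unfolding S_def using m by (intro member_le_sum) auto
      then have "real k * (exp (- real k) * (real k ^ m / fact m)) \<le> g (real k)"
        unfolding g_def by (intro mult_left_mono) auto
      then show ?thesis using m by (simp add: field_simps)
    qed
    moreover have "exp (-1) < real k ^ k / fact (k - 1) * exp (- real k)"
    proof -
      have "fact k = real k * fact (k - 1)" using m by simp
      moreover have "fact k < exp (1 - real k) * real k ^ (k + 1)"
        using k by (intro fact_less_power) auto
      ultimately have "real k * fact (k - 1) < real k * (exp (1 - real k) * real k ^ k)"
        by (simp add: mult_ac)
      then have "fact (k - 1) < exp (1 - real k) * real k ^ k"
        using k by simp
      then have "fact (k - 1) * exp (-1) < exp (1 - real k) * real k ^ k * exp (-1)" by simp
      also have "\<dots> = real k ^ k * exp (- real k)"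
        by (simp add: exp_diff exp_minus field_simps)
      finally show ?thesis by (simp add: field_simps)
    qed
    ultimately show ?thesis by linarith
  qed
  have "(g \<longlongrightarrow> 0) at_top"
  proof -
    have "((\<lambda>x::real. x ^ Suc j / exp x / fact j) \<longlongrightarrow> 0 / fact j) at_top" for j
      by (intro tendsto_divide tendsto_power_div_exp_0 tendsto_const) auto
    then have "((\<lambda>x::real. \<Sum>j<k. x ^ Suc j / exp x / fact j) \<longlongrightarrow> (\<Sum>j<k. 0)) at_top"
      by (intro tendsto_sum) simp
    moreover have "g = (\<lambda>x. \<Sum>j<k. x ^ Suc j / exp x / fact j)"
      by (auto simp: g_def S_def sum_distrib_left exp_minus field_simps)
    ultimately show ?thesis by simp
  qed
  then have "eventually (\<lambda>x. g x < exp (-1)) at_top"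
    by (rule order_tendstoD) simp
  then have "eventually (\<lambda>x. x > real k \<and> g x < exp (-1)) at_top"
    using eventually_gt_at_top[of "real k"] by eventually_elim simp
  then obtain b where b: "b > real k" "g b < exp (-1)"
    using eventually_happens[of _ "at_top :: real filter"] by fastforce
  obtain x where x: "real k \<le> x" "x \<le> b" "g x = exp (-1)"
    using IVT2'[of g b "exp (-1)" "real k"] b start cont by auto
  then have "x > real k" using start by (cases "x = real k") auto
  moreover have "y = x" if y: "y > real k" "g y = exp (-1)" for y
  proof (rule ccontr)
    assume "y \<noteq> x"
    then consider "x < y" | "y < x" by linarith
    then show False
      using decr[of x y] decr[of y x] y x(3) \<open>x > real k\<close> by cases simp_all
  qed
  ultimately show ?thesis
    using x(3) iff by (intro ex1I[of _ x]) blast+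
qed

end

theory Submission
  imports Defs "HOL-Real_Asymp.Real_Asymp"
begin

text \<open>Let \<open>f\<close> be the size of the core as a function of the independent edge indicators, \<open>D\<^sub>e f\<close> its
  discrete derivative at \<open>e\<close>, and \<open>W = (f - \<mu>) / \<sigma>\<close>. Integrating out the edges one at a time gives
  \<open>Cov(f, h) = \<Sum>\<^sub>e p(1-p) E[g\<^sub>e D\<^sub>e h]\<close>, where \<open>g\<^sub>e\<close> is a partial average of \<open>D\<^sub>e f\<close>. With
  \<open>h = exp(itW)\<close> the right-hand side is \<open>it\<sigma> E[h]\<close> up to a Taylor remainder and the covariances
  of \<open>g\<^sub>e D\<^sub>e f\<close> with \<open>h\<close>. The same formula bounds these by the mixed differences
  \<open>D\<^sub>e' D\<^sub>e f\<close>. Hence the characteristic function of \<open>W\<close> nearly solves \<open>\<phi>'(t) = -t \<phi>(t)\<close>.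

  Inserting an edge changes the core only inside the components, in the graph induced on the
  complement of the core, of its two endpoints, and \<open>D\<^sub>e' D\<^sub>e f = 0\<close> unless \<open>e'\<close> meets one of these.
  In such a component every vertex has fewer than \<open>k\<close> neighbours outside. The hypothesis on \<open>c\<close> says
  that \<open>c e P[Poisson(c) < k] < 1\<close>, so the expected number of connected sets of this kind of size \<open>s\<close>
  decays exponentially in \<open>s\<close>, and all components have size at most \<open>(log n)\<^sup>2 + 1\<close> with overwhelming
  probability. The variance is of order \<open>n\<close>, by comparing \<open>f\<close> with the number of edges: vertices of
  degree exactly \<open>k\<close> with all neighbours in the core of the remaining graph make \<open>E[D\<^sub>e f]\<close> bounded below.\<close>

section \<open>Averages over independent Bernoulli coordinates\<close>

text \<open>The condition on \<open>c\<close> comes from a union bound over search trees: summing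
  over all trees costs a factor about \<open>c * exp 1\<close> per vertex, and lightness gains a
  factor close to P[Poisson(c) < k] per vertex. The threshold is where the product passes 1. The
  assumption also gives \<open>k < c\<close>, so a given vertex misses the core with probability
  bounded away from 1 / k, and that keeps the variance linear. The obstacle is that discrete
  derivatives of the core size are under control only with high probability; otherwise there is just
  the trivial bound \<open>n\<close>. All estimates therefore carry two bounds, and the exceptional
  event must be stable under overwriting edges, because differences are evaluated at altered graphs.
  Component size (log n)^2 instead of a multiple of log n makes that event rarer than every power of
  n, whatever the gap between \<open>c\<close> and the threshold. Powers of n lost to trivial
  bounds, to union bounds over edges and to overwriting are then harmless. The resulting error in
  the characteristic function at a fixed point is a power of log n divided by sqrt n.\<close>

definition av :: "real \<Rightarrow> 'i \<Rightarrow> (('i \<Rightarrow> bool) \<Rightarrow> 'b::real_vector) \<Rightarrow> ('i \<Rightarrow> bool) \<Rightarrow> 'b" where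
  "av p i u x = p *\<^sub>R u (x(i := True)) + (1 - p) *\<^sub>R u (x(i := False))"

definition dif :: "'i \<Rightarrow> (('i \<Rightarrow> bool) \<Rightarrow> 'b::ab_group_add) \<Rightarrow> ('i \<Rightarrow> bool) \<Rightarrow> 'b" where
  "dif i u x = u (x(i := True)) - u (x(i := False))"

primrec avl :: "real \<Rightarrow> 'i list \<Rightarrow> (('i \<Rightarrow> bool) \<Rightarrow> 'b::real_vector) \<Rightarrow> ('i \<Rightarrow> bool) \<Rightarrow> 'b" where
  "avl p [] u = u"
| "avl p (i # is) u = avl p is (av p i u)"

definition ignores :: "'i \<Rightarrow> (('i \<Rightarrow> bool) \<Rightarrow> 'b) \<Rightarrow> bool" where
  "ignores i u \<longleftrightarrow> (\<forall>x b. u (x(i := b)) = u x)"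

lemma av_ignores: "ignores i u \<Longrightarrow> av p i u = u"
  by (auto simp: av_def ignores_def fun_eq_iff algebra_simps)

lemma ignores_av_same: "ignores i (av p i u)"
  by (auto simp: av_def ignores_def)

lemma ignores_dif_same: "ignores i (dif i u)"
  by (auto simp: dif_def ignores_def)

lemma ignores_av: "ignores j u \<Longrightarrow> ignores j (av p i u)"
  by (cases "i = j") (auto simp: av_def ignores_def fun_upd_twist)

lemma ignores_dif: "ignores j u \<Longrightarrow> ignores j (dif i u)"
  by (cases "i = j") (auto simp: dif_def ignores_def fun_upd_twist)

lemma ignores_avl: "ignores j u \<Longrightarrow> ignores j (avl p is u)"
  by (induction "is" arbitrary: u) (auto intro: ignores_av)

lemma ignores_avl_mem: "j \<in> set is \<Longrightarrow> ignores j (avl p is u)"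
  by (induction "is" arbitrary: u) (auto intro: ignores_avl ignores_av_same)

lemma avl_ignores: "(\<And>i. i \<in> set is \<Longrightarrow> ignores i u) \<Longrightarrow> avl p is u = u"
  by (induction "is" arbitrary: u) (auto simp: av_ignores)

lemma dif_ignores: "ignores i u \<Longrightarrow> dif i u = (\<lambda>x. 0)"
  by (auto simp: dif_def ignores_def)

lemma avl_append: "avl p (as @ bs) u = avl p bs (avl p as u)"
  by (induction as arbitrary: u) auto

text \<open>The inner averages already ignore the coordinates in \<open>take m is\<close>, and
  averaging an ignored coordinate does nothing. This is the tower property that later removes
  partial averages under the full one.\<close>

lemma avl_take: "avl p is (avl p (take m is) u) = avl p is u"
proof -
  have "avl p is v = avl p (drop m is) (avl p (take m is) v)" for v :: "('a \<Rightarrow> bool) \<Rightarrow> 'b"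
    by (metis avl_append append_take_drop_id)
  moreover have "avl p (take m is) (avl p (take m is) u) = avl p (take m is) u"
    by (rule avl_ignores) (rule ignores_avl_mem)
  ultimately show ?thesis by metis
qed

lemma av_add: "av p i (\<lambda>x. u x + v x) = (\<lambda>x. av p i u x + av p i v x)"
  by (auto simp: av_def algebra_simps)

lemma avl_add: "avl p is (\<lambda>x. u x + v x) z = avl p is u z + avl p is v z"
  by (induction "is" arbitrary: u v) (auto simp: av_add)

lemma av_scaleR: "av p i (\<lambda>x. r *\<^sub>R u x) = (\<lambda>x. r *\<^sub>R av p i u x)"
  by (auto simp: av_def algebra_simps)

lemma avl_scaleR: "avl p is (\<lambda>x. r *\<^sub>R u x) z = r *\<^sub>R avl p is u z"
  by (induction "is" arbitrary: u) (auto simp: av_scaleR)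

lemma avl_cmult:
  fixes u :: "('i \<Rightarrow> bool) \<Rightarrow> real" shows "avl p is (\<lambda>x. r * u x) z = r * avl p is u z"
  using avl_scaleR[of p "is" r u z] by simp

lemma avl_linear: "bounded_linear L \<Longrightarrow> avl p is (\<lambda>x. L (u x)) z = L (avl p is u z)"
proof (induction "is" arbitrary: u)
  case (Cons i "is")
  have "av p i (\<lambda>x. L (u x)) = (\<lambda>x. L (av p i u x))"
    using Cons.prems by (auto simp: av_def bounded_linear.linear linear_add linear_scale)
  then show ?case using Cons by simp
qed auto

lemma avl_const [simp]: "avl p is (\<lambda>x. a) = (\<lambda>x. a)"
  by (rule avl_ignores) (auto simp: ignores_def)

lemma avl_diff: "avl p is (\<lambda>x. u x - v x) z = avl p is u z - avl p is v z"
  using avl_add[of p "is" u "\<lambda>x. - v x" z] avl_scaleR[of p "is" "-1" v z] by simp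

lemma avl_sum: "avl p is (\<lambda>x. \<Sum>j\<in>J. u j x) z = (\<Sum>j\<in>J. avl p is (u j) z)"
  by (induction J rule: infinite_finite_induct) (auto simp: avl_add)

lemma avl_mono:
  fixes u v :: "('i \<Rightarrow> bool) \<Rightarrow> real"
  assumes "0 \<le> p" "p \<le> 1" "\<And>x. u x \<le> v x"
  shows "avl p is u z \<le> avl p is v z"
  using assms(3)
proof (induction "is" arbitrary: u v)
  case (Cons i "is")
  have "av p i u x \<le> av p i v x" for x
    unfolding av_def using assms(1,2) Cons.prems by (intro add_mono scaleR_left_mono) auto
  then show ?case using Cons.IH by simp
qed auto

lemma avl_nonneg:
  fixes u :: "('i \<Rightarrow> bool) \<Rightarrow> real"
  assumes "0 \<le> p" "p \<le> 1" "\<And>x. 0 \<le> u x"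
  shows "0 \<le> avl p is u z"
  using avl_mono[of p "\<lambda>x. 0" u "is" z] assms by simp

lemma avl_le_const:
  fixes u :: "('i \<Rightarrow> bool) \<Rightarrow> real"
  assumes "0 \<le> p" "p \<le> 1" "\<And>x. u x \<le> a"
  shows "avl p is u z \<le> a"
  using avl_mono[of p u "\<lambda>x. a" "is" z] assms by simp

text \<open>A coordinate overwritten before averaging may itself be averaged; then the average wins
  and \<open>b\<close> is lost. Asking for the bound at every overwritten value covers this case
  together with the case that \<open>j\<close> is not in the list.\<close>

lemma norm_avl_upd_le:
  fixes u :: "('i \<Rightarrow> bool) \<Rightarrow> 'b::real_normed_vector"
  assumes p: "0 \<le> p" "p \<le> 1" and uv: "\<And>x b. norm (u (x(j := b))) \<le> v x"
  shows "norm (avl p is u (z(j := b))) \<le> avl p is v z"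
  using uv
proof (induction "is" arbitrary: u v)
  case (Cons i "is")
  have "norm (av p i u (x(j := b))) \<le> av p i v x" for x b
  proof -
    have "norm (u (x(j := b, i := a))) \<le> v (x(i := a))" for a
    proof -
      have "x(j := b, i := a) = x(i := a, j := if i = j then a else b)"
        by (rule ext) simp
      then show ?thesis by (metis Cons.prems)
    qed
    then have "p * norm (u (x(j := b, i := True))) \<le> p * v (x(i := True))"
        "(1 - p) * norm (u (x(j := b, i := False))) \<le> (1 - p) * v (x(i := False))"
      using p by (simp_all only: mult_left_mono diff_ge_0_iff_ge)
    moreover have "norm (av p i u (x(j := b))) \<le>
        p * norm (u (x(j := b, i := True))) + (1 - p) * norm (u (x(j := b, i := False)))"
      unfolding av_def using p by (rule_tac order_trans[OF norm_triangle_ineq]) simp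
    moreover have "av p i v x = p * v (x(i := True)) + (1 - p) * v (x(i := False))"
      by (simp add: av_def)
    ultimately show ?thesis by linarith
  qed
  then show ?case unfolding avl.simps by (rule Cons.IH)
qed auto

lemma norm_avl_le:
  fixes u :: "('i \<Rightarrow> bool) \<Rightarrow> 'b::real_normed_vector"
  assumes p: "0 \<le> p" "p \<le> 1"
  shows "norm (avl p is u z) \<le> avl p is (\<lambda>x. norm (u x)) z"
proof (induction "is" arbitrary: u)
  case (Cons i "is")
  have "norm (avl p is (av p i u) z) \<le> avl p is (\<lambda>x. norm (av p i u x)) z" by (rule Cons)
  also have "\<dots> \<le> avl p is (av p i (\<lambda>x. norm (u x))) z"
    unfolding av_def using p
    by (intro avl_mono p order_trans[OF norm_triangle_ineq]) simp
  finally show ?case by simp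
qed auto

lemma dif_av: "i \<noteq> j \<Longrightarrow> dif j (av p i u) = av p i (dif j u)"
  by (auto simp: dif_def av_def fun_upd_twist algebra_simps)

lemma dif_avl: "j \<notin> set is \<Longrightarrow> dif j (avl p is u) = avl p is (dif j u)"
  by (induction "is" arbitrary: u) (auto simp: dif_av)

lemma abs_dif_avl_le:
  fixes u :: "('i \<Rightarrow> bool) \<Rightarrow> real"
  assumes p: "0 \<le> p" "p \<le> 1"
  shows "\<bar>dif j (avl p is u) x\<bar> \<le> avl p is (\<lambda>x. \<bar>dif j u x\<bar>) x"
proof (cases "j \<in> set is")
  case True
  then have "dif j (avl p is u) x = 0" by (simp add: dif_ignores ignores_avl_mem)
  then show ?thesis using avl_nonneg[OF p, of "\<lambda>x. \<bar>dif j u x\<bar>"] by simp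
next
  case False
  then show ?thesis using norm_avl_le[OF p, of "is" "dif j u" x] by (simp add: dif_avl)
qed

section \<open>Covariance as a sum over coordinates\<close>

lemma av_mult:
  "av p i (\<lambda>x. f x *\<^sub>R h x) =
    (\<lambda>x. av p i f x *\<^sub>R av p i h x + (p * (1 - p)) *\<^sub>R (dif i f x *\<^sub>R dif i h x))"
  unfolding av_def dif_def real_scaleR_def
  by (rule ext) (simp add: algebra_simps power2_eq_square)

text \<open>Telescoping of \<open>av_mult\<close> along the list. Only the first factor carries a
  partial average: it ignores the coordinates averaged so far, so the same averages around
  \<open>dif (is ! m) h\<close> are absorbed by the full one. Keeping \<open>h\<close> raw is what
  later permits a Taylor expansion at the actual point \<open>x\<close>.\<close>

lemma avl_covariance:
  assumes "distinct is"
  shows "avl p is (\<lambda>x. f x *\<^sub>R h x) z = avl p is f z *\<^sub>R avl p is h z +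
    (\<Sum>m<length is. (p * (1 - p)) *\<^sub>R
      avl p is (\<lambda>x. avl p (take m is) (dif (is ! m) f) x *\<^sub>R dif (is ! m) h x) z)"
  using assms
proof (induction "is" arbitrary: f h)
  case (Cons i "is")
  let ?r = "p * (1 - p)"
  define t where "t = (\<lambda>m. avl p (i # is) (\<lambda>x. avl p (take m (i # is)) (dif ((i # is) ! m) f) x *\<^sub>R
                  dif ((i # is) ! m) h x) z)"
  have 1: "avl p is (\<lambda>x. avl p (take m is) (dif (is ! m) (av p i f)) x *\<^sub>R
             dif (is ! m) (av p i h) x) z = t (Suc m)" if m: "m < length is" for m
  proof -
    have ne: "i \<noteq> is ! m" using Cons.prems m by auto
    define G where "G = avl p (take m is) (av p i (dif (is ! m) f))"
    have "ignores i G" unfolding G_def by (intro ignores_avl ignores_av_same)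
    then have "av p i (\<lambda>x. G x *\<^sub>R dif (is ! m) h x) = (\<lambda>x. G x *\<^sub>R av p i (dif (is ! m) h) x)"
      by (auto simp: ignores_def av_def algebra_simps)
    then show ?thesis using ne by (simp add: dif_av G_def t_def)
  qed
  have 0: "avl p is (\<lambda>x. dif i f x *\<^sub>R dif i h x) z = t 0"
  proof -
    have "ignores i (\<lambda>x. dif i f x *\<^sub>R dif i h x)"
      using ignores_dif_same[of i f] ignores_dif_same[of i h] by (auto simp: ignores_def)
    then show ?thesis by (simp add: av_ignores t_def)
  qed
  have "avl p (i # is) (\<lambda>x. f x *\<^sub>R h x) z =
      avl p is (\<lambda>x. av p i f x *\<^sub>R av p i h x) z + ?r *\<^sub>R t 0"
    by (simp only: avl.simps av_mult[of p i f h] avl_add avl_scaleR 0)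
  also have "avl p is (\<lambda>x. av p i f x *\<^sub>R av p i h x) z =
      avl p (i # is) f z *\<^sub>R avl p (i # is) h z + (\<Sum>m<length is. ?r *\<^sub>R t (Suc m))"
  proof -
    have "distinct is" using Cons.prems by simp
    show ?thesis
      unfolding Cons.IH[OF \<open>distinct is\<close>, of "av p i f" "av p i h"] avl.simps
      by (rule arg_cong2[where f = "(+)", OF refl], rule sum.cong[OF refl]) (simp only: 1 lessThan_iff)
  qed
  finally have "avl p (i # is) (\<lambda>x. f x *\<^sub>R h x) z =
      avl p (i # is) f z *\<^sub>R avl p (i # is) h z + (?r *\<^sub>R t 0 + (\<Sum>m<length is. ?r *\<^sub>R t (Suc m)))"
    by (simp only: add_ac)
  also have "?r *\<^sub>R t 0 + (\<Sum>m<length is. ?r *\<^sub>R t (Suc m)) = (\<Sum>m<length (i # is). ?r *\<^sub>R t m)"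
    unfolding list.size add_Suc_right add_0_right sum.lessThan_Suc_shift ..
  finally show ?case unfolding t_def .
qed simp

lemma norm_avl_covariance_le:
  fixes f :: "('i \<Rightarrow> bool) \<Rightarrow> real" and h :: "('i \<Rightarrow> bool) \<Rightarrow> 'b::real_normed_vector"
  assumes "distinct is" and p: "0 \<le> p" "p \<le> 1"
  shows "norm (avl p is (\<lambda>x. f x *\<^sub>R h x) z - avl p is f z *\<^sub>R avl p is h z) \<le>
    (\<Sum>m<length is. p * avl p is (\<lambda>x. avl p (take m is) (\<lambda>x. \<bar>dif (is ! m) f x\<bar>) x *
        norm (dif (is ! m) h x)) z)"
proof -
  have "norm (avl p is (\<lambda>x. f x *\<^sub>R h x) z - avl p is f z *\<^sub>R avl p is h z) \<le>
      (\<Sum>m<length is. norm ((p * (1 - p)) *\<^sub>R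
      avl p is (\<lambda>x. avl p (take m is) (dif (is ! m) f) x *\<^sub>R dif (is ! m) h x) z))"
    unfolding avl_covariance[OF assms(1), of p f h z] add_diff_cancel_left' by (rule norm_sum)
  also have "\<dots> \<le> (\<Sum>m<length is. p * avl p is (\<lambda>x. avl p (take m is) (\<lambda>x. \<bar>dif (is ! m) f x\<bar>) x *
        norm (dif (is ! m) h x)) z)"
  proof (rule sum_mono)
    fix m
    let ?u = "avl p is (\<lambda>x. avl p (take m is) (dif (is ! m) f) x *\<^sub>R dif (is ! m) h x) z"
    have "norm ?u \<le> avl p is (\<lambda>x. norm (avl p (take m is) (dif (is ! m) f) x *\<^sub>R dif (is ! m) h x)) z"
      by (rule norm_avl_le[OF p])
    also have "\<dots> \<le> avl p is (\<lambda>x. avl p (take m is) (\<lambda>x. \<bar>dif (is ! m) f x\<bar>) x *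
        norm (dif (is ! m) h x)) z" (is "_ \<le> ?v")
      unfolding norm_scaleR using norm_avl_le[OF p, of "take m is" "dif (is ! m) f"]
      by (intro avl_mono p mult_right_mono) auto
    finally have "norm ?u \<le> ?v" .
    moreover have "\<bar>p * (1 - p)\<bar> \<le> p"
      using p mult_left_le[of "1 - p" p] by (auto simp: abs_mult)
    ultimately show "norm ((p * (1 - p)) *\<^sub>R ?u) \<le> p * ?v"
      unfolding norm_scaleR using p by (intro mult_mono) auto
  qed
  finally show ?thesis .
qed

lemma avl_has_vector_derivative:
  assumes "\<And>x. ((\<lambda>t. u t x) has_vector_derivative u' x) (at t)"
  shows "((\<lambda>t. avl p is (u t) z) has_vector_derivative avl p is u' z) (at t)"
  using assms
proof (induction "is" arbitrary: u u')
  case (Cons i "is")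
  have "((\<lambda>t. av p i (u t) x) has_vector_derivative av p i u' x) (at t)" for x
    unfolding av_def
    by (intro has_vector_derivative_add bounded_linear.has_vector_derivative[OF bounded_linear_scaleR_right]
        Cons.prems)
  then show ?case using Cons.IH by simp
qed auto

section \<open>Averages as expectations under the product measure\<close>

lemma expectation_Pi_bernoulli_insert:
  fixes u :: "('i \<Rightarrow> bool) \<Rightarrow> 'b::{banach, second_countable_topology}"
  assumes "finite I" "i \<notin> I" and p: "0 \<le> p" "p \<le> 1"
  shows "measure_pmf.expectation (Pi_pmf (insert i I) False (\<lambda>_. bernoulli_pmf p)) u =
    measure_pmf.expectation (Pi_pmf I False (\<lambda>_. bernoulli_pmf p)) (av p i u)"
proof -
  let ?P = "Pi_pmf I False (\<lambda>_. bernoulli_pmf p)"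
  have fin: "finite (set_pmf ?P)"
    using assms by (intro finite_subset[OF set_Pi_pmf_subset'] finite_PiE_dflt) auto
  have "Pi_pmf (insert i I) False (\<lambda>_. bernoulli_pmf p) =
      bernoulli_pmf p \<bind> (\<lambda>y. map_pmf (\<lambda>f. f(i := y)) ?P)"
    using assms by (simp add: Pi_pmf_insert' map_pmf_def)
  also have "measure_pmf.expectation \<dots> u =
      (\<Sum>a\<in>UNIV. pmf (bernoulli_pmf p) a *\<^sub>R measure_pmf.expectation (map_pmf (\<lambda>f. f(i := a)) ?P) u)"
    using fin by (intro pmf_expectation_bind) auto
  also have "\<dots> = measure_pmf.expectation ?P (av p i u)"
    unfolding UNIV_bool av_def using p fin
    by (simp add: integrable_measure_pmf_finite)
  finally show ?thesis .
qed

text \<open>The base point fills the coordinates outside the list; it is constantly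
  \<open>False\<close> because that is the default value in \<open>Pi_pmf\<close>.\<close>

lemma expectation_Pi_bernoulli:
  fixes u :: "('i \<Rightarrow> bool) \<Rightarrow> 'b::{banach, second_countable_topology}"
  assumes "distinct is" and p: "0 \<le> p" "p \<le> 1"
  shows "measure_pmf.expectation (Pi_pmf (set is) False (\<lambda>_. bernoulli_pmf p)) u =
    avl p is u (\<lambda>_. False)"
  using assms(1)
proof (induction "is" arbitrary: u)
  case (Cons i "is")
  then show ?case
    using expectation_Pi_bernoulli_insert[of "set is" i p u] p by simp
qed simp

section \<open>Gaussian approximation from small mixed differences\<close>

lemma abs_avl_le_const:
  fixes u :: "('i \<Rightarrow> bool) \<Rightarrow> real"
  assumes p: "0 \<le> p" "p \<le> 1" and u: "\<And>x. \<bar>u x\<bar> \<le> a"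
  shows "\<bar>avl p is u z\<bar> \<le> a"
  using norm_avl_le[OF p, of "is" u z] avl_le_const[OF p, of "\<lambda>x. \<bar>u x\<bar>" a "is" z] u by simp

lemma norm_iexp_minus_linear_le: "norm (exp (\<i> * complex_of_real a) - 1 - \<i> * of_real a) \<le> a\<^sup>2 / 2"
  using iexp_approx1[of a 1] by (simp add: power2_eq_square numeral_2_eq_2 diff_diff_eq)

lemma norm_iexp_minus_one_le: "norm (exp (\<i> * complex_of_real a) - 1) \<le> \<bar>a\<bar>"
  using iexp_approx1[of a 0] by simp

text \<open>Two-level bounds on the differences: \<open>B\<close> holds always, \<open>M\<close>
  only off \<open>bad\<close>. The bound \<open>M\<close> is required after overwriting one further
  coordinate because the product rule evaluates differences at such points. \<open>Q\<close>
  measures, on average and weighted by \<open>p\<close>, how strongly other coordinates influence a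
  given difference. The aim is an error in \<open>M\<close> and \<open>Q\<close> in which
  \<open>B\<close> occurs only next to \<eta>.\<close>

locale sparse_differences =
  fixes p :: real and "is" :: "'i list" and f :: "('i \<Rightarrow> bool) \<Rightarrow> real"
    and bad :: "('i \<Rightarrow> bool) \<Rightarrow> bool" and z :: "'i \<Rightarrow> bool" and B M \<eta> Q :: real
  assumes dist: "distinct is" and p: "0 \<le> p" "p \<le> 1"
    and B: "\<And>i x. i \<in> set is \<Longrightarrow> \<bar>dif i f x\<bar> \<le> B"
    and M: "\<And>i j x b. \<not> bad x \<Longrightarrow> i \<in> set is \<Longrightarrow> j \<in> set is \<Longrightarrow> \<bar>dif i f (x(j := b))\<bar> \<le> M"
    and MB: "0 \<le> M" "M \<le> B"
    and \<eta>: "avl p is (\<lambda>x. of_bool (bad x)) z \<le> \<eta>"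
    and Q: "\<And>i. i \<in> set is \<Longrightarrow> (\<Sum>j\<in>set is. p * avl p is (\<lambda>x. \<bar>dif j (dif i f) x\<bar>) z) \<le> Q"
begin

lemma eta_nonneg: "0 \<le> \<eta>"
  using avl_nonneg[OF p, of "\<lambda>x. of_bool (bad x)" "is" z] \<eta> by simp

lemma dif_upd_le:
  assumes "i \<in> set is" "j \<in> set is"
  shows "\<bar>dif i f (x(j := b))\<bar> \<le> M + B * of_bool (bad x)"
  using M[of x i j b] B[of i "x(j := b)"] assms MB by (cases "bad x") auto

lemma dif_le:
  assumes "i \<in> set is"
  shows "\<bar>dif i f x\<bar> \<le> M + B * of_bool (bad x)"
  using dif_upd_le[OF assms assms, of x True] ignores_dif_same[of i f] by (simp add: ignores_def)

lemma avl_bad_bound: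
  "avl p as (\<lambda>x. a + b * of_bool (bad x) :: real) y = a + b * avl p as (\<lambda>x. of_bool (bad x)) y"
  unfolding avl_add avl_cmult avl_const ..

text \<open>One summand of the covariance between \<open>A i m\<close>, a summand of the variance
  formula, and \<open>h\<close>. The product rule puts the mixed difference into one factor and
  bounds the other by \<open>M\<close> off \<open>bad\<close>; the difference of \<open>h\<close>
  contributes the second \<open>M\<close>. Wherever \<open>bad\<close> intervenes, trivial bounds
  give \<open>B ^ 3\<close>.\<close>

lemma covariance_term_le:
  fixes h :: "('i \<Rightarrow> bool) \<Rightarrow> complex"
  defines "A \<equiv> \<lambda>i m x. avl p (take m is) (dif i f) x * dif i f x"
  assumes i: "i \<in> set is" and j: "j \<in> set is" and \<tau>: "0 \<le> \<tau>"
    and h: "\<And>x. norm (dif j h x) \<le> \<tau> * \<bar>dif j f x\<bar>"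
  shows "avl p is (\<lambda>x. avl p (take l is) (\<lambda>x. \<bar>dif j (A i m) x\<bar>) x * norm (dif j h x)) z
    \<le> \<tau> * (2 * M\<^sup>2 * avl p is (\<lambda>x. \<bar>dif j (dif i f) x\<bar>) z + 6 * B ^ 3 * \<eta>)"
proof -
  define b where "b = (\<lambda>x. of_bool (bad x) :: real)"
  define as where "as = take m is"
  define G where "G = avl p as (dif i f)"
  define d where "d = (\<lambda>x. \<bar>dif j (dif i f) x\<bar>)"
  have b01: "0 \<le> b x" "b x \<le> 1" for x by (auto simp: b_def)
  have B0: "0 \<le> B" using MB by simp
  have G: "\<bar>G x\<bar> \<le> B" for x
    unfolding G_def by (rule abs_avl_le_const[OF p B[OF i]])
  have d: "d x \<le> 2 * B" for x
    using B[OF i, of "x(j := True)"] B[OF i, of "x(j := False)"] by (auto simp: d_def dif_def[of j])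
  have avd: "avl p as d x \<le> 2 * B" for x by (rule avl_le_const[OF p d])
  have "\<bar>dif j (A i m) x\<bar> \<le> M * (avl p as d x + d x) + 2 * B\<^sup>2 * (b x + avl p as b x)" for x
  proof -
    \<comment> \<open>Discrete product rule. It evaluates the factors at overwritten points instead
      of \<open>x\<close>, which is why \<open>dif_upd_le\<close> and \<open>norm_avl_upd_le\<close>
      are needed.\<close>
    have "dif j (A i m) x = dif j G x * dif i f (x(j := True)) + G (x(j := False)) * dif j (dif i f) x"
      unfolding A_def G_def as_def by (simp add: dif_def[of j] algebra_simps)
    also have "\<bar>\<dots>\<bar> \<le> \<bar>dif j G x\<bar> * \<bar>dif i f (x(j := True))\<bar> + \<bar>G (x(j := False))\<bar> * d x"
      by (rule order_trans[OF abs_triangle_ineq]) (simp add: d_def abs_mult)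
    also have "\<dots> \<le> avl p as d x * (M + B * b x) + (M + B * avl p as b x) * d x"
    proof (intro add_mono mult_mono)
      show "\<bar>dif j G x\<bar> \<le> avl p as d x" unfolding G_def d_def by (rule abs_dif_avl_le[OF p])
      show "\<bar>dif i f (x(j := True))\<bar> \<le> M + B * b x" unfolding b_def by (rule dif_upd_le[OF i j])
      have "norm (G (x(j := False))) \<le> avl p as (\<lambda>x. M + B * b x) x"
        unfolding G_def b_def
        by (rule norm_avl_upd_le[OF p]) (unfold real_norm_def, rule dif_upd_le[OF i j])
      then show "\<bar>G (x(j := False))\<bar> \<le> M + B * avl p as b x"
        unfolding b_def avl_bad_bound by simp
      show "0 \<le> avl p as d x" by (rule avl_nonneg[OF p]) (simp add: d_def)
      have "0 \<le> avl p as b x" by (rule avl_nonneg[OF p b01(1)])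
      then show "0 \<le> M + B * avl p as b x" using MB by simp
    qed (auto simp: d_def)
    also have "\<dots> = M * (avl p as d x + d x) + B * (avl p as d x * b x + avl p as b x * d x)"
      by (simp add: algebra_simps)
    also have "\<dots> \<le> M * (avl p as d x + d x) + B * (2 * B * b x + avl p as b x * (2 * B))"
      using avd d b01 avl_nonneg[OF p b01(1)] B0
      by (intro add_left_mono mult_left_mono add_mono mult_right_mono) auto
    finally show ?thesis by (simp add: algebra_simps power2_eq_square)
  qed
  note A1 = this
  have A2: "\<bar>dif j (A i m) x\<bar> \<le> 2 * B\<^sup>2" for x
  proof -
    have "\<bar>A i m y\<bar> \<le> B * B" for y
      using G[of y] B[OF i, of y] B0 unfolding A_def G_def as_def abs_mult
      by (intro mult_mono) auto
    from this[of "x(j := True)"] this[of "x(j := False)"] show ?thesis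
      by (simp add: dif_def[of j] power2_eq_square)
  qed
  define bs where "bs = take l is"
  define w where "w = (\<lambda>x. M * (avl p as d x + d x) + 2 * B\<^sup>2 * (b x + avl p as b x))"
  define v where "v = avl p bs (\<lambda>x. \<bar>dif j (A i m) x\<bar>)"
  have v0: "0 \<le> v x" for x unfolding v_def by (rule avl_nonneg[OF p]) simp
  have v1: "v x \<le> avl p bs w x" for x unfolding v_def w_def by (rule avl_mono[OF p A1])
  have v2: "v x \<le> 2 * B\<^sup>2" for x unfolding v_def by (rule avl_le_const[OF p A2])
  have "v x * norm (dif j h x) \<le> \<tau> * (M * avl p bs w x + 2 * B ^ 3 * b x)" for x
  proof -
    have "v x * norm (dif j h x) \<le> v x * (\<tau> * (M + B * b x))"
      using dif_le[OF j, of x] \<tau> by (intro mult_left_mono v0 order_trans[OF h] mult_left_mono) (auto simp: b_def)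
    also have "\<dots> = \<tau> * (M * v x + B * b x * v x)" by (simp add: algebra_simps)
    also have "\<dots> \<le> \<tau> * (M * avl p bs w x + B * b x * (2 * B\<^sup>2))"
      using v1 v2 MB B0 b01 \<tau> by (intro mult_left_mono add_mono) auto
    finally show ?thesis by (simp add: algebra_simps power2_eq_square power3_eq_cube)
  qed
  then have "avl p is (\<lambda>x. v x * norm (dif j h x)) z
      \<le> avl p is (\<lambda>x. \<tau> * (M * avl p bs w x + 2 * B ^ 3 * b x)) z"
    by (rule avl_mono[OF p])
  also have "\<dots> = \<tau> * (M * avl p is w z + 2 * B ^ 3 * avl p is b z)"
    unfolding bs_def by (simp add: avl_cmult avl_add avl_take)
  also have "avl p is w z = M * (2 * avl p is d z) + 2 * B\<^sup>2 * (2 * avl p is b z)"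
    unfolding w_def as_def by (simp only: avl_cmult avl_add avl_take) simp
  also have "\<tau> * (M * (M * (2 * avl p is d z) + 2 * B\<^sup>2 * (2 * avl p is b z)) + 2 * B ^ 3 * avl p is b z)
      = \<tau> * (2 * M\<^sup>2 * avl p is d z + (4 * (M * B\<^sup>2) + 2 * B ^ 3) * avl p is b z)"
    by (simp add: algebra_simps power2_eq_square)
  also have "\<dots> \<le> \<tau> * (2 * M\<^sup>2 * avl p is d z + (6 * B ^ 3) * \<eta>)"
  proof (intro mult_left_mono \<tau> add_left_mono mult_mono)
    have "M * B\<^sup>2 \<le> B * B\<^sup>2" using MB by (intro mult_right_mono) auto
    then show "4 * (M * B\<^sup>2) + 2 * B ^ 3 \<le> 6 * B ^ 3" by (simp add: power2_eq_square power3_eq_cube)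
    show "avl p is b z \<le> \<eta>" unfolding b_def by (rule \<eta>)
    show "0 \<le> avl p is b z" by (rule avl_nonneg[OF p b01(1)])
  qed (use B0 in auto)
  finally show ?thesis unfolding v_def bs_def d_def by simp
qed

lemma sum_nth_eq_sum_set: "(\<Sum>m<length is. u (is ! m)) = (\<Sum>j\<in>set is. u j)"
  by (rule sum.reindex_bij_betw) (rule bij_betw_nth[OF dist refl refl])

lemma covariance_le:
  fixes h :: "('i \<Rightarrow> bool) \<Rightarrow> complex"
  defines "A \<equiv> \<lambda>i m x. avl p (take m is) (dif i f) x * dif i f x"
  assumes i: "i \<in> set is" and \<tau>: "0 \<le> \<tau>"
    and h: "\<And>j x. j \<in> set is \<Longrightarrow> norm (dif j h x) \<le> \<tau> * \<bar>dif j f x\<bar>"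
  shows "norm (avl p is (\<lambda>x. A i m x *\<^sub>R h x) z - avl p is (A i m) z *\<^sub>R avl p is h z)
    \<le> \<tau> * (2 * M\<^sup>2 * Q + 6 * B ^ 3 * \<eta> * (p * length is))"
proof -
  define D where "D = (\<lambda>j. avl p is (\<lambda>x. \<bar>dif j (dif i f) x\<bar>) z)"
  have "norm (avl p is (\<lambda>x. A i m x *\<^sub>R h x) z - avl p is (A i m) z *\<^sub>R avl p is h z)
      \<le> (\<Sum>l<length is. p * avl p is (\<lambda>x. avl p (take l is) (\<lambda>x. \<bar>dif (is ! l) (A i m) x\<bar>) x *
        norm (dif (is ! l) h x)) z)"
    by (rule norm_avl_covariance_le[OF dist p])
  also have "\<dots> \<le> (\<Sum>l<length is. p * (\<tau> * (2 * M\<^sup>2 * D (is ! l) + 6 * B ^ 3 * \<eta>)))"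
    unfolding A_def D_def using p
    by (intro sum_mono mult_left_mono covariance_term_le[OF i _ \<tau>] h) auto
  also have "\<dots> = (\<Sum>j\<in>set is. p * (\<tau> * (2 * M\<^sup>2 * D j + 6 * B ^ 3 * \<eta>)))"
    by (rule sum_nth_eq_sum_set)
  also have "\<dots> = \<tau> * (2 * M\<^sup>2 * (\<Sum>j\<in>set is. p * D j) + 6 * B ^ 3 * \<eta> * (p * length is))"
    by (simp add: sum_distrib_left sum.distrib algebra_simps distinct_card[OF dist])
  also have "\<dots> \<le> \<tau> * (2 * M\<^sup>2 * Q + 6 * B ^ 3 * \<eta> * (p * length is))"
    using Q[OF i] \<tau> unfolding D_def by (intro mult_left_mono add_right_mono) auto
  finally show ?thesis .
qed

text \<open>This controls the Taylor remainder: off \<open>bad\<close> each of the three factors is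
  at most \<open>M\<close>. The partial average also sees points other than \<open>x\<close>, so it
  brings its own average of \<open>bad\<close>, which \<open>avl_take\<close> merges into the full
  average.\<close>

lemma third_moment_le:
  assumes i: "i \<in> set is"
  shows "avl p is (\<lambda>x. \<bar>avl p (take m is) (dif i f) x\<bar> * (dif i f x)\<^sup>2) z \<le> M ^ 3 + 2 * B ^ 3 * \<eta>"
proof -
  define b where "b = (\<lambda>x. of_bool (bad x) :: real)"
  define G where "G = avl p (take m is) (dif i f)"
  have b01: "0 \<le> b x" "b x \<le> 1" "b x * b x = b x" for x by (auto simp: b_def)
  have B0: "0 \<le> B" using MB by simp
  have G: "\<bar>G x\<bar> \<le> B" for x
    unfolding G_def by (rule abs_avl_le_const[OF p B[OF i]])
  have G2: "\<bar>G x\<bar> \<le> M + B * avl p (take m is) b x" for x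
  proof -
    have "\<bar>G x\<bar> \<le> avl p (take m is) (\<lambda>x. \<bar>dif i f x\<bar>) x"
      unfolding G_def using norm_avl_le[OF p, of "take m is" "dif i f" x] by simp
    also have "\<dots> \<le> avl p (take m is) (\<lambda>x. M + B * b x) x"
      unfolding b_def by (rule avl_mono[OF p dif_le[OF i]])
    finally show ?thesis unfolding b_def avl_bad_bound .
  qed
  have sq: "(dif i f x)\<^sup>2 \<le> M\<^sup>2 + B\<^sup>2 * b x" for x
  proof (cases "bad x")
    case True
    have "(dif i f x)\<^sup>2 \<le> B\<^sup>2" using B[OF i, of x] B0 by (simp add: abs_le_square_iff[symmetric])
    then show ?thesis using True by (simp add: b_def add_increasing)
  next
    case False
    then show ?thesis using dif_le[OF i, of x] MB by (simp add: b_def abs_le_square_iff[symmetric])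
  qed
  have "\<bar>G x\<bar> * (dif i f x)\<^sup>2 \<le> M\<^sup>2 * (M + B * avl p (take m is) b x) + B ^ 3 * b x" for x
  proof -
    have "\<bar>G x\<bar> * (dif i f x)\<^sup>2 \<le> \<bar>G x\<bar> * (M\<^sup>2 + B\<^sup>2 * b x)"
      using sq by (intro mult_left_mono) auto
    also have "\<dots> = M\<^sup>2 * \<bar>G x\<bar> + \<bar>G x\<bar> * (B\<^sup>2 * b x)" by (simp add: algebra_simps)
    also have "\<dots> \<le> M\<^sup>2 * (M + B * avl p (take m is) b x) + B * (B\<^sup>2 * b x)"
      using G G2 b01 B0 by (intro add_mono mult_left_mono mult_right_mono) auto
    finally show ?thesis by (simp add: power2_eq_square power3_eq_cube algebra_simps)
  qed
  then have "avl p is (\<lambda>x. \<bar>G x\<bar> * (dif i f x)\<^sup>2) z \<le>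
      avl p is (\<lambda>x. M\<^sup>2 * (M + B * avl p (take m is) b x) + B ^ 3 * b x) z"
    by (rule avl_mono[OF p])
  also have "\<dots> = M\<^sup>2 * (M + B * avl p is b z) + B ^ 3 * avl p is b z"
    by (simp add: avl_add avl_cmult avl_take)
  also have "\<dots> = M ^ 3 + (M\<^sup>2 * B + B ^ 3) * avl p is b z"
    by (simp add: power2_eq_square power3_eq_cube algebra_simps)
  also have "\<dots> \<le> M ^ 3 + (2 * B ^ 3) * \<eta>"
  proof (intro add_left_mono mult_mono)
    have "M\<^sup>2 * B \<le> B\<^sup>2 * B" using MB by (intro mult_right_mono power_mono) auto
    then show "M\<^sup>2 * B + B ^ 3 \<le> 2 * B ^ 3" by (simp add: power2_eq_square power3_eq_cube)
    show "avl p is b z \<le> \<eta>" unfolding b_def by (rule \<eta>)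
    show "0 \<le> avl p is b z" by (rule avl_nonneg[OF p b01(1)])
  qed (use B0 in auto)
  finally show ?thesis unfolding G_def .
qed


text \<open>The first average is the derivative at \<open>t\<close> of the characteristic function
  of W. In the covariance formula for \<open>f\<close> and \<open>h\<close>, the linear part of the
  difference of \<open>h\<close> leaves averages of \<open>A m\<close> times \<open>h\<close>; if
  these factorised, \<open>var'\<close> would give exactly the Gaussian equation. \<open>E1\<close>
  collects the failure to factorise and \<open>E2\<close> the Taylor remainders. Each contributes a
  term of order \<open>t\<^sup>2\<close>.\<close>

lemma char_derivative_le:
  fixes \<sigma> t :: real
  defines "\<mu> \<equiv> avl p is f z"
  defines "h \<equiv> \<lambda>x. exp (\<i> * complex_of_real (t * ((f x - \<mu>) / \<sigma>)))"
  defines "K \<equiv> p * length is / \<sigma> ^ 3 *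
    (2 * M\<^sup>2 * Q + 6 * B ^ 3 * \<eta> * (p * length is) + (M ^ 3 + 2 * B ^ 3 * \<eta>) / 2)"
  assumes \<sigma>: "\<sigma> > 0" and var: "avl p is (\<lambda>x. (f x - \<mu>)\<^sup>2) z = \<sigma>\<^sup>2"
  shows "norm (avl p is (\<lambda>x. (\<i> * of_real ((f x - \<mu>) / \<sigma>)) * h x) z + of_real t * avl p is h z)
    \<le> t\<^sup>2 * K"
proof -
  define N where "N = length is"
  define g where "g = (\<lambda>m. avl p (take m is) (dif (is ! m) f))"
  define A where "A = (\<lambda>m x. g m x * dif (is ! m) f x)"
  define \<phi> where "\<phi> = avl p is h z"
  define r where "r = (\<lambda>m x. dif (is ! m) h x - (t / \<sigma> * dif (is ! m) f x) *\<^sub>R (\<i> * h x))"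
  define X where "X = 2 * M\<^sup>2 * Q + 6 * B ^ 3 * \<eta> * (p * N)"
  define Y where "Y = M ^ 3 + 2 * B ^ 3 * \<eta>"
  have mem: "is ! m \<in> set is" if "m < N" for m using that by (simp add: N_def)
  have norm_h: "norm (h x) = 1" for x by (simp add: h_def)
  have h_ratio: "h x = h y * exp (\<i> * of_real (t / \<sigma> * (f x - f y)))" for x y
  proof -
    have "t * ((f x - \<mu>) / \<sigma>) = t * ((f y - \<mu>) / \<sigma>) + t / \<sigma> * (f x - f y)"
      using \<sigma> by (simp add: field_simps)
    then show ?thesis by (simp only: h_def of_real_add distrib_left exp_add)
  qed
  have norm_dif_h: "norm (dif j h x) \<le> \<bar>t\<bar> / \<sigma> * \<bar>dif j f x\<bar>" for j x
  proof -
    have "dif j h x = h (x(j := False)) * (exp (\<i> * of_real (t / \<sigma> * dif j f x)) - 1)"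
      unfolding dif_def using h_ratio[of "x(j := True)" "x(j := False)"] by (simp add: algebra_simps)
    then have "norm (dif j h x) = norm (exp (\<i> * of_real (t / \<sigma> * dif j f x)) - 1)"
      by (simp add: norm_mult norm_h)
    also have "\<dots> \<le> \<bar>t / \<sigma> * dif j f x\<bar>" by (rule norm_iexp_minus_one_le)
    finally show ?thesis using \<sigma> by (simp add: abs_mult)
  qed
  \<comment> \<open>\<open>x\<close> is itself one of the two endpoints of the flip. Expanding
    around that endpoint keeps the factor \<open>h x\<close>, so that the main term is an average of
    \<open>A m\<close> times \<open>h\<close>; hence the two cases.\<close>
  have norm_r: "norm (r m x) \<le> (t / \<sigma> * dif (is ! m) f x)\<^sup>2 / 2" for m x
  proof -
    let ?i = "is ! m" and ?a = "t / \<sigma> * dif (is ! m) f x"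
    show ?thesis
    proof (cases "x ?i")
      case True
      then have x: "x(?i := True) = x" by (auto simp: fun_eq_iff)
      have "h (x(?i := False)) = h x * exp (\<i> * of_real (- ?a))"
        using h_ratio[of "x(?i := False)" x] unfolding dif_def x by (simp add: algebra_simps)
      then have "r m x = h x * - (exp (\<i> * of_real (- ?a)) - 1 - \<i> * of_real (- ?a))"
        unfolding r_def dif_def[of ?i h] x by (simp add: scaleR_conv_of_real algebra_simps)
      then have "norm (r m x) = norm (exp (\<i> * of_real (- ?a)) - 1 - \<i> * of_real (- ?a))"
        by (simp only: norm_mult norm_h norm_minus_cancel mult_1)
      also have "\<dots> \<le> (- ?a)\<^sup>2 / 2" by (rule norm_iexp_minus_linear_le)
      finally show ?thesis by simp
    next
      case False
      then have x: "x(?i := False) = x" by (auto simp: fun_eq_iff)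
      have "h (x(?i := True)) = h x * exp (\<i> * of_real ?a)"
        using h_ratio[of "x(?i := True)" x] unfolding dif_def x by (simp add: algebra_simps)
      then have "r m x = h x * (exp (\<i> * of_real ?a) - 1 - \<i> * of_real ?a)"
        unfolding r_def dif_def[of ?i h] x by (simp add: scaleR_conv_of_real algebra_simps)
      then have "norm (r m x) = norm (exp (\<i> * of_real ?a) - 1 - \<i> * of_real ?a)"
        by (simp only: norm_mult norm_h mult_1)
      also have "\<dots> \<le> ?a\<^sup>2 / 2" by (rule norm_iexp_minus_linear_le)
      finally show ?thesis .
    qed
  qed
  \<comment> \<open>The covariance formula applied to \<open>f\<close> with itself.\<close>
  have var': "(\<Sum>m<N. p * (1 - p) * avl p is (A m) z) = \<sigma>\<^sup>2"
  proof -
    have "avl p is (\<lambda>x. f x *\<^sub>R f x) z = avl p is f z *\<^sub>R avl p is f z +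
        (\<Sum>m<N. (p * (1 - p)) *\<^sub>R avl p is (A m) z)"
      using avl_covariance[OF dist, of p f f z] by (simp add: N_def A_def g_def)
    moreover have "avl p is (\<lambda>x. (f x - \<mu>)\<^sup>2) z = avl p is (\<lambda>x. f x *\<^sub>R f x) z - \<mu> * \<mu>"
    proof -
      have "(\<lambda>x. (f x - \<mu>)\<^sup>2) = (\<lambda>x. (f x * f x - 2 * \<mu> * f x) + \<mu> * \<mu>)"
        by (simp add: power2_eq_square algebra_simps)
      then have "avl p is (\<lambda>x. (f x - \<mu>)\<^sup>2) z = avl p is (\<lambda>x. f x * f x) z - 2 * \<mu> * \<mu> + \<mu> * \<mu>"
        by (simp only: avl_add avl_diff avl_cmult avl_const \<mu>_def)
      then show ?thesis by simp
    qed
    ultimately show ?thesis using var by (simp add: \<mu>_def)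
  qed
  define E1 where "E1 = (\<Sum>m<N. (p * (1 - p)) *\<^sub>R
    (avl p is (\<lambda>x. A m x *\<^sub>R h x) z - avl p is (A m) z *\<^sub>R \<phi>))"
  define E2 where "E2 = (\<Sum>m<N. (p * (1 - p)) *\<^sub>R avl p is (\<lambda>x. g m x *\<^sub>R r m x) z)"
  have pp: "0 \<le> p * (1 - p)" "p * (1 - p) \<le> p" using p by (auto simp: mult_left_le)
  have E1: "norm E1 \<le> p * N * (\<bar>t\<bar> / \<sigma> * X)"
  proof -
    have "norm E1 \<le> (\<Sum>m<N. p * (\<bar>t\<bar> / \<sigma> * X))"
      unfolding E1_def
    proof (rule sum_norm_le)
      fix m assume "m \<in> {..<N}"
      then have "norm (avl p is (\<lambda>x. A m x *\<^sub>R h x) z - avl p is (A m) z *\<^sub>R \<phi>) \<le> \<bar>t\<bar> / \<sigma> * X"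
        unfolding A_def g_def \<phi>_def X_def N_def using \<sigma>
        by (intro covariance_le norm_dif_h) auto
      then show "norm ((p * (1 - p)) *\<^sub>R (avl p is (\<lambda>x. A m x *\<^sub>R h x) z - avl p is (A m) z *\<^sub>R \<phi>))
          \<le> p * (\<bar>t\<bar> / \<sigma> * X)"
        using pp p unfolding norm_scaleR by (intro mult_mono) auto
    qed
    then show ?thesis by (simp add: mult_ac)
  qed
  have E2: "norm E2 \<le> p * N * (t\<^sup>2 / (2 * \<sigma>\<^sup>2) * Y)"
  proof -
    have "norm E2 \<le> (\<Sum>m<N. p * (t\<^sup>2 / (2 * \<sigma>\<^sup>2) * Y))"
      unfolding E2_def
    proof (rule sum_norm_le)
      fix m assume m: "m \<in> {..<N}"
      have "norm (avl p is (\<lambda>x. g m x *\<^sub>R r m x) z) \<le> avl p is (\<lambda>x. norm (g m x *\<^sub>R r m x)) z"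
        by (rule norm_avl_le[OF p])
      also have "\<dots> \<le> avl p is (\<lambda>x. t\<^sup>2 / (2 * \<sigma>\<^sup>2) * (\<bar>g m x\<bar> * (dif (is ! m) f x)\<^sup>2)) z"
      proof (rule avl_mono[OF p])
        fix x
        have "norm (g m x *\<^sub>R r m x) \<le> \<bar>g m x\<bar> * ((t / \<sigma> * dif (is ! m) f x)\<^sup>2 / 2)"
          unfolding norm_scaleR by (intro mult_left_mono norm_r) auto
        then show "norm (g m x *\<^sub>R r m x) \<le> t\<^sup>2 / (2 * \<sigma>\<^sup>2) * (\<bar>g m x\<bar> * (dif (is ! m) f x)\<^sup>2)"
          by (simp add: power_mult_distrib power_divide mult_ac)
      qed
      also have "\<dots> \<le> t\<^sup>2 / (2 * \<sigma>\<^sup>2) * Y"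
        unfolding avl_cmult g_def Y_def using m mem by (intro mult_left_mono third_moment_le) auto
      finally show "norm ((p * (1 - p)) *\<^sub>R avl p is (\<lambda>x. g m x *\<^sub>R r m x) z) \<le> p * (t\<^sup>2 / (2 * \<sigma>\<^sup>2) * Y)"
        using pp p unfolding norm_scaleR by (intro mult_mono) auto
    qed
    then show ?thesis by (simp add: mult_ac)
  qed
  have split: "avl p is (\<lambda>x. g m x *\<^sub>R dif (is ! m) h x) z =
      (t / \<sigma>) *\<^sub>R (\<i> * avl p is (\<lambda>x. A m x *\<^sub>R h x) z) + avl p is (\<lambda>x. g m x *\<^sub>R r m x) z" for m
  proof -
    have "(\<lambda>x. g m x *\<^sub>R dif (is ! m) h x) =
        (\<lambda>x. (t / \<sigma>) *\<^sub>R (\<i> * (A m x *\<^sub>R h x)) + g m x *\<^sub>R r m x)"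
      by (simp add: r_def A_def scaleR_conv_of_real algebra_simps)
    moreover have "avl p is (\<lambda>x. (t / \<sigma>) *\<^sub>R (\<i> * (A m x *\<^sub>R h x))) z =
        (t / \<sigma>) *\<^sub>R (\<i> * avl p is (\<lambda>x. A m x *\<^sub>R h x) z)"
      unfolding avl_scaleR[of p "is" "t / \<sigma>"]
      by (subst avl_linear[OF bounded_linear_mult_right]) simp
    ultimately show ?thesis by (simp only: avl_add)
  qed
  have "avl p is (\<lambda>x. f x *\<^sub>R h x) z - \<mu> *\<^sub>R \<phi> =
      (\<Sum>m<N. (p * (1 - p)) *\<^sub>R avl p is (\<lambda>x. g m x *\<^sub>R dif (is ! m) h x) z)"
    unfolding avl_covariance[OF dist, of p f h z] by (simp add: \<mu>_def \<phi>_def N_def g_def)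
  also have "\<dots> = (t / \<sigma>) *\<^sub>R (\<i> * (\<Sum>m<N. (p * (1 - p)) *\<^sub>R avl p is (\<lambda>x. A m x *\<^sub>R h x) z)) + E2"
    unfolding split E2_def
    by (simp add: scaleR_right_distrib sum.distrib sum_distrib_left scaleR_right.sum mult_ac)
  also have "(\<Sum>m<N. (p * (1 - p)) *\<^sub>R avl p is (\<lambda>x. A m x *\<^sub>R h x) z) = \<sigma>\<^sup>2 *\<^sub>R \<phi> + E1"
  proof -
    have "\<sigma>\<^sup>2 *\<^sub>R \<phi> = (\<Sum>m<N. (p * (1 - p)) *\<^sub>R (avl p is (A m) z *\<^sub>R \<phi>))"
      unfolding var'[symmetric] by (simp add: scaleR_left.sum)
    then show ?thesis by (simp add: E1_def scaleR_right_diff_distrib sum_subtractf)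
  qed
  finally have cov: "avl p is (\<lambda>x. f x *\<^sub>R h x) z - \<mu> *\<^sub>R \<phi> =
      (t / \<sigma>) *\<^sub>R (\<i> * (\<sigma>\<^sup>2 *\<^sub>R \<phi> + E1)) + E2" .
  have "avl p is (\<lambda>x. (\<i> * of_real ((f x - \<mu>) / \<sigma>)) * h x) z =
      \<i> * ((1 / \<sigma>) *\<^sub>R (avl p is (\<lambda>x. f x *\<^sub>R h x) z - \<mu> *\<^sub>R \<phi>))"
  proof -
    have "(\<lambda>x. (\<i> * of_real ((f x - \<mu>) / \<sigma>)) * h x) =
        (\<lambda>x. \<i> * ((1 / \<sigma>) *\<^sub>R (f x *\<^sub>R h x - \<mu> *\<^sub>R h x)))"
      by (simp add: scaleR_conv_of_real algebra_simps diff_divide_distrib)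
    moreover have "avl p is (\<lambda>x. \<i> * ((1 / \<sigma>) *\<^sub>R (f x *\<^sub>R h x - \<mu> *\<^sub>R h x))) z =
        \<i> * avl p is (\<lambda>x. (1 / \<sigma>) *\<^sub>R (f x *\<^sub>R h x - \<mu> *\<^sub>R h x)) z"
      by (rule avl_linear[OF bounded_linear_mult_right])
    ultimately show ?thesis
      by (simp only: avl_scaleR[of p "is" "1 / \<sigma>"] avl_diff avl_scaleR[of p "is" \<mu>] \<phi>_def)
  qed
  also have "\<dots> = - (of_real t * \<phi>) - (t / \<sigma>\<^sup>2) *\<^sub>R E1 + \<i> * ((1 / \<sigma>) *\<^sub>R E2)"
    unfolding cov using \<sigma>
    by (simp add: scaleR_conv_of_real field_simps power2_eq_square)
  finally have "avl p is (\<lambda>x. (\<i> * of_real ((f x - \<mu>) / \<sigma>)) * h x) z + of_real t * \<phi> =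
      \<i> * ((1 / \<sigma>) *\<^sub>R E2) - (t / \<sigma>\<^sup>2) *\<^sub>R E1" by simp
  also have "norm \<dots> \<le> (1 / \<sigma>) * norm E2 + (\<bar>t\<bar> / \<sigma>\<^sup>2) * norm E1"
    using \<sigma> by (intro order_trans[OF norm_triangle_ineq4]) (simp add: norm_mult)
  also have "\<dots> \<le> (1 / \<sigma>) * (p * N * (t\<^sup>2 / (2 * \<sigma>\<^sup>2) * Y)) + (\<bar>t\<bar> / \<sigma>\<^sup>2) * (p * N * (\<bar>t\<bar> / \<sigma> * X))"
    using \<sigma> by (intro add_mono mult_left_mono E1 E2) auto
  also have "\<dots> = t\<^sup>2 * K"
    unfolding K_def X_def[symmetric, unfolded N_def] Y_def[symmetric] N_def using \<sigma>
    by (simp add: field_simps power2_eq_square power3_eq_cube abs_mult_self_eq)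
  finally show ?thesis unfolding \<phi>_def .
qed

end

text \<open>The integrating factor \<open>exp (s\<^sup>2 / 2)\<close> turns the approximate equation
  for \<phi> into a bound on the derivative of \<psi>. The mean value inequality between 0 and
  \<open>t\<close> costs \<open>exp (t\<^sup>2 / 2)\<close>, which is removed again on returning to
  \<phi>.\<close>

lemma norm_minus_gaussian_le:
  fixes \<phi> \<phi>' :: "real \<Rightarrow> complex"
  assumes deriv: "\<And>s. (\<phi> has_vector_derivative \<phi>' s) (at s)"
    and le: "\<And>s. norm (\<phi>' s + of_real s * \<phi> s) \<le> s\<^sup>2 * K"
    and "\<phi> 0 = 1"
  shows "norm (\<phi> t - exp (- (t\<^sup>2) / 2)) \<le> \<bar>t\<bar> ^ 3 * K"
proof -
  define \<psi> where "\<psi> = (\<lambda>s. exp (s\<^sup>2 / 2) *\<^sub>R \<phi> s)"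
  have K: "0 \<le> K" using order_trans[OF norm_ge_zero le[of 1]] by simp
  have \<psi>': "(\<psi> has_vector_derivative exp (s\<^sup>2 / 2) *\<^sub>R (\<phi>' s + of_real s * \<phi> s)) (at s)" for s
  proof -
    have "((\<lambda>s. exp (s\<^sup>2 / 2)) has_real_derivative exp (s\<^sup>2 / 2) * s) (at s)"
      by (auto intro!: derivative_eq_intros)
    then show ?thesis unfolding \<psi>_def
      by (rule has_vector_derivative_eq_rhs[OF has_vector_derivative_scaleR[OF _ deriv]])
        (simp add: scaleR_conv_of_real algebra_simps)
  qed
  define D where "D = (\<lambda>s. exp (s\<^sup>2 / 2) *\<^sub>R (\<phi>' s + of_real s * \<phi> s))"
  define C where "C = exp (t\<^sup>2 / 2) * (t\<^sup>2 * K)"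
  have D: "norm (D s) \<le> C" if "s \<in> closed_segment 0 t" for s
  proof -
    have "\<bar>s\<bar> \<le> \<bar>t\<bar>" using that by (auto simp: closed_segment_eq_real_ivl split: if_splits)
    then have st: "s\<^sup>2 \<le> t\<^sup>2" by (simp add: abs_le_square_iff)
    have "norm (D s) \<le> exp (s\<^sup>2 / 2) * (s\<^sup>2 * K)"
      unfolding D_def norm_scaleR abs_exp_cancel by (rule mult_left_mono[OF le]) simp
    also have "\<dots> \<le> C" unfolding C_def using K st by (intro mult_mono) auto
    finally show ?thesis .
  qed
  have "norm (\<psi> t - \<psi> 0) \<le> C * norm (t - 0)"
  proof (rule differentiable_bound)
    show "convex (closed_segment 0 t)" by simp
    show "(\<psi> has_derivative (\<lambda>y. y *\<^sub>R D s)) (at s within closed_segment 0 t)" for s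
      using \<psi>'[of s] unfolding has_vector_derivative_def D_def by (rule has_derivative_at_withinI)
    show "onorm (\<lambda>y. y *\<^sub>R D s) \<le> C" if "s \<in> closed_segment 0 t" for s
      using D[OF that] by (simp add: onorm_scaleR_left[OF bounded_linear_ident] onorm_id)
  qed auto
  then have "norm (\<psi> t - \<psi> 0) \<le> exp (t\<^sup>2 / 2) * (t\<^sup>2 * K) * \<bar>t\<bar>" by (simp add: C_def)
  then have "exp (- (t\<^sup>2) / 2) * norm (\<psi> t - \<psi> 0) \<le>
      exp (- (t\<^sup>2) / 2) * (exp (t\<^sup>2 / 2) * (t\<^sup>2 * K) * \<bar>t\<bar>)"
    by (intro mult_left_mono) auto
  also have "\<dots> = \<bar>t\<bar> ^ 3 * K"
    by (simp add: power3_eq_cube power2_eq_square flip: exp_add mult.assoc)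
  also have "exp (- (t\<^sup>2) / 2) * norm (\<psi> t - \<psi> 0) = norm (exp (- (t\<^sup>2) / 2) *\<^sub>R (\<psi> t - \<psi> 0))"
    by simp
  also have "exp (- (t\<^sup>2) / 2) *\<^sub>R (\<psi> t - \<psi> 0) = \<phi> t - exp (- (t\<^sup>2) / 2)"
  proof -
    have "exp (- (t\<^sup>2 / 2)) * exp (t\<^sup>2 / 2) = 1" by (simp flip: exp_add)
    then show ?thesis using \<open>\<phi> 0 = 1\<close>
      by (simp add: \<psi>_def scaleR_right_diff_distrib) (simp add: scaleR_conv_of_real)
  qed
  finally show ?thesis .
qed

section \<open>The k-core and its complement\<close>

text \<open>\<open>x\<close> is an arbitrary Boolean function on sets, so
  \<open>w \<noteq> v\<close> keeps the singleton \<open>{v, v}\<close> from counting as an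
  edge.\<close>

definition nb :: "('a set \<Rightarrow> bool) \<Rightarrow> 'a set \<Rightarrow> 'a \<Rightarrow> 'a set" where
  "nb x S v = {w \<in> S. w \<noteq> v \<and> x {v, w}}"

text \<open>With vertex sets and induced degrees, a set is placed inside the core merely by checking
  degrees within it. The ground set is a parameter because the variance bound uses the core after
  the deletion of a vertex.\<close>

definition kcore :: "nat \<Rightarrow> 'a set \<Rightarrow> ('a set \<Rightarrow> bool) \<Rightarrow> 'a set" where
  "kcore k V x = \<Union>{S. S \<subseteq> V \<and> (\<forall>v\<in>S. k \<le> card (nb x S v))}"

lemma finite_nb: "finite S \<Longrightarrow> finite (nb x S v)"
  by (simp add: nb_def)

lemma card_nb_mono:
  assumes "finite T" "S \<subseteq> T" "\<And>w. w \<in> S \<Longrightarrow> w \<noteq> v \<Longrightarrow> x {v, w} \<Longrightarrow> y {v, w}"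
  shows "card (nb x S v) \<le> card (nb y T v)"
  using assms by (intro card_mono finite_nb) (auto simp: nb_def)

lemma kcore_subset: "kcore k V x \<subseteq> V"
  by (auto simp: kcore_def)

lemma finite_kcore: "finite V \<Longrightarrow> finite (kcore k V x)"
  using kcore_subset finite_subset by metis

lemma kcore_maximal: "S \<subseteq> V \<Longrightarrow> (\<And>v. v \<in> S \<Longrightarrow> k \<le> card (nb x S v)) \<Longrightarrow> S \<subseteq> kcore k V x"
  by (auto simp: kcore_def)

lemma kcore_degree:
  assumes "finite V" "v \<in> kcore k V x"
  shows "k \<le> card (nb x (kcore k V x) v)"
proof -
  obtain S where S: "S \<subseteq> V" "\<forall>v\<in>S. k \<le> card (nb x S v)" "v \<in> S"
    using assms(2) by (auto simp: kcore_def)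
  then have "S \<subseteq> kcore k V x" by (intro kcore_maximal) auto
  then have "card (nb x S v) \<le> card (nb x (kcore k V x) v)"
    by (intro card_nb_mono finite_kcore assms)
  then show ?thesis using S by force
qed

lemma kcore_mono:
  assumes "finite W" "V \<subseteq> W" "\<And>e. x e \<Longrightarrow> y e"
  shows "kcore k V x \<subseteq> kcore k W y"
proof (rule kcore_maximal)
  show "kcore k V x \<subseteq> W" using kcore_subset assms(2) by fastforce
  have V: "finite V" using assms finite_subset by metis
  fix v assume "v \<in> kcore k V x"
  then have "k \<le> card (nb x (kcore k V x) v)" by (rule kcore_degree[OF V])
  also have "\<dots> \<le> card (nb y (kcore k V x) v)"
    by (intro card_nb_mono finite_kcore V assms) auto
  finally show "k \<le> card (nb y (kcore k V x) v)" .
qed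

text \<open>The vertex set of any subgraph of minimum degree at least \<open>k\<close> competes in
  the union defining \<open>kcore\<close>. The subgraph induced on \<open>kcore k V x\<close> is
  therefore the greatest such subgraph, and uniqueness identifies it with
  \<open>k_core\<close>.\<close>

lemma verts_k_core_eq_kcore:
  assumes V: "finite V"
  shows "verts (k_core k (Ugraph V {e \<in> [V]\<^bsup>2\<^esup>. x e})) = kcore k V x"
proof -
  define G where "G = Ugraph V {e \<in> [V]\<^bsup>2\<^esup>. x e}"
  define H where "H = Ugraph (kcore k V x) {e \<in> [kcore k V x]\<^bsup>2\<^esup>. x e}"
  have G: "simple_graph G" using V by (auto simp: simple_graph_def G_def)
  have deg: "degree F v = card {w. w \<noteq> v \<and> {v, w} \<in> edges F}" if F: "simple_graph F" for F :: "'a ugraph" and v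
  proof -
    have "bij_betw (\<lambda>w. {v, w}) {w. w \<noteq> v \<and> {v, w} \<in> edges F} {e \<in> edges F. v \<in> e}"
    proof (rule bij_betwI')
      fix e assume "e \<in> {e \<in> edges F. v \<in> e}"
      moreover from this F obtain a b where "e = {a, b}" "a \<noteq> b"
        by (auto simp: simple_graph_def nsets_def card_2_iff dest!: subsetD)
      ultimately show "\<exists>w\<in>{w. w \<noteq> v \<and> {v, w} \<in> edges F}. e = {v, w}"
        by (auto simp: insert_commute)
    qed (auto simp: doubleton_eq_iff)
    then show ?thesis unfolding degree_def by (rule bij_betw_same_card[symmetric])
  qed
  have HG: "is_subgraph H G"
    using G kcore_subset[of k V x] finite_kcore[OF V, of k x]
    by (auto simp: is_subgraph_def simple_graph_def H_def G_def nsets_def)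
  have Hmin: "min_degree_at_least k H"
    unfolding min_degree_at_least_def
  proof
    fix v assume "v \<in> verts H"
    then have v: "v \<in> kcore k V x" by (simp add: H_def)
    have "nb x (kcore k V x) v = {w. w \<noteq> v \<and> {v, w} \<in> edges H}"
      using v by (auto simp: nb_def H_def nsets_def card_2_iff doubleton_eq_iff)
    then show "k \<le> degree H v"
      using kcore_degree[OF V v] HG by (simp add: deg is_subgraph_def)
  qed
  have sub: "is_subgraph F H" if F: "is_subgraph F G" "min_degree_at_least k F" for F
  proof -
    have sF: "simple_graph F" using F by (simp add: is_subgraph_def)
    then have fF: "finite (verts F)" by (simp add: simple_graph_def)
    have "verts F \<subseteq> kcore k V x"
    proof (rule kcore_maximal)
      show "verts F \<subseteq> V" using F by (simp add: is_subgraph_def G_def)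
      fix v assume v: "v \<in> verts F"
      then have "k \<le> degree F v" using F by (simp add: min_degree_at_least_def)
      also have "\<dots> \<le> card (nb x (verts F) v)"
        unfolding deg[OF sF]
      proof (intro card_mono finite_nb fF subsetI)
        fix w assume w: "w \<in> {w. w \<noteq> v \<and> {v, w} \<in> edges F}"
        then have "{v, w} \<in> edges G" "{v, w} \<in> [verts F]\<^bsup>2\<^esup>"
          using F sF by (auto simp: is_subgraph_def simple_graph_def)
        then show "w \<in> nb x (verts F) v" using w by (auto simp: nb_def G_def nsets_def)
      qed
      finally show "k \<le> card (nb x (verts F) v)" .
    qed
    moreover have "edges F \<subseteq> edges H"
    proof
      fix e assume "e \<in> edges F"
      then have "e \<in> edges G" "e \<in> [verts F]\<^bsup>2\<^esup>"
        using F sF by (auto simp: is_subgraph_def simple_graph_def)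
      then show "e \<in> edges H"
        using \<open>verts F \<subseteq> kcore k V x\<close> by (auto simp: H_def G_def nsets_def)
    qed
    ultimately show ?thesis using sF HG by (simp add: is_subgraph_def H_def)
  qed
  have "is_k_core k G H"
    unfolding is_k_core_def using HG Hmin sub
    by (auto simp: is_subgraph_def intro!: ugraph.expand)
  then have "k_core k G = H"
    unfolding k_core_def using ex1_k_core[OF G] by (rule the1_equality[rotated])
  then show ?thesis by (simp add: G_def H_def)
qed

text \<open>With \<open>x' = x\<close> the conclusion says that \<open>P\<close> stays outside the core when edges are added
  that do not touch \<open>P\<close>.\<close>

lemma kcore_local:
  assumes V: "finite V" and le: "\<And>e. x e \<Longrightarrow> x' e" and P: "P \<subseteq> V"
    and cross: "\<And>u w. u \<in> P \<Longrightarrow> w \<in> V - kcore k V x - P \<Longrightarrow> \<not> x' {u, w}"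
    and y: "\<And>u w. u \<in> P \<Longrightarrow> w \<in> V \<Longrightarrow> y {u, w} \<Longrightarrow> x' {u, w}"
  shows "kcore k V y \<inter> P \<subseteq> kcore k V x'"
proof -
  \<comment> \<open>Witness for maximality: a vertex of \<open>P\<close> keeps all its neighbours in
    \<open>kcore k V y\<close>, because \<open>cross\<close> confines them to the old core and
    \<open>P\<close>.\<close>
  define S where "S = kcore k V x \<union> (kcore k V y \<inter> P)"
  have SV: "S \<subseteq> V" using kcore_subset[of k V x] P by (auto simp: S_def)
  have fS: "finite S" using SV V finite_subset by metis
  have "S \<subseteq> kcore k V x'"
  proof (rule kcore_maximal[OF SV])
    fix v assume "v \<in> S"
    then consider "v \<in> kcore k V x" | "v \<in> kcore k V y" "v \<in> P" by (auto simp: S_def)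
    then show "k \<le> card (nb x' S v)"
    proof cases
      case 1
      have "card (nb x (kcore k V x) v) \<le> card (nb x' S v)"
        using le by (intro card_nb_mono fS) (auto simp: S_def)
      then show ?thesis using kcore_degree[OF V 1] by linarith
    next
      case 2
      have "nb y (kcore k V y) v \<subseteq> nb x' S v"
        using y[OF 2(2)] cross[OF 2(2)] kcore_subset[of k V y] by (auto simp: nb_def S_def)
      then have "card (nb y (kcore k V y) v) \<le> card (nb x' S v)" by (intro card_mono finite_nb fS)
      then show ?thesis using kcore_degree[OF V 2(1)] by linarith
    qed
  qed
  then show ?thesis by (auto simp: S_def)
qed

section \<open>Components outside the core and breadth-first search\<close>

definition adjs :: "('a set \<Rightarrow> bool) \<Rightarrow> 'a set \<Rightarrow> ('a \<times> 'a) set" where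
  "adjs x Z = {(u, v). u \<in> Z \<and> v \<in> Z \<and> u \<noteq> v \<and> x {u, v}}"

text \<open>For \<open>a \<notin> Z\<close> the reflexive closure would return \<open>{a}\<close>;
  the intersection with \<open>Z\<close> makes the component empty, so endpoints of an edge that lie
  in the core contribute nothing to \<open>affected\<close>.\<close>

definition component :: "('a set \<Rightarrow> bool) \<Rightarrow> 'a set \<Rightarrow> 'a \<Rightarrow> 'a set" where
  "component x Z a = Z \<inter> (adjs x Z)\<^sup>* `` {a}"

lemma component_subset: "component x Z a \<subseteq> Z"
  by (auto simp: component_def)

lemma mem_component_self: "a \<in> Z \<Longrightarrow> a \<in> component x Z a"
  by (auto simp: component_def)

lemma component_empty: "a \<notin> Z \<Longrightarrow> component x Z a = {}"
proof -
  assume "a \<notin> Z"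
  have "b = a" if "(a, b) \<in> (adjs x Z)\<^sup>*" for b
    using that \<open>a \<notin> Z\<close> by (cases rule: converse_rtranclE) (auto simp: adjs_def)
  then show ?thesis using \<open>a \<notin> Z\<close> by (auto simp: component_def)
qed

lemma component_closed:
  assumes "b \<in> component x Z a" "w \<in> Z" "w \<noteq> b" "x {b, w}"
  shows "w \<in> component x Z a"
proof -
  have "(b, w) \<in> adjs x Z" using assms by (auto simp: adjs_def component_def)
  then show ?thesis using assms by (auto simp: component_def intro: rtrancl_into_rtrancl)
qed

lemma adjs_mono: "Y \<subseteq> Z \<Longrightarrow> adjs x Y \<subseteq> adjs x Z"
  by (auto simp: adjs_def)

lemma component_mono: "Y \<subseteq> Z \<Longrightarrow> component x Y a \<subseteq> component x Z a"
  using rtrancl_mono[OF adjs_mono[of Y Z x]] by (auto simp: component_def)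

text \<open>Paths from \<open>a\<close> never leave the component, so connectivity holds already in
  the graph induced on it. This is the form that \<open>reach_of_connected\<close> consumes.\<close>

lemma component_connected:
  assumes "b \<in> component x Z a"
  shows "(a, b) \<in> (adjs x (component x Z a))\<^sup>*"
proof -
  have a: "a \<in> Z" using assms component_empty by fastforce
  have "(a, b) \<in> (adjs x Z)\<^sup>*" using assms by (auto simp: component_def)
  then show ?thesis
  proof (induction rule: rtrancl_induct)
    case (step b c)
    have b: "b \<in> component x Z a" using step a by (auto simp: component_def adjs_def)
    moreover have "c \<in> component x Z a" using step component_closed[OF b, of c] by (auto simp: adjs_def)
    ultimately have "(b, c) \<in> adjs x (component x Z a)" using step by (auto simp: adjs_def)
    then show ?case using step by (auto intro: rtrancl_into_rtrancl)
  qed simp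
qed

lemma component_subset_component:
  assumes "b \<in> component x Z a"
  shows "component x Z a \<subseteq> component x Z b"
proof -
  have "sym (adjs x Z)" by (auto simp: adjs_def sym_def insert_commute)
  then have "(b, a) \<in> (adjs x Z)\<^sup>*"
    using assms by (auto simp: component_def dest: sym_rtrancl[THEN symD])
  then show ?thesis by (auto simp: component_def intro: rtrancl_trans)
qed

text \<open>\<open>reach x A T\<close>: breadth-first search started from \<open>A\<close> exhausts \<open>T\<close>. The layers \<open>B\<close> make
  the union bound over the shape of the search tree recursive.\<close>

inductive reach :: "('a set \<Rightarrow> bool) \<Rightarrow> 'a set \<Rightarrow> 'a set \<Rightarrow> bool" for x where
  reach_empty: "reach x A {}"
| reach_step: "B \<noteq> {} \<Longrightarrow> B \<subseteq> T \<Longrightarrow> (\<And>b. b \<in> B \<Longrightarrow> \<exists>a\<in>A. x {a, b}) \<Longrightarrow> reach x B (T - B) \<Longrightarrow> reach x A T"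

lemma reach_of_connected:
  assumes "finite S" "A \<subseteq> S" "\<And>b. b \<in> S \<Longrightarrow> \<exists>a\<in>A. (a, b) \<in> (adjs x S)\<^sup>*"
  shows "reach x A (S - A)"
  using assms
proof (induction "card S" arbitrary: S A rule: less_induct)
  case less
  show ?case
  proof (cases "S - A = {}")
    case True
    show ?thesis unfolding True by (rule reach_empty)
  next
    case False
    define B where "B = {b \<in> S - A. \<exists>a\<in>A. x {a, b}}"
    \<comment> \<open>Induction along the path with restarts: each visit to \<open>A\<close>
      discards the witness, and the next vertex outside \<open>A\<close> lies in the layer
      \<open>B\<close>.\<close>
    have path: "b \<notin> A \<longrightarrow> (\<exists>c\<in>B. (c, b) \<in> (adjs x (S - A))\<^sup>*)"
      if "(a, b) \<in> (adjs x S)\<^sup>*" "a \<in> A" for a b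
      using that
    proof (induction rule: rtrancl_induct)
      case (step b c)
      show ?case
      proof (cases "b \<in> A")
        case True
        then have "c \<notin> A \<longrightarrow> c \<in> B" using step by (auto simp: B_def adjs_def)
        then show ?thesis by blast
      next
        case False
        then obtain d where "d \<in> B" "(d, b) \<in> (adjs x (S - A))\<^sup>*" using step by auto
        moreover have "c \<notin> A \<Longrightarrow> (b, c) \<in> adjs x (S - A)" using step False by (auto simp: adjs_def)
        ultimately show ?thesis by (meson rtrancl_into_rtrancl)
      qed
    qed auto
    have cover: "\<exists>c\<in>B. (c, b) \<in> (adjs x (S - A))\<^sup>*" if "b \<in> S - A" for b
      using that path less.prems(3)[of b] by auto
    have "A \<noteq> {}" using False less.prems(3) by auto
    then have "card (S - A) < card S"
      using less.prems by (intro psubset_card_mono) auto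
    then have rest: "reach x B (S - A - B)"
      using less.prems(1) cover by (intro less.hyps) (auto simp: B_def)
    have "B \<noteq> {}" using False cover by auto
    then show ?thesis by (rule reach_step[OF _ _ _ rest]) (auto simp: B_def)
  qed
qed

lemma reach_component:
  assumes "finite Z" "a \<in> Z"
  shows "reach x {a} (component x Z a - {a})"
  using assms component_connected[of _ x Z a] mem_component_self[of a Z x] finite_subset[OF component_subset]
  by (intro reach_of_connected) auto

definition big_light :: "nat \<Rightarrow> 'a set \<Rightarrow> nat \<Rightarrow> ('a set \<Rightarrow> bool) \<Rightarrow> bool" where
  "big_light k V M x \<longleftrightarrow> (\<exists>a T. a \<in> V \<and> T \<subseteq> V - {a} \<and> M \<le> card T \<and> card T < 2 * M \<and>
     reach x {a} T \<and> (\<forall>w\<in>T. card (nb x (V - insert a T) w) < k))"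

text \<open>Every vertex of a component of \<open>V - kcore k V x\<close> has fewer than \<open>k\<close> neighbours outside the
  component, but the union bound over such sets only works for sets of sublinear size. Therefore
  vertices are removed one by one. As long as all components of the removed set have at most \<open>M\<close>
  vertices, the first larger component contains the last vertex \<open>v\<close>, and \<open>v\<close> together with a
  minimal collection of old components adjacent to it is a set as in \<open>big_light\<close>. Its size is below
  \<open>2 * M + 1\<close> because old components are small; \<open>v\<close> itself may have many outside neighbours.\<close>

lemma card_component_le:
  assumes V: "finite V" and M: "M \<ge> 1" and good: "\<not> big_light k V M x"
  shows "card (component x (V - kcore k V x) a) \<le> M"
proof -
  \<comment> \<open>A member of \<open>ZZ\<close> of maximal size replaces the removal process: if
    it did not yet contain the whole complement of the core, removing one more vertex would stay in
    \<open>ZZ\<close>.\<close>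
  define ZZ where "ZZ = {Z. Z \<subseteq> V \<and> (\<forall>w\<in>Z. card (nb x (V - Z) w) < k) \<and> (\<forall>a. card (component x Z a) \<le> M)}"
  have "{} \<in> ZZ" by (auto simp: ZZ_def component_def)
  moreover have "\<forall>Z. Z \<in> ZZ \<longrightarrow> card Z < Suc (card V)"
    using V by (auto simp: ZZ_def less_Suc_eq_le intro: card_mono)
  ultimately have "\<exists>Z. Z \<in> ZZ \<and> (\<forall>Y. Y \<in> ZZ \<longrightarrow> card Y \<le> card Z)"
    by (rule ex_has_greatest_nat)
  then obtain Z where Z: "Z \<in> ZZ" and max: "\<And>Y. Y \<in> ZZ \<Longrightarrow> card Y \<le> card Z" by auto
  have ZV: "Z \<subseteq> V" and fZ: "finite Z" using Z V finite_subset by (auto simp: ZZ_def)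
  have "V - Z \<subseteq> kcore k V x"
  proof (rule ccontr)
    assume "\<not> V - Z \<subseteq> kcore k V x"
    then have "\<not> (\<forall>v\<in>V - Z. k \<le> card (nb x (V - Z) v))" using kcore_maximal[of "V - Z" V k x] by blast
    then obtain v where v: "v \<in> V" "v \<notin> Z" "card (nb x (V - Z) v) < k" by force
    define Z' where "Z' = insert v Z"
    have light: "card (nb x (V - Z') w) < k" if "w \<in> Z'" for w
    proof -
      have "card (nb x (V - Z') w) \<le> card (nb x (V - Z) w)"
        using V by (intro card_nb_mono) (auto simp: Z'_def)
      also have "\<dots> < k" using that v Z by (auto simp: Z'_def ZZ_def)
      finally show ?thesis .
    qed
    have large: "card (component x Z' v) \<le> M"
    proof (rule ccontr)
      assume big: "\<not> card (component x Z' v) \<le> M"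
      define CC where "CC = component x Z ` nb x Z v"
      have fCC: "finite CC" using finite_nb[OF fZ] by (simp add: CC_def)
      have sub: "component x Z' v \<subseteq> insert v (\<Union>CC)"
      proof
        fix b assume "b \<in> component x Z' v"
        then have "(v, b) \<in> (adjs x Z')\<^sup>*" by (auto simp: component_def)
        then show "b \<in> insert v (\<Union>CC)"
        proof (induction rule: rtrancl_induct)
          case (step b c)
          show ?case
          proof (cases "b = v \<or> c = v")
            case True
            then have "c = v \<or> c \<in> nb x Z v" using step by (auto simp: adjs_def nb_def Z'_def)
            then show ?thesis using mem_component_self[of c Z x] by (auto simp: CC_def nb_def)
          next
            case False
            then obtain d where d: "d \<in> nb x Z v" "b \<in> component x Z d" using step by (auto simp: CC_def)
            have "c \<in> component x Z d" using step False by (intro component_closed[OF d(2)]) (auto simp: adjs_def Z'_def)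
            then show ?thesis using d by (auto simp: CC_def)
          qed
        qed simp
      qed
      have fU: "finite (\<Union>DD)" if "DD \<subseteq> CC" for DD
        using that fZ component_subset[of x Z] by (intro finite_subset[of "\<Union>DD" Z]) (auto simp: CC_def)
      define FF where "FF = {DD. DD \<subseteq> CC \<and> M < card (insert v (\<Union>DD))}"
      have "CC \<in> FF"
        using big card_mono[OF _ sub] fU[of CC] by (auto simp: FF_def)
      then obtain DD where DD: "DD \<in> FF" and min: "\<And>EE. EE \<in> FF \<Longrightarrow> card DD \<le> card EE"
        using ex_has_least_nat[of "\<lambda>DD. DD \<in> FF" CC card] by blast
      have DDC: "DD \<subseteq> CC" and DDM: "M < card (insert v (\<Union>DD))" using DD by (auto simp: FF_def)
      have "DD \<noteq> {}" using DDM M by auto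
      then obtain D where D: "D \<in> DD" by auto
      have "card (DD - {D}) < card DD"
        using D DDC fCC finite_subset by (intro psubset_card_mono) auto
      then have "DD - {D} \<notin> FF" using min by force
      then have "card (insert v (\<Union>(DD - {D}))) \<le> M" using DDC by (auto simp: FF_def)
      moreover have "card D \<le> M" using D DDC Z by (auto simp: CC_def ZZ_def)
      moreover have "insert v (\<Union>DD) = insert v (\<Union>(DD - {D})) \<union> D" using D by auto
      ultimately have DD2: "card (insert v (\<Union>DD)) \<le> 2 * M"
        using card_Un_le[of "insert v (\<Union>(DD - {D}))" D] by simp
      define T where "T = \<Union>DD"
      have TZ: "T \<subseteq> Z" using DDC component_subset[of x Z] by (auto simp: T_def CC_def)
      have vT: "v \<notin> T" using TZ v by auto
      have fT: "finite T" using TZ fZ finite_subset by auto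
      have "reach x {v} (insert v T - {v})"
      proof (intro reach_of_connected)
        fix b assume "b \<in> insert v T"
        moreover have "(v, b) \<in> (adjs x (insert v T))\<^sup>*" if bT: "b \<in> T"
        proof -
          obtain d where d: "d \<in> nb x Z v" "b \<in> component x Z d" "component x Z d \<in> DD"
            using bT DDC by (auto simp: T_def CC_def)
          have "component x Z d \<subseteq> insert v T" using d by (auto simp: T_def)
          then have "(d, b) \<in> (adjs x (insert v T))\<^sup>*"
            using component_connected[OF d(2)] rtrancl_mono[OF adjs_mono] by blast
          moreover have "(v, d) \<in> adjs x (insert v T)"
            using d mem_component_self[of d Z x] by (auto simp: adjs_def nb_def T_def)
          ultimately show ?thesis by (rule converse_rtrancl_into_rtrancl[rotated])
        qed
        ultimately show "\<exists>a\<in>{v}. (a, b) \<in> (adjs x (insert v T))\<^sup>*" by auto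
      qed (use fT in auto)
      moreover have "card (nb x (V - insert v T) w) < k" if w: "w \<in> T" for w
      proof -
        \<comment> \<open>\<open>T\<close> contains the entire old component of \<open>w\<close>, so
          a neighbour of \<open>w\<close> outside \<open>insert v T\<close> cannot lie in
          \<open>Z\<close>.\<close>
        have "nb x (V - insert v T) w \<subseteq> nb x (V - Z) w"
        proof
          fix u assume u: "u \<in> nb x (V - insert v T) w"
          obtain d where d: "w \<in> component x Z d" "component x Z d \<in> DD"
            using w DDC by (auto simp: T_def CC_def)
          have "u \<notin> Z" using component_closed[OF d(1), of u] d(2) u by (auto simp: nb_def T_def)
          then show "u \<in> nb x (V - Z) w" using u by (auto simp: nb_def)
        qed
        then have "card (nb x (V - insert v T) w) \<le> card (nb x (V - Z) w)"
          using V by (intro card_mono finite_nb) auto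
        also have "\<dots> < k" using w TZ Z by (auto simp: ZZ_def)
        finally show ?thesis .
      qed
      \<comment> \<open>\<open>insert v T\<close> has between \<open>M + 1\<close> and
        \<open>2 * M\<close> vertices; without the root this is the range demanded of
        \<open>card T\<close>.\<close>
      ultimately have "big_light k V M x"
        unfolding big_light_def using v TZ ZV vT fT DDM DD2
        by (intro exI[of _ v] exI[of _ T]) (auto simp: T_def[symmetric])
      then show False using good by simp
    qed
    have "card (component x Z' a) \<le> M" for a
    proof (cases "v \<in> component x Z' a")
      case True
      have "card (component x Z' a) \<le> card (component x Z' v)"
        using component_subset_component[OF True] component_subset[of x Z' v] fZ
        by (intro card_mono) (auto simp: Z'_def intro: finite_subset)
      then show ?thesis using large by simp
    next
      case False
      have "component x Z' a \<subseteq> component x Z a"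
      proof (cases "a \<in> Z'")
        case True
        then have a: "a \<in> Z" using False mem_component_self[of a Z' x] by (auto simp: Z'_def)
        show ?thesis
        proof
          fix b assume b: "b \<in> component x Z' a"
          have "adjs x (component x Z' a) \<subseteq> adjs x Z"
            using False component_subset[of x Z' a] by (intro adjs_mono) (auto simp: Z'_def)
          then have "(a, b) \<in> (adjs x Z)\<^sup>*" using component_connected[OF b] rtrancl_mono by blast
          then show "b \<in> component x Z a" using False b by (auto simp: component_def Z'_def)
        qed
      qed (simp add: component_empty)
      then have "card (component x Z' a) \<le> card (component x Z a)"
        using component_subset[of x Z a] fZ by (intro card_mono) (auto intro: finite_subset)
      then show ?thesis using Z by (auto simp: ZZ_def intro: order_trans)
    qed
    then have "Z' \<in> ZZ" using light v ZV by (auto simp: ZZ_def Z'_def)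
    then have "card Z' \<le> card Z" by (rule max)
    then show False using v fZ by (simp add: Z'_def)
  qed
  then have RZ: "V - kcore k V x \<subseteq> Z" by auto
  then have "card (component x (V - kcore k V x) a) \<le> card (component x Z a)"
    using component_mono[OF RZ] finite_subset[OF component_subset fZ] by (intro card_mono)
  then show ?thesis using Z by (auto simp: ZZ_def intro: order_trans)
qed

text \<open>A vertex outside the core with at least \<open>k\<close> neighbours in the core could be
  added to it. Neighbours outside the component do lie in the core, because components are closed
  within the complement.\<close>

lemma component_removed_light:
  assumes V: "finite V" and w: "w \<in> component x (V - kcore k V x) a"
  shows "card (nb x (V - component x (V - kcore k V x) a) w) < k"
proof -
  let ?K = "kcore k V x" and ?C = "component x (V - kcore k V x) a"
  have wK: "w \<notin> ?K" "w \<in> V" using w component_subset by fastforce+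
  have "card (nb x ?K w) < k"
  proof (rule ccontr)
    assume deg: "\<not> card (nb x ?K w) < k"
    have "insert w ?K \<subseteq> ?K"
    proof (rule kcore_maximal)
      show "insert w ?K \<subseteq> V" using wK kcore_subset by fast
      fix v assume "v \<in> insert w ?K"
      then have "k \<le> card (nb x ?K v)" using deg kcore_degree[OF V] by auto
      also have "\<dots> \<le> card (nb x (insert w ?K) v)"
        using finite_kcore[OF V] by (intro card_nb_mono) auto
      finally show "k \<le> card (nb x (insert w ?K) v)" .
    qed
    then show False using wK by simp
  qed
  moreover have "nb x (V - ?C) w \<subseteq> nb x ?K w"
    using component_closed[OF w] by (auto simp: nb_def)
  then have "card (nb x (V - ?C) w) \<le> card (nb x ?K w)"
    using finite_kcore[OF V] by (intro card_mono finite_nb)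
  ultimately show ?thesis by simp
qed

section \<open>Discrete derivatives of the core size\<close>

definition core_size :: "nat \<Rightarrow> 'a set \<Rightarrow> ('a set \<Rightarrow> bool) \<Rightarrow> real" where
  "core_size k V x = card (kcore k V x)"

lemma core_size_mono:
  assumes "finite V" "\<And>e. x e \<Longrightarrow> y e"
  shows "core_size k V x \<le> core_size k V y"
  unfolding core_size_def using assms by (intro of_nat_mono card_mono finite_kcore kcore_mono) auto

lemma dif_core_size_nonneg: "finite V \<Longrightarrow> 0 \<le> dif i (core_size k V) x"
  unfolding dif_def diff_ge_0_iff_ge by (rule core_size_mono) (auto split: if_splits)

definition affected :: "nat \<Rightarrow> 'a set \<Rightarrow> ('a set \<Rightarrow> bool) \<Rightarrow> 'a set \<Rightarrow> 'a set" where
  "affected k V x e = (\<Union>a\<in>e. component x (V - kcore k V x) a)"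

lemma affected_subset: "affected k V x e \<subseteq> V - kcore k V x"
  using component_subset by (fastforce simp: affected_def)

lemma mem_affected: "a \<in> e \<Longrightarrow> a \<in> V \<Longrightarrow> a \<in> kcore k V x \<or> a \<in> affected k V x e"
  using mem_component_self[of a "V - kcore k V x" x] by (auto simp: affected_def)

lemma affected_closed:
  assumes "u \<in> affected k V x e" "w \<in> V - kcore k V x - affected k V x e"
  shows "\<not> x {u, w}"
  using assms component_closed[of u x "V - kcore k V x" _ w] by (auto simp: affected_def)

lemma affected_closed':
  assumes "w \<in> affected k V x e" "u \<in> V - kcore k V x - affected k V x e"
  shows "\<not> x {u, w}"
  using affected_closed[OF assms] by (simp add: insert_commute)

lemma card_affected_le:
  assumes "card e = 2" "\<And>a. card (component x (V - kcore k V x) a) \<le> M" "finite V"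
  shows "card (affected k V x e) \<le> 2 * M"
proof -
  have "card (affected k V x e) \<le> (\<Sum>a\<in>e. card (component x (V - kcore k V x) a))"
    unfolding affected_def using assms(1) by (intro card_UN_le) (auto intro: card_ge_0_finite)
  also have "\<dots> \<le> (\<Sum>a\<in>e. M)" by (intro sum_mono assms)
  finally show ?thesis using assms(1) by simp
qed

text \<open>\<open>kcore_local\<close> is applied to the part of the complement that
  \<open>affected\<close> misses: no endpoint of \<open>e\<close> lies there, so its edges are
  unchanged, and no edge joins it to the affected components.\<close>

lemma kcore_insert_edge_subset:
  assumes V: "finite V" and e: "e \<subseteq> V" and x: "\<not> x e"
  shows "kcore k V (x(e := True)) \<subseteq> kcore k V x \<union> affected k V x e"
proof -
  let ?P = "affected k V x e" and ?K = "kcore k V x"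
  have "kcore k V (x(e := True)) \<inter> (V - ?K - ?P) \<subseteq> ?K"
  proof (rule kcore_local[OF V, of x])
    show "x {u, w}" if "u \<in> V - ?K - ?P" "w \<in> V" "(x(e := True)) {u, w}" for u w
    proof -
      have "u \<notin> e" using that mem_affected[of u e V k x] by auto
      then show ?thesis using that by (auto split: if_splits)
    qed
    show "\<not> x {u, w}" if "u \<in> V - ?K - ?P" "w \<in> V - ?K - (V - ?K - ?P)" for u w
      using that by (intro affected_closed'[of _ k V x e]) auto
  qed auto
  then show ?thesis using kcore_subset[of k V "x(e := True)"] by auto
qed

lemma dif_core_size_le:
  assumes V: "finite V" and e: "e \<subseteq> V"
  shows "dif e (core_size k V) x \<le> card (affected k V (x(e := False)) e)"
proof -
  define x0 where "x0 = x(e := False)"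
  have x: "x(e := True) = x0(e := True)" by (simp add: x0_def)
  have "card (kcore k V (x0(e := True))) \<le> card (kcore k V x0 \<union> affected k V x0 e)"
  proof (rule card_mono)
    have "kcore k V x0 \<union> affected k V x0 e \<subseteq> V"
      using affected_subset[of k V x0 e] kcore_subset[of k V x0] by blast
    then show "finite (kcore k V x0 \<union> affected k V x0 e)" using V finite_subset by blast
    show "kcore k V (x0(e := True)) \<subseteq> kcore k V x0 \<union> affected k V x0 e"
      by (rule kcore_insert_edge_subset[OF V e]) (simp add: x0_def)
  qed
  also have "\<dots> \<le> card (kcore k V x0) + card (affected k V x0 e)" by (rule card_Un_le)
  finally show ?thesis unfolding dif_def x core_size_def x0_def[symmetric] by linarith
qed

lemma dif_core_size_le_card:
  assumes V: "finite V"
  shows "\<bar>dif e (core_size k V) x\<bar> \<le> card V"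
proof -
  have "card (kcore k V y) \<le> card V" for y by (intro card_mono V kcore_subset)
  then show ?thesis unfolding dif_def core_size_def
    by (smt (verit) of_nat_0_le_iff of_nat_mono)
qed

text \<open>On the affected components \<open>?P\<close> only the insertion of \<open>e\<close> can
  matter, on the rest \<open>?P'\<close> of the complement only that of \<open>e'\<close>. Hence the
  core with both edges is the union of the two single-edge cores and the old core is their
  intersection, and inclusion-exclusion for cardinalities makes the mixed difference vanish.\<close>

lemma dif_dif_core_size_eq_0:
  assumes V: "finite V" and e: "e \<subseteq> V" and e': "e' \<subseteq> V" and x: "\<not> x e" "\<not> x e'" "e \<noteq> e'"
    and disj: "e' \<inter> affected k V x e = {}"
  shows "dif e' (dif e (core_size k V)) x = 0"
proof -
  let ?P = "affected k V x e" and ?K = "kcore k V x"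
  let ?P' = "V - ?K - ?P"
  define x10 where "x10 = x(e := True)"
  define x01 where "x01 = x(e' := True)"
  define x11 where "x11 = x(e := True, e' := True)"
  have PV: "?P \<subseteq> V" using affected_subset by fastforce
  have eP': "u \<notin> e" if "u \<in> ?P'" for u using that mem_affected[of u e V k x] by auto
  have e'P: "u \<notin> e'" if "u \<in> ?P" for u using that disj by auto
  have PP: "V - ?K - ?P' = ?P" using affected_subset[of k V x e] by auto
  have 1: "kcore k V x11 \<inter> ?P \<subseteq> kcore k V x10"
  proof (rule kcore_local[OF V, of x])
    show "\<not> x10 {u, w}" if "u \<in> ?P" "w \<in> ?P'" for u w
      using affected_closed[OF that] eP'[OF that(2)] by (auto simp: x10_def)
    show "x10 {u, w}" if "u \<in> ?P" "w \<in> V" "x11 {u, w}" for u w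
      using that e'P[OF that(1)] by (auto simp: x10_def x11_def split: if_splits)
  qed (use PV in \<open>auto simp: x10_def\<close>)
  have 2: "kcore k V x11 \<inter> ?P' \<subseteq> kcore k V x01"
  proof (rule kcore_local[OF V, of x])
    show "\<not> x01 {u, w}" if "u \<in> ?P'" "w \<in> V - ?K - ?P'" for u w
      using affected_closed'[of w k V x e u] e'P[of w] that unfolding PP by (auto simp: x01_def)
    show "x01 {u, w}" if "u \<in> ?P'" "w \<in> V" "x11 {u, w}" for u w
      using that eP'[OF that(1)] by (auto simp: x01_def x11_def split: if_splits)
  qed (auto simp: x01_def)
  have 3: "kcore k V x10 \<inter> ?P' \<subseteq> ?K"
    using kcore_insert_edge_subset[where x = x, OF V e x(1), of k] by (auto simp: x10_def)
  have 4: "kcore k V x01 \<inter> ?P \<subseteq> ?K"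
  proof (rule kcore_local[OF V, of x])
    show "\<not> x {u, w}" if "u \<in> ?P" "w \<in> ?P'" for u w using affected_closed[OF that] .
    show "x {u, w}" if "u \<in> ?P" "w \<in> V" "x01 {u, w}" for u w
      using that e'P[OF that(1)] by (auto simp: x01_def split: if_splits)
  qed (use PV in auto)
  have mono: "?K \<subseteq> kcore k V x10" "?K \<subseteq> kcore k V x01" "kcore k V x10 \<subseteq> kcore k V x11" "kcore k V x01 \<subseteq> kcore k V x11"
    by (rule kcore_mono[OF V subset_refl], simp add: x10_def x01_def x11_def)+
  have un: "kcore k V x11 = kcore k V x10 \<union> kcore k V x01"
    using 1 2 mono kcore_subset[of k V x11] by blast
  have int: "kcore k V x10 \<inter> kcore k V x01 = ?K"
    using 3 4 mono kcore_subset[of k V x10] by blast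
  have "core_size k V x11 + core_size k V x = core_size k V x10 + core_size k V x01"
    unfolding core_size_def un int[symmetric]
    using card_Un_Int[OF finite_kcore[OF V, of k x10] finite_kcore[OF V, of k x01]] by linarith
  moreover have "x(e := False) = x" "x(e' := False) = x" "x(e' := True, e := False) = x01"
      "x(e' := True, e := True) = x11"
    using x by (auto simp: fun_eq_iff x01_def x11_def)
  ultimately show ?thesis unfolding dif_def x10_def by simp
qed

text \<open>The differences involve graphs with both \<open>e\<close> and \<open>e'\<close> altered,
  so \<open>good\<close> speaks about all of these. Pairs \<open>e'\<close> that avoid the at most
  \<open>2 * M\<close> affected vertices contribute nothing if absent from \<open>x\<close>. Pairs
  present in \<open>x\<close> are outside the scope of \<open>dif_dif_core_size_eq_0\<close> and are
  simply counted: a sparse graph has only linearly many.\<close>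

lemma sum_dif_dif_core_size_le:
  assumes V: "finite V" and M: "M \<ge> 1" and e: "e \<in> [V]\<^bsup>2\<^esup>"
    and good: "\<And>e e' b b'. e \<in> [V]\<^bsup>2\<^esup> \<Longrightarrow> e' \<in> [V]\<^bsup>2\<^esup> \<Longrightarrow> \<not> big_light k V M (x(e := b, e' := b'))"
  shows "\<And>e' b. e' \<in> [V]\<^bsup>2\<^esup> \<Longrightarrow> \<bar>dif e (core_size k V) (x(e' := b))\<bar> \<le> 2 * M"
    and "(\<Sum>e'\<in>[V]\<^bsup>2\<^esup>. \<bar>dif e' (dif e (core_size k V)) x\<bar>)
      \<le> 4 * real M * (2 * real M * card V + card {e \<in> [V]\<^bsup>2\<^esup>. x e})"
proof -
  have eV: "e \<subseteq> V" "card e = 2" using e by (auto simp: nsets_def)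
  have aff: "card (affected k V (x(e' := b, e := False)) e) \<le> 2 * M" if "e' \<in> [V]\<^bsup>2\<^esup>" for e' b
    using good[OF that e] by (intro card_affected_le eV card_component_le V M)
  show d: "\<bar>dif e (core_size k V) (x(e' := b))\<bar> \<le> 2 * M" if "e' \<in> [V]\<^bsup>2\<^esup>" for e' b
    using dif_core_size_nonneg[OF V, of e k "x(e' := b)"] dif_core_size_le[OF V eV(1), of k "x(e' := b)"]
      aff[OF that, of b] by linarith
  define P where "P = affected k V (x(e := False)) e"
  have PV: "P \<subseteq> V" using affected_subset[of k V _ e] by (auto simp: P_def)
  have cP: "card P \<le> 2 * M" using aff[OF e, of False] by (simp add: P_def)
  define J where "J = {e' \<in> [V]\<^bsup>2\<^esup>. x e'} \<union> (\<lambda>(a, b). {a, b}) ` (P \<times> V)"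
  have fI: "finite ([V]\<^bsup>2\<^esup>)" using V by (rule finite_imp_finite_nsets)
  have fJ: "finite J" using fI V finite_subset[OF PV V] by (auto simp: J_def)
  have "dif e' (dif e (core_size k V)) x = 0" if "e' \<in> [V]\<^bsup>2\<^esup>" "e' \<notin> J" for e'
  proof (cases "e = e'")
    case True
    then show ?thesis by (simp add: dif_ignores ignores_dif_same)
  next
    case False
    have "dif e' (dif e (core_size k V)) (x(e := False)) = 0"
    proof (rule dif_dif_core_size_eq_0[OF V eV(1)])
      show "e' \<subseteq> V" "\<not> (x(e := False)) e'" "\<not> (x(e := False)) e" "e \<noteq> e'"
        using that False by (auto simp: J_def nsets_def)
      from that(1) obtain a b where ab: "e' = {a, b}" "a \<in> V" "b \<in> V"
        by (auto simp: nsets_def card_2_iff)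
      then have "a \<notin> P \<and> b \<notin> P" using that by (force simp: J_def insert_commute)
      then show "e' \<inter> affected k V (x(e := False)) e = {}" using ab by (auto simp: P_def)
    qed
    moreover have "ignores e (dif e' (dif e (core_size k V)))" by (intro ignores_dif ignores_dif_same)
    ultimately show ?thesis by (simp add: ignores_def)
  qed
  then have "(\<Sum>e'\<in>[V]\<^bsup>2\<^esup>. \<bar>dif e' (dif e (core_size k V)) x\<bar>)
      = (\<Sum>e'\<in>[V]\<^bsup>2\<^esup> \<inter> J. \<bar>dif e' (dif e (core_size k V)) x\<bar>)"
    using fI by (intro sum.mono_neutral_right) auto
  also have "\<dots> \<le> (\<Sum>e'\<in>[V]\<^bsup>2\<^esup> \<inter> J. 4 * real M)"
  proof (rule sum_mono)
    fix e' assume "e' \<in> [V]\<^bsup>2\<^esup> \<inter> J"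
    then show "\<bar>dif e' (dif e (core_size k V)) x\<bar> \<le> 4 * real M"
      using d[of e' True] d[of e' False] by (auto simp: dif_def[of e'])
  qed
  also have "\<dots> = 4 * real M * card ([V]\<^bsup>2\<^esup> \<inter> J)" by simp
  also have "\<dots> \<le> 4 * real M * (2 * real M * card V + card {e \<in> [V]\<^bsup>2\<^esup>. x e})"
  proof (rule mult_left_mono)
    have "card ((\<lambda>(a, b). {a, b}) ` (P \<times> V)) \<le> card (P \<times> V)"
      using V finite_subset[OF PV V] by (intro card_image_le) auto
    also have "\<dots> = card P * card V" by (rule card_cartesian_product)
    also have "\<dots> \<le> 2 * M * card V" using cP by (rule mult_right_mono) simp
    finally have "card {e \<in> [V]\<^bsup>2\<^esup>. x e} + card ((\<lambda>(a, b). {a, b}) ` (P \<times> V))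
        \<le> card {e \<in> [V]\<^bsup>2\<^esup>. x e} + 2 * M * card V" by simp
    moreover have "card ([V]\<^bsup>2\<^esup> \<inter> J) \<le> card J" by (intro card_mono fJ) auto
    moreover have "card J \<le> card {e \<in> [V]\<^bsup>2\<^esup>. x e} + card ((\<lambda>(a, b). {a, b}) ` (P \<times> V))"
      unfolding J_def by (rule card_Un_le)
    ultimately have "card ([V]\<^bsup>2\<^esup> \<inter> J) \<le> card {e \<in> [V]\<^bsup>2\<^esup>. x e} + 2 * M * card V" by linarith
    then have "real (card ([V]\<^bsup>2\<^esup> \<inter> J)) \<le> real (card {e \<in> [V]\<^bsup>2\<^esup>. x e} + 2 * M * card V)"
      by (rule of_nat_mono)
    then show "real (card ([V]\<^bsup>2\<^esup> \<inter> J)) \<le> 2 * real M * card V + card {e \<in> [V]\<^bsup>2\<^esup>. x e}"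
      by simp
  qed simp
  finally show "(\<Sum>e'\<in>[V]\<^bsup>2\<^esup>. \<bar>dif e' (dif e (core_size k V)) x\<bar>)
      \<le> 4 * real M * (2 * real M * card V + card {e \<in> [V]\<^bsup>2\<^esup>. x e})" .
qed

text \<open>With degree exactly \<open>k\<close>, the vertex \<open>a\<close> belongs to the core
  while all its edges are present and drops out when one is deleted. Using the core of
  \<open>V - {a}\<close> makes the condition on the neighbours independent of the edges at
  \<open>a\<close>.\<close>

lemma dif_core_size_ge_1:
  assumes V: "finite V" and a: "a \<in> V" and deg: "card (nb x V a) = k"
    and sub: "nb x V a \<subseteq> kcore k (V - {a}) x" and b: "b \<in> nb x V a"
  shows "1 \<le> dif {a, b} (core_size k V) x"
proof -
  define x0 where "x0 = x({a, b} := False)"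
  have x: "x({a, b} := True) = x" using b by (auto simp: nb_def fun_eq_iff)
  let ?K = "kcore k (V - {a}) x"
  have KV: "?K \<subseteq> V - {a}" by (rule kcore_subset)
  have fK: "finite (insert a ?K)" using KV V finite_subset by auto
  have "insert a ?K \<subseteq> kcore k V x"
  proof (rule kcore_maximal)
    show "insert a ?K \<subseteq> V" using KV a by auto
    fix v assume "v \<in> insert a ?K"
    then consider "v = a" | "v \<in> ?K" by auto
    then show "k \<le> card (nb x (insert a ?K) v)"
    proof cases
      case 1
      have "nb x V a \<subseteq> nb x (insert a ?K) a" using sub by (auto simp: nb_def)
      then have "card (nb x V a) \<le> card (nb x (insert a ?K) a)" by (intro card_mono finite_nb fK)
      then show ?thesis using deg 1 by simp
    next
      case 2
      have "card (nb x ?K v) \<le> card (nb x (insert a ?K) v)" by (intro card_nb_mono fK) auto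
      then show ?thesis using kcore_degree[OF _ 2] V by auto
    qed
  qed
  then have a1: "a \<in> kcore k V x" by auto
  have a0: "a \<notin> kcore k V x0"
  proof
    assume "a \<in> kcore k V x0"
    then have "k \<le> card (nb x0 (kcore k V x0) a)" by (rule kcore_degree[OF V])
    also have "\<dots> \<le> card (nb x V a - {b})"
      using V kcore_subset[of k V x0]
      by (intro card_mono) (auto simp: nb_def x0_def split: if_splits)
    also have "\<dots> < card (nb x V a)" using b by (intro card_Diff1_less finite_nb V)
    finally show False using deg by simp
  qed
  have "kcore k V x0 \<subseteq> kcore k V x" using V by (intro kcore_mono) (auto simp: x0_def split: if_splits)
  then have "card (kcore k V x0) < card (kcore k V x)"
    using a0 a1 by (intro psubset_card_mono finite_kcore V) auto
  then show ?thesis unfolding dif_def x core_size_def x0_def[symmetric] by linarith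
qed

section \<open>Union bounds in the random graph\<close>

definition expect :: "real \<Rightarrow> 'i set \<Rightarrow> (('i \<Rightarrow> bool) \<Rightarrow> real) \<Rightarrow> real" where
  "expect p I u = measure_pmf.expectation (Pi_pmf I False (\<lambda>_. bernoulli_pmf p)) u"

abbreviation pr :: "real \<Rightarrow> 'i set \<Rightarrow> (('i \<Rightarrow> bool) \<Rightarrow> bool) \<Rightarrow> real" where
  "pr p I E \<equiv> expect p I (\<lambda>x. of_bool (E x))"

lemma expect_avl: "distinct is \<Longrightarrow> 0 \<le> p \<Longrightarrow> p \<le> 1 \<Longrightarrow> expect p (set is) u = avl p is u (\<lambda>_. False)"
  unfolding expect_def by (rule expectation_Pi_bernoulli)

locale bernoulli_product =
  fixes p :: real and I :: "'i set"
  assumes p: "0 \<le> p" "p \<le> 1" and I: "finite I"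
begin

text \<open>Fixing one enumeration of \<open>I\<close> transfers the algebra of \<open>avl\<close>
  to \<open>expect\<close>.\<close>

lemma expect_avl_exists: "\<exists>is. distinct is \<and> set is = I \<and> (\<forall>u. expect p I u = avl p is u (\<lambda>_. False))"
  using finite_distinct_list[OF I] expect_avl p by metis

lemma expect_mono: "(\<And>x. u x \<le> v x) \<Longrightarrow> expect p I u \<le> expect p I v"
  using expect_avl_exists by (metis avl_mono p)

lemma expect_add: "expect p I (\<lambda>x. u x + v x) = expect p I u + expect p I v"
  using expect_avl_exists avl_add by metis

lemma expect_diff: "expect p I (\<lambda>x. u x - v x) = expect p I u - expect p I v"
  using expect_avl_exists avl_diff by metis

lemma expect_cmult: "expect p I (\<lambda>x. r * u x) = r * expect p I u"
  using expect_avl_exists avl_cmult by metis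

lemma expect_const [simp]: "expect p I (\<lambda>x. a) = a"
  using expect_avl_exists avl_const by metis

lemma expect_sum: "expect p I (\<lambda>x. \<Sum>j\<in>J. u j x) = (\<Sum>j\<in>J. expect p I (u j))"
proof -
  obtain "is" where "\<And>u. expect p I u = avl p is u (\<lambda>_. False)" using expect_avl_exists by auto
  then show ?thesis by (simp only: avl_sum)
qed

lemma expect_nonneg: "(\<And>x. 0 \<le> u x) \<Longrightarrow> 0 \<le> expect p I u"
  using expect_mono[of "\<lambda>x. 0" u] by simp

lemma pr_mono: "(\<And>x. E x \<Longrightarrow> F x) \<Longrightarrow> pr p I E \<le> pr p I F"
  by (rule expect_mono) auto

lemma pr_disj_le: "pr p I (\<lambda>x. E x \<or> F x) \<le> pr p I E + pr p I F"
  unfolding expect_add[symmetric] by (rule expect_mono) auto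

lemma pr_bex_le:
  assumes "finite J"
  shows "pr p I (\<lambda>x. \<exists>j\<in>J. E j x) \<le> (\<Sum>j\<in>J. pr p I (E j))"
  unfolding expect_sum[symmetric]
proof (rule expect_mono)
  fix x
  show "of_bool (\<exists>j\<in>J. E j x) \<le> (\<Sum>j\<in>J. of_bool (E j x) :: real)"
  proof (cases "\<exists>j\<in>J. E j x")
    case True
    then obtain j where "j \<in> J" "E j x" by auto
    then show ?thesis using assms member_le_sum[of j J "\<lambda>j. of_bool (E j x) :: real"] True by simp
  qed (simp add: sum_nonneg)
qed

lemma expect_av: "i \<in> I \<Longrightarrow> expect p I (av p i u) = expect p I u"
proof -
  assume i: "i \<in> I"
  have *: "expect p I v = expect p (I - {i}) (av p i v)" for v
    unfolding expect_def using expectation_Pi_bernoulli_insert[of "I - {i}" i p v] i I p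
    by (simp add: insert_absorb)
  show ?thesis unfolding * by (simp add: av_ignores ignores_av_same)
qed

text \<open>The coordinate already equals \<open>b\<close> with probability \<open>p\<close> or
  \<open>1 - p\<close>, both at least \<open>p * (1 - p)\<close>. This bounds probabilities of
  events about a graph with overwritten edges.\<close>

lemma expect_upd_le:
  assumes "i \<in> I" "\<And>x. 0 \<le> u x"
  shows "p * (1 - p) * expect p I (\<lambda>x. u (x(i := b))) \<le> expect p I u"
proof -
  have "p * (1 - p) * u (x(i := b)) \<le> av p i u x" for x
  proof (cases b)
    case True
    have "p * (1 - p) * u (x(i := True)) \<le> p * u (x(i := True))"
      using p assms(2) by (intro mult_right_mono) (auto simp: mult_left_le)
    also have "\<dots> \<le> av p i u x" using p assms(2) by (simp add: av_def)
    finally show ?thesis using True by simp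
  next
    case False
    have "p * (1 - p) * u (x(i := False)) \<le> (1 - p) * u (x(i := False))"
      using p assms(2) by (intro mult_right_mono) (auto simp: mult_left_le_one_le)
    also have "\<dots> \<le> av p i u x" using p assms(2) by (simp add: av_def)
    finally show ?thesis using False by simp
  qed
  then have "expect p I (\<lambda>x. p * (1 - p) * u (x(i := b))) \<le> expect p I (av p i u)" by (rule expect_mono)
  then show ?thesis using assms(1) by (simp add: expect_cmult expect_av)
qed

lemma expect_coord: "i \<in> I \<Longrightarrow> ignores i v \<Longrightarrow> expect p I (\<lambda>x. of_bool (x i) * v x) = p * expect p I v"
proof -
  assume i: "i \<in> I" "ignores i v"
  then have "av p i (\<lambda>x. of_bool (x i) * v x) = (\<lambda>x. p * v x)"
    by (auto simp: av_def ignores_def fun_eq_iff)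
  then show ?thesis using expect_av[OF i(1), of "\<lambda>x. of_bool (x i) * v x"] by (simp add: expect_cmult)
qed

lemma pr_coord: "i \<in> I \<Longrightarrow> pr p I (\<lambda>x. x i) = p"
  using expect_coord[of i "\<lambda>x. 1"] by (simp add: ignores_def)

end

lemma expect_mult_indep:
  assumes "finite I" "0 \<le> p" "p \<le> 1" "\<And>i. i \<in> I \<Longrightarrow> ignores i u \<or> ignores i v"
  shows "expect p I (\<lambda>x. u x * v x) = expect p I u * expect p I v"
  using assms(1,4)
proof (induction I arbitrary: u v rule: finite_induct)
  case empty
  then show ?case by (simp add: expect_def)
next
  case (insert i I)
  have *: "expect p (insert i I) w = expect p I (av p i w)" for w
    unfolding expect_def using insert assms by (intro expectation_Pi_bernoulli_insert)
  show ?case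
  proof (cases "ignores i u")
    case True
    then have "av p i (\<lambda>x. u x * v x) = (\<lambda>x. u x * av p i v x)"
      by (auto simp: av_def ignores_def fun_eq_iff algebra_simps)
    then show ?thesis unfolding *
      using insert.IH[of u "av p i v"] insert.prems True ignores_av[of _ v p i] by (simp add: av_ignores) blast
  next
    case False
    then have v: "ignores i v" using insert.prems by auto
    then have "av p i (\<lambda>x. u x * v x) = (\<lambda>x. av p i u x * v x)"
      by (auto simp: av_def ignores_def fun_eq_iff algebra_simps)
    then show ?thesis unfolding *
      using insert.IH[of "av p i u" v] insert.prems v ignores_av[of _ u p i] by (simp add: av_ignores) blast
  qed
qed

section \<open>Ignored coordinates and independence\<close>

lemma ignores_boolI: "(\<And>x b. E x \<Longrightarrow> E (x(i := b))) \<Longrightarrow> ignores i E"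
  unfolding ignores_def by (metis fun_upd_triv fun_upd_upd)

lemma ignores_coord: "j \<noteq> i \<Longrightarrow> ignores i (\<lambda>x. x j)"
  by (simp add: ignores_def)

lemma ignores_ball: "(\<And>b. b \<in> B \<Longrightarrow> ignores i (E b)) \<Longrightarrow> ignores i (\<lambda>x. \<forall>b\<in>B. E b x)"
  by (simp add: ignores_def)

lemma ignores_bex: "(\<And>b. b \<in> B \<Longrightarrow> ignores i (E b)) \<Longrightarrow> ignores i (\<lambda>x. \<exists>b\<in>B. E b x)"
  by (simp add: ignores_def)

lemma reach_cong: "reach x A T \<Longrightarrow> (\<And>e. e \<subseteq> A \<union> T \<Longrightarrow> x e \<Longrightarrow> y e) \<Longrightarrow> reach y A T"
proof (induction rule: reach.induct)
  case (reach_step B T A)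
  have "reach y B (T - B)"
  proof (rule reach_step.IH)
    fix e assume "e \<subseteq> B \<union> (T - B)" "x e"
    moreover from this have "e \<subseteq> A \<union> T" using reach_step.hyps(2) by auto
    ultimately show "y e" by (intro reach_step.prems)
  qed
  then show ?case
  proof (rule reach.reach_step[rotated -1])
    fix b assume b: "b \<in> B"
    then obtain a where a: "a \<in> A" "x {a, b}" using reach_step.hyps(3) by blast
    then have "y {a, b}" using b reach_step.hyps(2) by (intro reach_step.prems) auto
    then show "\<exists>a\<in>A. y {a, b}" using a by blast
  qed (rule reach_step.hyps)+
qed (rule reach.reach_empty)

lemma ignores_reach: "\<not> e \<subseteq> A \<union> T \<Longrightarrow> ignores e (\<lambda>x. reach x A T)"
  by (rule ignores_boolI, erule reach_cong) (metis fun_upd_other)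

lemma ignores_comp: "ignores e u \<Longrightarrow> ignores e (\<lambda>x. g (u x))"
  by (simp add: ignores_def)

lemma ignores_conj: "ignores e (\<lambda>x. E x) \<Longrightarrow> ignores e (\<lambda>x. F x) \<Longrightarrow> ignores e (\<lambda>x. E x \<and> F x)"
  by (simp add: ignores_def)

lemma ignores_nb: "\<not> (a \<in> e \<and> e \<subseteq> insert a S) \<Longrightarrow> ignores e (\<lambda>x. nb x S a)"
  by (auto simp: ignores_def nb_def)

lemma ignores_kcore: "\<not> e \<subseteq> V \<Longrightarrow> ignores e (\<lambda>x. kcore k V x)"
proof -
  assume e: "\<not> e \<subseteq> V"
  have "nb (x(e := b)) S v = nb x S v" if "S \<subseteq> V" "v \<in> S" for x b S v
    using ignores_nb[of v e S] that e by (auto simp: ignores_def)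
  then show ?thesis unfolding ignores_def kcore_def by (intro allI arg_cong[of _ _ Union]) auto
qed

context bernoulli_product begin

lemma pr_conj_indep:
  assumes "\<And>i. i \<in> I \<Longrightarrow> ignores i E \<or> ignores i F"
  shows "pr p I (\<lambda>x. E x \<and> F x) = pr p I E * pr p I F"
  unfolding of_bool_conj using assms I p
  by (intro expect_mult_indep) (auto intro: ignores_comp)

text \<open>By \<open>inj\<close>, different \<open>b\<close> look at different coordinates, so
  their events are independent, and each has probability at most \<open>p * card A\<close> by the
  union bound. Since \<open>edge\<close> may leave \<open>I\<close>, the bound for single
  coordinates enters as \<open>le\<close>.\<close>

lemma pr_ball_ex_nb_le:
  fixes A B :: "'v set" and edge :: "'v \<Rightarrow> 'v \<Rightarrow> 'i"
  assumes "finite A" "finite B"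
    and inj: "\<And>a b a' b'. a \<in> A \<Longrightarrow> b \<in> B \<Longrightarrow> a' \<in> A \<Longrightarrow> b' \<in> B \<Longrightarrow> edge a b = edge a' b' \<Longrightarrow> b = b'"
    and le: "\<And>i. pr p I (\<lambda>x. x i) \<le> p"
  shows "pr p I (\<lambda>x. \<forall>b\<in>B. \<exists>a\<in>A. x (edge a b)) \<le> (p * card A) ^ card B"
  using assms(2) inj
proof (induction B rule: finite_induct)
  case (insert b B)
  have "pr p I (\<lambda>x. (\<exists>a\<in>A. x (edge a b)) \<and> (\<forall>b\<in>B. \<exists>a\<in>A. x (edge a b)))
      = pr p I (\<lambda>x. \<exists>a\<in>A. x (edge a b)) * pr p I (\<lambda>x. \<forall>b\<in>B. \<exists>a\<in>A. x (edge a b))"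
  proof (rule pr_conj_indep)
    fix i
    show "ignores i (\<lambda>x. \<exists>a\<in>A. x (edge a b)) \<or> ignores i (\<lambda>x. \<forall>b\<in>B. \<exists>a\<in>A. x (edge a b))"
    proof (cases "\<exists>a\<in>A. i = edge a b")
      case True
      then have "edge a' b' \<noteq> i" if "a' \<in> A" "b' \<in> B" for a' b'
        using that insert.prems insert.hyps by blast
      then have "ignores i (\<lambda>x. \<forall>b\<in>B. \<exists>a\<in>A. x (edge a b))" by (intro ignores_ball ignores_bex ignores_coord)
      then show ?thesis ..
    next
      case False
      then have "ignores i (\<lambda>x. \<exists>a\<in>A. x (edge a b))" by (intro ignores_bex ignores_coord) auto
      then show ?thesis ..
    qed
  qed
  also have "\<dots> \<le> (p * card A) * (p * card A) ^ card B"
  proof (intro mult_mono)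
    have "pr p I (\<lambda>x. \<exists>a\<in>A. x (edge a b)) \<le> (\<Sum>a\<in>A. pr p I (\<lambda>x. x (edge a b)))"
      by (rule pr_bex_le) fact
    also have "\<dots> \<le> (\<Sum>a\<in>A. p)" by (intro sum_mono le)
    finally show "pr p I (\<lambda>x. \<exists>a\<in>A. x (edge a b)) \<le> p * card A" by (simp add: mult.commute)
    show "pr p I (\<lambda>x. \<forall>b\<in>B. \<exists>a\<in>A. x (edge a b)) \<le> (p * card A) ^ card B"
    proof (rule insert.IH)
      fix a b a' b' assume "a \<in> A" "b \<in> B" "a' \<in> A" "b' \<in> B" "edge a b = edge a' b'"
      then show "b = b'" by (intro insert.prems[of a b a' b']) auto
    qed
  qed (use p in \<open>auto intro!: expect_nonneg\<close>)
  finally show ?case using insert.hyps by simp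
qed simp

text \<open>Outside \<open>I\<close> a coordinate has the default value \<open>False\<close>, hence
  probability 0.\<close>

lemma pr_coord_le: "pr p I (\<lambda>x. x i) \<le> p"
proof (cases "i \<in> I")
  case False
  have "pr p I (\<lambda>x. x i) = 0"
    unfolding expect_def
  proof (rule integral_eq_zero_AE)
    show "AE x in measure_pmf (Pi_pmf I False (\<lambda>_. bernoulli_pmf p)). of_bool (x i) = (0::real)"
      using set_Pi_pmf_subset[OF I, of False "\<lambda>_. bernoulli_pmf p"] False
      by (auto simp: AE_measure_pmf_iff)
  qed
  then show ?thesis using p by simp
qed (simp add: pr_coord)

end

lemma sum_power_card_Pow:
  fixes a :: real
  assumes "finite U"
  shows "(\<Sum>B\<in>Pow U. a ^ card B) = (1 + a) ^ card U"
  using prod_add[OF assms, of "\<lambda>_. a" "\<lambda>_. 1"] by (simp add: add.commute)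

lemma sum_Pow_nonempty:
  fixes g :: "'a set \<Rightarrow> real"
  assumes "finite U"
  shows "(\<Sum>T\<in>Pow U. g T) = g {} + (\<Sum>T\<in>Pow U - {{}}. g T)"
  using assms by (subst sum.remove[of _ "{}"]) auto

text \<open>Double counting: a search set \<open>T\<close> with first layer \<open>B\<close>
  corresponds to \<open>B\<close> together with the vertices \<open>T - B\<close> found
  later.\<close>

lemma sum_Pow_split:
  fixes g :: "'a set \<Rightarrow> 'a set \<Rightarrow> real"
  assumes "finite U"
  shows "(\<Sum>T\<in>Pow U - {{}}. \<Sum>B\<in>Pow T - {{}}. g B (T - B)) =
    (\<Sum>B\<in>Pow U - {{}}. \<Sum>T\<in>Pow (U - B). g B T)"
proof -
  have fin: "finite T" if "T \<subseteq> U" for T using that assms finite_subset by blast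
  have "(\<Sum>T\<in>Pow U - {{}}. \<Sum>B\<in>Pow T - {{}}. g B (T - B)) =
      (\<Sum>(T, B)\<in>Sigma (Pow U - {{}}) (\<lambda>T. Pow T - {{}}). g B (T - B))"
    using assms fin by (intro sum.Sigma) auto
  also have "\<dots> = (\<Sum>(B, T)\<in>Sigma (Pow U - {{}}) (\<lambda>B. Pow (U - B)). g B T)"
    by (rule sum.reindex_bij_witness[of _ "\<lambda>(B, T). (B \<union> T, B)" "\<lambda>(T, B). (B, T - B)"]) auto
  also have "\<dots> = (\<Sum>B\<in>Pow U - {{}}. \<Sum>T\<in>Pow (U - B). g B T)"
    using assms fin by (intro sum.Sigma[symmetric]) auto
  finally show ?thesis .
qed

context bernoulli_product begin

lemma pr_nonneg: "0 \<le> pr p I E"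
  by (rule expect_nonneg) simp

end

section \<open>Search trees and light sets in the random graph\<close>

locale random_graph = bernoulli_product p I for p :: real and I :: "'v set set"
begin

text \<open>Union bound over the first layer \<open>B\<close>. Edges from \<open>A\<close> to
  \<open>B\<close> are not contained in \<open>T\<close>, while the rest of the search looks only at
  edges inside \<open>T\<close>, so the two events are independent.\<close>

lemma pr_reach_le:
  assumes "finite T" "T \<noteq> {}" "finite A" "A \<inter> T = {}"
  shows "pr p I (\<lambda>x. reach x A T) \<le>
    (\<Sum>B\<in>Pow T - {{}}. (p * card A) ^ card B * pr p I (\<lambda>x. reach x B (T - B)))"
proof -
  have "pr p I (\<lambda>x. reach x A T) \<le>
      pr p I (\<lambda>x. \<exists>B\<in>Pow T - {{}}. (\<forall>b\<in>B. \<exists>a\<in>A. x {a, b}) \<and> reach x B (T - B))"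
  proof (rule pr_mono)
    fix x assume "reach x A T"
    then show "\<exists>B\<in>Pow T - {{}}. (\<forall>b\<in>B. \<exists>a\<in>A. x {a, b}) \<and> reach x B (T - B)"
    proof cases
      case (reach_step B)
      then show ?thesis by (intro bexI[of _ B]) auto
    qed (use assms(2) in simp)
  qed
  also have "\<dots> \<le> (\<Sum>B\<in>Pow T - {{}}. pr p I (\<lambda>x. (\<forall>b\<in>B. \<exists>a\<in>A. x {a, b}) \<and> reach x B (T - B)))"
    using assms by (intro pr_bex_le) auto
  also have "\<dots> \<le> (\<Sum>B\<in>Pow T - {{}}. (p * card A) ^ card B * pr p I (\<lambda>x. reach x B (T - B)))"
  proof (rule sum_mono)
    fix B assume "B \<in> Pow T - {{}}"
    then have B: "B \<subseteq> T" by auto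
    have "pr p I (\<lambda>x. (\<forall>b\<in>B. \<exists>a\<in>A. x {a, b}) \<and> reach x B (T - B)) =
        pr p I (\<lambda>x. \<forall>b\<in>B. \<exists>a\<in>A. x {a, b}) * pr p I (\<lambda>x. reach x B (T - B))"
    proof (rule pr_conj_indep)
      fix e
      show "ignores e (\<lambda>x. \<forall>b\<in>B. \<exists>a\<in>A. x {a, b}) \<or> ignores e (\<lambda>x. reach x B (T - B))"
      proof (cases "e \<subseteq> T")
        case True
        then have "{a, b} \<noteq> e" if "a \<in> A" for a b using that assms(4) by blast
        then have "ignores e (\<lambda>x. \<forall>b\<in>B. \<exists>a\<in>A. x {a, b})" by (intro ignores_ball ignores_bex ignores_coord)
        then show ?thesis ..
      next
        case False
        then have "ignores e (\<lambda>x. reach x B (T - B))" using B by (intro ignores_reach) blast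
        then show ?thesis ..
      qed
    qed
    also have "\<dots> \<le> (p * card A) ^ card B * pr p I (\<lambda>x. reach x B (T - B))"
    proof (intro mult_right_mono pr_ball_ex_nb_le pr_nonneg pr_coord_le)
      show "finite B" using B assms(1) finite_subset by blast
      fix a b a' b' assume "a \<in> A" "b \<in> B" "a' \<in> A" "b' \<in> B" "{a, b} = {a', b'}"
      then show "b = b'" using B assms(4) by (auto simp: doubleton_eq_iff)
    qed fact
    finally show "pr p I (\<lambda>x. (\<forall>b\<in>B. \<exists>a\<in>A. x {a, b}) \<and> reach x B (T - B)) \<le>
        (p * card A) ^ card B * pr p I (\<lambda>x. reach x B (T - B))" .
  qed
  finally show ?thesis .
qed

text \<open>This replaces Cayley's formula. The generating function of rooted trees of bounded height is
  obtained by iterating \<open>y \<mapsto> exp (z y)\<close>, here with \<open>z = w p n\<close>. For \<open>z \<le> exp (-1)\<close> the iterates stay below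
  \<open>exp 1\<close>, and each vertex of \<open>A\<close> contributes one such factor.\<close>

lemma sum_pr_reach_le:
  fixes A U :: "'v set"
  assumes "finite U" "finite A" "A \<inter> U = {}" and w: "0 \<le> w" "w * p * N \<le> exp (-1)" and "card U \<le> N"
  shows "(\<Sum>T\<in>Pow U. w ^ card T * pr p I (\<lambda>x. reach x A T)) \<le> exp (card A)"
  using assms(1,2,3,6)
proof (induction "card U" arbitrary: U A rule: less_induct)
  case less
  define \<rho> where "\<rho> = (\<lambda>A T. pr p I (\<lambda>x. reach x A T))"
  define z where "z = w * (p * card A)"
  have z0: "0 \<le> z" using w p by (simp add: z_def)
  have \<rho>0: "0 \<le> \<rho> A T" for A T unfolding \<rho>_def by (rule pr_nonneg)
  have fin: "finite T" if "T \<subseteq> U" for T using that less.prems finite_subset by blast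
  have "(\<Sum>T\<in>Pow U - {{}}. w ^ card T * \<rho> A T) \<le>
      (\<Sum>T\<in>Pow U - {{}}. \<Sum>B\<in>Pow T - {{}}. z ^ card B * (w ^ card (T - B) * \<rho> B (T - B)))"
  proof (rule sum_mono)
    fix T assume T: "T \<in> Pow U - {{}}"
    have "w ^ card T * \<rho> A T \<le> w ^ card T * (\<Sum>B\<in>Pow T - {{}}. (p * card A) ^ card B * \<rho> B (T - B))"
      unfolding \<rho>_def using T less.prems w fin by (intro mult_left_mono pr_reach_le) auto
    also have "\<dots> = (\<Sum>B\<in>Pow T - {{}}. z ^ card B * (w ^ card (T - B) * \<rho> B (T - B)))"
      unfolding sum_distrib_left
    proof (rule sum.cong[OF refl])
      fix B assume B: "B \<in> Pow T - {{}}"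
      then have "card T = card B + card (T - B)"
        using T fin by (metis DiffD1 PowD card_Diff_subset card_mono finite_subset le_add_diff_inverse)
      then show "w ^ card T * ((p * card A) ^ card B * \<rho> B (T - B)) =
          z ^ card B * (w ^ card (T - B) * \<rho> B (T - B))"
        by (simp add: z_def power_add power_mult_distrib)
    qed
    finally show "w ^ card T * \<rho> A T \<le>
        (\<Sum>B\<in>Pow T - {{}}. z ^ card B * (w ^ card (T - B) * \<rho> B (T - B)))" .
  qed
  also have "\<dots> = (\<Sum>B\<in>Pow U - {{}}. \<Sum>T\<in>Pow (U - B). z ^ card B * (w ^ card T * \<rho> B T))"
    by (rule sum_Pow_split) fact
  also have "\<dots> \<le> (\<Sum>B\<in>Pow U - {{}}. z ^ card B * exp 1 ^ card B)"
  proof (rule sum_mono)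
    fix B assume B: "B \<in> Pow U - {{}}"
    have "(\<Sum>T\<in>Pow (U - B). w ^ card T * \<rho> B T) \<le> exp (card B)"
      unfolding \<rho>_def
    proof (rule less.hyps)
      show "card (U - B) < card U" using B less.prems(1) by (intro psubset_card_mono) auto
      then show "card (U - B) \<le> N" using less.prems by linarith
    qed (use B less.prems fin in auto)
    then show "(\<Sum>T\<in>Pow (U - B). z ^ card B * (w ^ card T * \<rho> B T)) \<le> z ^ card B * exp 1 ^ card B"
      unfolding sum_distrib_left[symmetric] using z0
      by (intro mult_left_mono) (auto simp flip: exp_of_nat_mult)
  qed
  finally have "(\<Sum>T\<in>Pow U. w ^ card T * \<rho> A T) \<le> 1 + (\<Sum>B\<in>Pow U - {{}}. (z * exp 1) ^ card B)"
    unfolding sum_Pow_nonempty[OF less.prems(1), of "\<lambda>T. w ^ card T * \<rho> A T"]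
    by (simp add: power_mult_distrib \<rho>_def reach.reach_empty)
  also have "\<dots> = (\<Sum>B\<in>Pow U. (z * exp 1) ^ card B)"
    by (simp add: sum_Pow_nonempty[OF less.prems(1)])
  also have "\<dots> = (1 + z * exp 1) ^ card U" by (rule sum_power_card_Pow) fact
  also have "\<dots> \<le> exp (z * exp 1) ^ card U"
    using z0 by (intro power_mono exp_ge_add_one_self) auto
  also have "\<dots> = exp (card U * (z * exp 1))" by (simp add: exp_of_nat_mult)
  also have "\<dots> \<le> exp (card A)"
  proof -
    have "w * p * card U \<le> w * p * N" using less.prems w p by (intro mult_left_mono) auto
    then have "w * p * card U \<le> exp (-1)" using w by linarith
    then have "(w * p * card U) * exp 1 \<le> exp (-1) * exp 1" by (intro mult_right_mono) auto
    then have "real (card A) * (w * p * card U * exp 1) \<le> real (card A) * 1"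
      by (intro mult_left_mono) (auto simp flip: exp_add)
    then show ?thesis by (simp add: z_def mult_ac)
  qed
  finally show ?case unfolding \<rho>_def .
qed

lemma pr_card_nb:
  assumes "finite U" "a \<notin> U" "\<And>u. u \<in> U \<Longrightarrow> {a, u} \<in> I"
  shows "pr p I (\<lambda>x. card (nb x U a) = j) = (card U choose j) * p ^ j * (1 - p) ^ (card U - j)"
  using assms
proof (induction U arbitrary: j rule: finite_induct)
  case empty
  then show ?case by (cases j) (auto simp: nb_def)
next
  case (insert u U)
  let ?c = "\<lambda>x. card (nb x U a)"
  have nd: "ignores {a, u} (\<lambda>x. g (?c x))" for g :: "nat \<Rightarrow> real"
    using insert.hyps insert.prems by (intro ignores_comp[of _ "\<lambda>x. nb x U a" "\<lambda>N. g (card N)", OF ignores_nb]) auto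
  have card: "card (nb x (insert u U) a) = (if x {a, u} then Suc (?c x) else ?c x)" for x
  proof -
    have "nb x (insert u U) a = (if x {a, u} then insert u (nb x U a) else nb x U a)"
      using insert.prems by (auto simp: nb_def)
    moreover have "u \<notin> nb x U a" using insert.hyps by (auto simp: nb_def)
    ultimately show ?thesis using finite_nb[OF insert.hyps(1)] by simp
  qed
  have e: "{a, u} \<in> I" using insert.prems by simp
  have "pr p I (\<lambda>x. card (nb x (insert u U) a) = j) =
      expect p I (\<lambda>x. of_bool (x {a, u}) * of_bool (Suc (?c x) = j) +
        (of_bool (?c x = j) - of_bool (x {a, u}) * of_bool (?c x = j)))"
    unfolding card by (intro arg_cong[of _ _ "expect p I"] ext) auto
  also have "\<dots> = p * pr p I (\<lambda>x. Suc (?c x) = j) + (pr p I (\<lambda>x. ?c x = j) - p * pr p I (\<lambda>x. ?c x = j))"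
    unfolding expect_add expect_diff using nd[of "\<lambda>c. of_bool (Suc c = j)"] nd[of "\<lambda>c. of_bool (c = j)"] e
    by (simp add: expect_coord)
  also have "\<dots> = p * pr p I (\<lambda>x. Suc (?c x) = j) + (1 - p) * pr p I (\<lambda>x. ?c x = j)"
    by (simp add: algebra_simps)
  also have "\<dots> = (card (insert u U) choose j) * p ^ j * (1 - p) ^ (card (insert u U) - j)"
  proof (cases j)
    case 0
    then show ?thesis using insert by (simp add: insert.IH[of 0])
  next
    case (Suc i)
    have IH: "pr p I (\<lambda>x. ?c x = j) = (card U choose j) * p ^ j * (1 - p) ^ (card U - j)" for j
      using insert by simp
    show ?thesis
    \<comment> \<open>For \<open>j > card U\<close> the subtraction in the exponent is truncated,
      but the binomial coefficient vanishes.\<close>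
    proof (cases "j \<le> card U")
      case True
      then have "card U - i = Suc (card U - j)" using Suc by simp
      then show ?thesis using Suc insert.hyps by (simp add: IH algebra_simps)
    next
      case False
      then have "card U choose j = 0" by (simp add: binomial_eq_0)
      then show ?thesis using Suc insert.hyps by (simp add: IH algebra_simps)
    qed
  qed
  finally show ?case .
qed

lemma pr_card_nb_less:
  assumes "finite U" "a \<notin> U" "\<And>u. u \<in> U \<Longrightarrow> {a, u} \<in> I"
  shows "pr p I (\<lambda>x. card (nb x U a) < k) = (\<Sum>j<k. (card U choose j) * p ^ j * (1 - p) ^ (card U - j))"
proof -
  have "pr p I (\<lambda>x. card (nb x U a) < k) = expect p I (\<lambda>x. \<Sum>j<k. of_bool (card (nb x U a) = j))"
    by (intro arg_cong[of _ _ "expect p I"] ext) (auto simp: of_bool_def sum.delta)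
  also have "\<dots> = (\<Sum>j<k. pr p I (\<lambda>x. card (nb x U a) = j))" by (rule expect_sum)
  also have "\<dots> = (\<Sum>j<k. (card U choose j) * p ^ j * (1 - p) ^ (card U - j))"
    by (intro sum.cong refl pr_card_nb assms)
  finally show ?thesis .
qed

text \<open>The search looks at edges inside \<open>insert a T\<close>, lightness of
  \<open>w\<close> at edges from \<open>w\<close> to the outside. These edge sets are disjoint, also
  for different \<open>w\<close>, so each vertex of \<open>W\<close> gives a factor
  \<open>q\<close>. The choice \<open>W = T\<close> serves \<open>big_light\<close> with its exempt
  root, \<open>W = insert a T\<close> a whole component of the complement.\<close>

lemma pr_reach_light_le:
  assumes V: "finite V" "[V]\<^bsup>2\<^esup> \<subseteq> I" and S: "insert a T \<subseteq> V" and W: "W \<subseteq> insert a T"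
    and q: "(\<Sum>j<k. (card (V - insert a T) choose j) * p ^ j * (1 - p) ^ (card (V - insert a T) - j)) \<le> q"
  shows "pr p I (\<lambda>x. reach x {a} T \<and> (\<forall>w\<in>W. card (nb x (V - insert a T) w) < k))
    \<le> pr p I (\<lambda>x. reach x {a} T) * q ^ card W"
proof -
  let ?L = "\<lambda>w x. card (nb x (V - insert a T) w) < k"
  have L: "pr p I (?L w) \<le> q" if "w \<in> insert a T" for w
  proof -
    have "{w, u} \<in> I" if u: "u \<in> V - insert a T" for u
    proof -
      have "w \<noteq> u" "w \<in> V" using u \<open>w \<in> insert a T\<close> S by auto
      then have "{w, u} \<in> [V]\<^bsup>2\<^esup>" using u by (simp add: nsets_def)
      then show ?thesis using V(2) by blast
    qed
    then show ?thesis using that V q by (subst pr_card_nb_less) auto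
  qed
  have q0: "0 \<le> q" using L[of a] pr_nonneg[of "?L a"] by simp
  have "finite W" using W S V finite_subset by metis
  then show ?thesis using W
  proof (induction W rule: finite_induct)
    case (insert w W)
    have "pr p I (\<lambda>x. ?L w x \<and> (reach x {a} T \<and> (\<forall>w\<in>W. ?L w x))) =
        pr p I (?L w) * pr p I (\<lambda>x. reach x {a} T \<and> (\<forall>w\<in>W. ?L w x))"
    proof (rule pr_conj_indep)
      fix e
      show "ignores e (?L w) \<or> ignores e (\<lambda>x. reach x {a} T \<and> (\<forall>w\<in>W. ?L w x))"
      proof (cases "\<exists>u\<in>V - insert a T. e = {w, u}")
        case True
        then obtain u where u: "u \<in> V - insert a T" "e = {w, u}" by auto
        have "ignores e (\<lambda>x. reach x {a} T)" using u by (intro ignores_reach) auto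
        moreover have "ignores e (\<lambda>x. \<forall>w\<in>W. ?L w x)"
        proof (rule ignores_ball)
          fix w' assume "w' \<in> W"
          then have "\<not> (w' \<in> e)" using u insert by auto
          then show "ignores e (?L w')"
            by (intro ignores_comp[of _ "\<lambda>x. nb x (V - insert a T) w'" "\<lambda>N. card N < k", OF ignores_nb]) auto
        qed
        ultimately have "ignores e (\<lambda>x. reach x {a} T \<and> (\<forall>w\<in>W. ?L w x))" by (rule ignores_conj)
        then show ?thesis ..
      next
        case False
        have "ignores e (\<lambda>x. nb x (V - insert a T) w)"
          unfolding ignores_def nb_def using False by auto
        then have "ignores e (?L w)" by (rule ignores_comp)
        then show ?thesis ..
      qed
    qed
    also have "\<dots> \<le> q * (pr p I (\<lambda>x. reach x {a} T) * q ^ card W)"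
      using insert.prems q0 by (intro mult_mono L insert.IH pr_nonneg) auto
    finally show ?case using insert.hyps by (simp add: mult_ac conj_ac)
  qed simp
qed

text \<open>\<open>sum_pr_reach_le\<close> with weight \<open>\<theta> * q\<close>: inserting
  \<open>\<theta> ^ card T / \<theta> ^ M\<close>, which is at least 1, converts the slack \<theta>
  into exponential decay in \<open>M\<close>. The factor \<open>card V\<close> counts the roots. The
  bound \<open>q\<close> must reach down to \<open>card V - 2 * M\<close> because
  \<open>insert a T\<close> has at most \<open>2 * M\<close> vertices.\<close>

lemma pr_big_light_le:
  assumes V: "finite V" "[V]\<^bsup>2\<^esup> \<subseteq> I"
    and q: "\<And>m. m + 2 * M \<ge> card V \<Longrightarrow> m \<le> card V \<Longrightarrow> (\<Sum>j<k. (m choose j) * p ^ j * (1 - p) ^ (m - j)) \<le> q"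
    and \<theta>: "\<theta> > 0" "\<theta> * q * p * card V \<le> exp (-1)" and q0: "0 \<le> q" and \<theta>1: "\<theta> \<ge> 1"
  shows "pr p I (\<lambda>x. big_light k V M x) \<le> card V * (exp 1 / \<theta> ^ M)"
proof -
  define R where "R = (\<lambda>a T x. reach x {a} T \<and> (\<forall>w\<in>T. card (nb x (V - insert a T) w) < k))"
  have "pr p I (\<lambda>x. big_light k V M x) \<le>
      pr p I (\<lambda>x. \<exists>a\<in>V. \<exists>T\<in>{T \<in> Pow (V - {a}). M \<le> card T \<and> card T < 2 * M}. R a T x)"
    by (rule pr_mono) (auto simp: big_light_def R_def)
  also have "\<dots> \<le> (\<Sum>a\<in>V. pr p I (\<lambda>x. \<exists>T\<in>{T \<in> Pow (V - {a}). M \<le> card T \<and> card T < 2 * M}. R a T x))"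
    by (rule pr_bex_le) fact
  also have "\<dots> \<le> (\<Sum>a\<in>V. exp 1 / \<theta> ^ M)"
  proof (rule sum_mono)
    fix a assume a: "a \<in> V"
    let ?TT = "{T \<in> Pow (V - {a}). M \<le> card T \<and> card T < 2 * M}"
    have "pr p I (\<lambda>x. \<exists>T\<in>?TT. R a T x) \<le> (\<Sum>T\<in>?TT. pr p I (R a T))"
      using V by (intro pr_bex_le) auto
    also have "\<dots> \<le> (\<Sum>T\<in>?TT. (\<theta> * q) ^ card T * pr p I (\<lambda>x. reach x {a} T) / \<theta> ^ M)"
    proof (rule sum_mono)
      fix T assume T: "T \<in> ?TT"
      then have fT: "finite T" using V finite_subset by blast
      have cS: "card (insert a T) = Suc (card T)" using T fT by (intro card_insert_disjoint) auto
      have "card (insert a T) \<le> card V" using T a V by (intro card_mono) auto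
      moreover have "card (V - insert a T) = card V - card (insert a T)"
        using T a fT by (intro card_Diff_subset) auto
      ultimately have "pr p I (R a T) \<le> pr p I (\<lambda>x. reach x {a} T) * q ^ card T"
        unfolding R_def using T a cS by (intro pr_reach_light_le V q) auto
      also have "\<dots> \<le> pr p I (\<lambda>x. reach x {a} T) * q ^ card T * (\<theta> ^ card T / \<theta> ^ M)"
        using T \<theta>1 q0 pr_nonneg[of "\<lambda>x. reach x {a} T"] mult_left_mono[of 1 "\<theta> ^ card T / \<theta> ^ M"
          "pr p I (\<lambda>x. reach x {a} T) * q ^ card T"] by (simp add: power_increasing)
      finally show "pr p I (R a T) \<le> (\<theta> * q) ^ card T * pr p I (\<lambda>x. reach x {a} T) / \<theta> ^ M"
        by (simp add: power_mult_distrib mult_ac)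
    qed
    also have "\<dots> \<le> (\<Sum>T\<in>Pow (V - {a}). (\<theta> * q) ^ card T * pr p I (\<lambda>x. reach x {a} T) / \<theta> ^ M)"
      using V \<theta> q0 by (intro sum_mono2) (auto intro!: divide_nonneg_nonneg mult_nonneg_nonneg pr_nonneg)
    also have "\<dots> = (\<Sum>T\<in>Pow (V - {a}). (\<theta> * q) ^ card T * pr p I (\<lambda>x. reach x {a} T)) / \<theta> ^ M"
      by (simp add: sum_divide_distrib)
    also have "\<dots> \<le> exp (card {a}) / \<theta> ^ M"
      using V \<theta> q0 a by (intro divide_right_mono sum_pr_reach_le[where N = "card V"]) (auto intro: card_mono)
    finally show "pr p I (\<lambda>x. \<exists>T\<in>?TT. R a T x) \<le> exp 1 / \<theta> ^ M" by simp
  qed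
  finally show ?thesis by simp
qed

text \<open>Without a big light set, the component of \<open>a\<close> outside the core has at most
  \<open>M\<close> vertices, and all of them, including \<open>a\<close>, are light. The factor
  \<open>q\<close> for the root makes the bound \<open>q * exp 1\<close>, which can later be
  compared with 1 / k.\<close>

lemma pr_notin_kcore_le:
  assumes V: "finite V" "[V]\<^bsup>2\<^esup> \<subseteq> I" and a: "a \<in> V" and M: "M \<ge> 1"
    and q: "\<And>m. m + 2 * M \<ge> card V \<Longrightarrow> m \<le> card V \<Longrightarrow> (\<Sum>j<k. (m choose j) * p ^ j * (1 - p) ^ (m - j)) \<le> q"
    and q0: "0 \<le> q" "q * p * card V \<le> exp (-1)"
  shows "pr p I (\<lambda>x. a \<notin> kcore k V x) \<le> pr p I (\<lambda>x. big_light k V M x) + q * exp 1"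
proof -
  define R where "R = (\<lambda>T x. reach x {a} T \<and> (\<forall>w\<in>insert a T. card (nb x (V - insert a T) w) < k))"
  let ?TT = "{T \<in> Pow (V - {a}). card T < M}"
  have "pr p I (\<lambda>x. a \<notin> kcore k V x) \<le> pr p I (\<lambda>x. big_light k V M x \<or> (\<exists>T\<in>?TT. R T x))"
  proof (rule pr_mono)
    fix x assume x: "a \<notin> kcore k V x"
    have "(\<exists>T\<in>?TT. R T x) \<or> big_light k V M x"
    proof (rule disjCI)
      assume good: "\<not> big_light k V M x"
      define C where "C = component x (V - kcore k V x) a"
      have aC: "a \<in> C" unfolding C_def using a x by (intro mem_component_self) auto
      have CV: "C \<subseteq> V" using component_subset[of x "V - kcore k V x" a] by (auto simp: C_def)
      have cC: "card C \<le> M" unfolding C_def by (rule card_component_le[OF V(1) M good])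
      have ins: "insert a (C - {a}) = C" using aC by auto
      have "reach x {a} (C - {a})" unfolding C_def using V a x by (intro reach_component) auto
      moreover have "card (nb x (V - C) w) < k" if "w \<in> C" for w
        using that unfolding C_def by (intro component_removed_light V)
      ultimately have "R (C - {a}) x" unfolding R_def ins by blast
      moreover have "card (C - {a}) < M"
        using aC cC V CV finite_subset[of C V] card_Diff1_less[of C a] by auto
      ultimately show "\<exists>T\<in>?TT. R T x" using CV by (intro bexI[of _ "C - {a}"]) auto
    qed
    then show "big_light k V M x \<or> (\<exists>T\<in>?TT. R T x)" by blast
  qed
  also have "\<dots> \<le> pr p I (\<lambda>x. big_light k V M x) + pr p I (\<lambda>x. \<exists>T\<in>?TT. R T x)" by (rule pr_disj_le)
  also have "pr p I (\<lambda>x. \<exists>T\<in>?TT. R T x) \<le> q * exp 1"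
  proof -
    have "pr p I (\<lambda>x. \<exists>T\<in>?TT. R T x) \<le> (\<Sum>T\<in>?TT. pr p I (R T))"
      using V by (intro pr_bex_le) auto
    also have "\<dots> \<le> (\<Sum>T\<in>?TT. q * (q ^ card T * pr p I (\<lambda>x. reach x {a} T)))"
    proof (rule sum_mono)
      fix T assume T: "T \<in> ?TT"
      then have fT: "finite T" using V finite_subset by blast
      have cS: "card (insert a T) = Suc (card T)" using T fT by (intro card_insert_disjoint) auto
      have "card (insert a T) \<le> card V" using T a V by (intro card_mono) auto
      moreover have "card (V - insert a T) = card V - card (insert a T)"
        using T a fT by (intro card_Diff_subset) auto
      ultimately have "pr p I (R T) \<le> pr p I (\<lambda>x. reach x {a} T) * q ^ card (insert a T)"
        unfolding R_def using T a cS by (intro pr_reach_light_le V q) auto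
      then show "pr p I (R T) \<le> q * (q ^ card T * pr p I (\<lambda>x. reach x {a} T))"
        unfolding cS by (simp add: mult_ac)
    qed
    also have "\<dots> \<le> (\<Sum>T\<in>Pow (V - {a}). q * (q ^ card T * pr p I (\<lambda>x. reach x {a} T)))"
      using V q0 by (intro sum_mono2) (auto intro!: mult_nonneg_nonneg pr_nonneg)
    also have "\<dots> \<le> q * exp (card {a})"
      unfolding sum_distrib_left[symmetric] using V q0 a
      by (intro mult_left_mono sum_pr_reach_le[where N = "card V"]) (auto intro: card_mono)
    finally show ?thesis by simp
  qed
  finally show ?thesis by simp
qed

end

section \<open>Variance\<close>

context bernoulli_product begin

lemma expect_coord_mult:
  assumes "i \<in> I"
  shows "expect p I (\<lambda>x. of_bool (x i) * u x) = p * expect p I u + p * (1 - p) * expect p I (dif i u)"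
proof -
  have "av p i (\<lambda>x. of_bool (x i) * u x) = (\<lambda>x. p * av p i u x + p * (1 - p) * dif i u x)"
    by (simp add: av_def dif_def fun_eq_iff algebra_simps)
  then have "expect p I (\<lambda>x. of_bool (x i) * u x) = expect p I (\<lambda>x. p * av p i u x + p * (1 - p) * dif i u x)"
    using expect_av[OF assms, of "\<lambda>x. of_bool (x i) * u x"] by simp
  then show ?thesis by (simp only: expect_add expect_cmult expect_av[OF assms])
qed

lemma expect_count_mult:
  "expect p I (\<lambda>x. (\<Sum>i\<in>I. of_bool (x i)) * u x) =
    p * card I * expect p I u + p * (1 - p) * (\<Sum>i\<in>I. expect p I (dif i u))"
proof -
  have "expect p I (\<lambda>x. (\<Sum>i\<in>I. of_bool (x i)) * u x) = (\<Sum>i\<in>I. expect p I (\<lambda>x. of_bool (x i) * u x))"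
    unfolding sum_distrib_right by (rule expect_sum)
  also have "\<dots> = (\<Sum>i\<in>I. p * expect p I u + p * (1 - p) * expect p I (dif i u))"
    by (intro sum.cong refl expect_coord_mult)
  finally show ?thesis by (simp add: sum.distrib sum_distrib_left mult_ac)
qed

text \<open>With \<open>N\<close> the number of true coordinates, the variance of
  \<open>u - r * N\<close> is nonnegative, so Var(u) >= 2 r Cov(u, N) - r^2 Var(N). All differences
  of \<open>N\<close> are 1, so the covariance needs only the mean differences of
  \<open>u\<close>.\<close>

lemma variance_ge:
  "expect p I (\<lambda>x. (u x - expect p I u)\<^sup>2) \<ge>
    2 * r * (p * (1 - p) * (\<Sum>i\<in>I. expect p I (dif i u))) - r\<^sup>2 * (p * (1 - p) * card I)"
proof -
  define N where "N = (\<lambda>x. \<Sum>i\<in>I. of_bool (x i) :: real)"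
  define \<nu> where "\<nu> = p * card I"
  define \<mu> where "\<mu> = expect p I u"
  have exN: "expect p I N = \<nu>"
    unfolding N_def \<nu>_def expect_sum by (simp add: pr_coord)
  have dN: "dif i N = (\<lambda>x. 1)" if "i \<in> I" for i
  proof
    fix x
    have "N (x(i := b)) = of_bool b + (\<Sum>j\<in>I - {i}. of_bool (x j))" for b
      unfolding N_def using that I by (subst sum.remove[of I i]) (auto intro!: sum.cong)
    then show "dif i N x = 1" by (simp add: dif_def)
  qed
  have count: "expect p I (\<lambda>x. N x * v x) = \<nu> * expect p I v + p * (1 - p) * (\<Sum>i\<in>I. expect p I (dif i v))" for v
    unfolding N_def \<nu>_def by (rule expect_count_mult)
  have NN: "expect p I (\<lambda>x. N x * N x) = \<nu> * \<nu> + p * (1 - p) * card I"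
    using count[of N] dN by (simp add: exN)
  have Nu: "expect p I (\<lambda>x. N x * u x) = \<nu> * \<mu> + p * (1 - p) * (\<Sum>i\<in>I. expect p I (dif i u))"
    using count[of u] by (simp add: \<mu>_def)
  have "0 \<le> expect p I (\<lambda>x. ((u x - \<mu>) - r * (N x - \<nu>))\<^sup>2)" by (rule expect_nonneg) simp
  also have "(\<lambda>x. ((u x - \<mu>) - r * (N x - \<nu>))\<^sup>2) = (\<lambda>x. (u x - \<mu>)\<^sup>2 +
      (r\<^sup>2 * (N x * N x) + (2 * r * \<mu> - 2 * r\<^sup>2 * \<nu>) * N x + 2 * r * \<nu> * u x -
        2 * r * (N x * u x) + (r\<^sup>2 * \<nu>\<^sup>2 - 2 * r * \<mu> * \<nu>)))"
    by (simp add: fun_eq_iff power2_eq_square algebra_simps)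
  also have "expect p I \<dots> = expect p I (\<lambda>x. (u x - \<mu>)\<^sup>2) + (r\<^sup>2 * (p * (1 - p) * card I)
      - 2 * r * (p * (1 - p) * (\<Sum>i\<in>I. expect p I (dif i u))))"
    unfolding expect_add expect_diff expect_cmult expect_const NN Nu exN \<mu>_def[symmetric]
    by (simp add: power2_eq_square algebra_simps)
  finally show ?thesis unfolding \<mu>_def by simp
qed

end

context random_graph begin

text \<open>The core of \<open>V - {a}\<close> ignores the edges at \<open>a\<close>, so it is
  independent of the neighbourhood of \<open>a\<close>. On the event of degree \<open>k\<close>
  exactly \<open>k\<close> vertices \<open>b\<close> satisfy \<open>X b\<close>, so the union bound
  over neighbours outside that core loses the proportion \<open>k * \<rho>\<close>.\<close>

lemma pr_neighbours_in_kcore_ge: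
  assumes V: "finite V" "[V]\<^bsup>2\<^esup> \<subseteq> I" and a: "a \<in> V"
    and \<rho>: "\<And>b. b \<in> V - {a} \<Longrightarrow> pr p I (\<lambda>x. b \<notin> kcore k (V - {a}) x) \<le> \<rho>"
  shows "pr p I (\<lambda>x. card (nb x V a) = k) * (1 - k * \<rho>) \<le>
    pr p I (\<lambda>x. card (nb x V a) = k \<and> nb x V a \<subseteq> kcore k (V - {a}) x)"
proof -
  define D where "D = (\<lambda>x. card (nb x V a) = k)"
  define X where "X = (\<lambda>b x. D x \<and> x {a, b})"
  define Y where "Y = (\<lambda>b x. b \<notin> kcore k (V - {a}) x)"
  have indep: "pr p I (\<lambda>x. X b x \<and> Y b x) = pr p I (X b) * pr p I (Y b)" for b
  proof (rule pr_conj_indep)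
    fix e
    show "ignores e (X b) \<or> ignores e (Y b)"
    proof (cases "a \<in> e")
      case True
      then have "ignores e (\<lambda>x. kcore k (V - {a}) x)" by (intro ignores_kcore) auto
      then have "ignores e (Y b)" unfolding Y_def by (rule ignores_comp)
      then show ?thesis ..
    next
      case False
      then have "ignores e (\<lambda>x. nb x V a)" by (intro ignores_nb) auto
      then have "ignores e D" unfolding D_def by (rule ignores_comp)
      moreover have "ignores e (\<lambda>x. x {a, b})" using False by (intro ignores_coord) auto
      ultimately have "ignores e (X b)" unfolding X_def by (rule ignores_conj)
      then show ?thesis ..
    qed
  qed
  have nbV: "nb x V a = {b \<in> V - {a}. x {a, b}}" for x by (auto simp: nb_def)
  have "pr p I D \<le> pr p I (\<lambda>x. (D x \<and> nb x V a \<subseteq> kcore k (V - {a}) x) \<or> (\<exists>b\<in>V - {a}. X b x \<and> Y b x))"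
    by (rule pr_mono) (auto simp: nbV X_def Y_def)
  also have "\<dots> \<le> pr p I (\<lambda>x. D x \<and> nb x V a \<subseteq> kcore k (V - {a}) x) +
      pr p I (\<lambda>x. \<exists>b\<in>V - {a}. X b x \<and> Y b x)"
    by (rule pr_disj_le)
  also have "pr p I (\<lambda>x. \<exists>b\<in>V - {a}. X b x \<and> Y b x) \<le> k * \<rho> * pr p I D"
  proof -
    have "pr p I (\<lambda>x. \<exists>b\<in>V - {a}. X b x \<and> Y b x) \<le> (\<Sum>b\<in>V - {a}. pr p I (\<lambda>x. X b x \<and> Y b x))"
      using V by (intro pr_bex_le) auto
    also have "\<dots> \<le> (\<Sum>b\<in>V - {a}. pr p I (X b) * \<rho>)"
      unfolding indep by (intro sum_mono mult_left_mono pr_nonneg) (simp add: Y_def \<rho>)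
    also have "\<dots> = \<rho> * expect p I (\<lambda>x. \<Sum>b\<in>V - {a}. of_bool (X b x))"
      unfolding expect_sum by (simp add: sum_distrib_left mult.commute)
    also have "(\<lambda>x. \<Sum>b\<in>V - {a}. of_bool (X b x)) = (\<lambda>x. real k * of_bool (D x))"
    proof
      fix x
      have "(\<Sum>b\<in>V - {a}. of_bool (X b x)) = real (card ((V - {a}) \<inter> {b. X b x}))"
        using V by simp
      also have "\<dots> = real k * of_bool (D x)"
      proof (cases "D x")
        case True
        then have "(V - {a}) \<inter> {b. X b x} = nb x V a" by (auto simp: X_def nbV)
        then show ?thesis using True by (simp add: D_def)
      qed (simp add: X_def)
      finally show "(\<Sum>b\<in>V - {a}. of_bool (X b x)) = real k * of_bool (D x)" .
    qed
    finally show ?thesis unfolding expect_cmult by (simp add: mult_ac)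
  qed
  finally show ?thesis unfolding D_def by (simp add: algebra_simps)
qed

text \<open>Each vertex counted on the left has a present edge whose difference is at least 1, and
  an edge has two endpoints. Presence of \<open>e\<close> is independent of the difference at
  \<open>e\<close>, which gives the factor \<open>p\<close>.\<close>

lemma sum_dif_core_size_ge:
  assumes V: "finite V" "[V]\<^bsup>2\<^esup> = I" and k: "k \<ge> 1"
  shows "(\<Sum>a\<in>V. pr p I (\<lambda>x. card (nb x V a) = k \<and> nb x V a \<subseteq> kcore k (V - {a}) x))
    \<le> 2 * p * (\<Sum>e\<in>I. expect p I (dif e (core_size k V)))"
proof -
  define E where "E = (\<lambda>a x. card (nb x V a) = k \<and> nb x V a \<subseteq> kcore k (V - {a}) x)"
  define d where "d = (\<lambda>e x. of_bool (x e) * dif e (core_size k V) x)"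
  have d0: "0 \<le> d e x" for e x using dif_core_size_nonneg[OF V(1), of e k x] by (simp add: d_def)
  have pt: "(\<Sum>a\<in>V. of_bool (E a x)) \<le> 2 * (\<Sum>e\<in>I. d e x)" for x
  proof -
    have "(\<Sum>a\<in>V. of_bool (E a x)) \<le> (\<Sum>a\<in>V. \<Sum>e\<in>{e \<in> I. a \<in> e}. d e x)"
    proof (rule sum_mono)
      fix a assume a: "a \<in> V"
      show "of_bool (E a x) \<le> (\<Sum>e\<in>{e \<in> I. a \<in> e}. d e x)"
      proof (cases "E a x")
        case True
        then have "nb x V a \<noteq> {}" using k by (auto simp: E_def)
        then obtain b where b: "b \<in> nb x V a" by auto
        have "1 \<le> d {a, b} x"
          using dif_core_size_ge_1[OF V(1) a _ _ b, of k] True b by (auto simp: E_def d_def nb_def)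
        also have "\<dots> \<le> (\<Sum>e\<in>{e \<in> I. a \<in> e}. d e x)"
        proof (rule member_le_sum)
          show "{a, b} \<in> {e \<in> I. a \<in> e}" using a b V(2)[symmetric] by (auto simp: nb_def nsets_def card_insert_if)
          show "finite {e \<in> I. a \<in> e}" using I by simp
        qed (rule d0)
        finally show ?thesis using True by simp
      qed (simp add: sum_nonneg d0)
    qed
    also have "\<dots> = (\<Sum>e\<in>I. \<Sum>a\<in>{a \<in> V. a \<in> e}. d e x)"
      using V I by (intro sum.swap_restrict) auto
    also have "\<dots> = (\<Sum>e\<in>I. 2 * d e x)"
    proof (rule sum.cong[OF refl])
      fix e assume "e \<in> I"
      then have "{a \<in> V. a \<in> e} = e" "card e = 2" using V(2) by (auto simp: nsets_def)
      then show "(\<Sum>a\<in>{a \<in> V. a \<in> e}. d e x) = 2 * d e x" by simp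
    qed
    finally show ?thesis by (simp add: sum_distrib_left)
  qed
  have "(\<Sum>a\<in>V. pr p I (E a)) = expect p I (\<lambda>x. \<Sum>a\<in>V. of_bool (E a x))" by (rule expect_sum[symmetric])
  also have "\<dots> \<le> expect p I (\<lambda>x. 2 * (\<Sum>e\<in>I. d e x))" by (rule expect_mono[OF pt])
  also have "\<dots> = 2 * (\<Sum>e\<in>I. expect p I (d e))" by (simp only: expect_cmult expect_sum)
  also have "(\<Sum>e\<in>I. expect p I (d e)) = (\<Sum>e\<in>I. p * expect p I (dif e (core_size k V)))"
    unfolding d_def by (intro sum.cong refl expect_coord ignores_dif_same)
  finally show ?thesis unfolding E_def by (simp add: sum_distrib_left mult_ac)
qed

end

section \<open>Sparse random graphs of fixed size\<close>

lemma card_edges_le: "card ([{..<n}]\<^bsup>2\<^esup>) \<le> n\<^sup>2"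
proof -
  have "card ([{..<n}]\<^bsup>2\<^esup>) = n choose 2"
    using card_nsets[of "{..<n}" 2] by simp
  also have "\<dots> \<le> n * (n - 1)" unfolding choose_two by (rule div_le_dividend)
  also have "\<dots> \<le> n\<^sup>2" by (simp add: power2_eq_square)
  finally show ?thesis .
qed

lemma (in bernoulli_product) pr_bex_le_const:
  assumes "finite J" "\<And>j. j \<in> J \<Longrightarrow> pr p I (E j) \<le> B"
  shows "pr p I (\<lambda>x. \<exists>j\<in>J. E j x) \<le> real (card J) * B"
  using order_trans[OF pr_bex_le[OF assms(1)] sum_mono[OF assms(2)]] by simp

text \<open>The sums bounded by \<open>q\<close> are probabilities that a binomial variable is below
  \<open>k\<close>. Here \<open>m\<close> goes down to \<open>n - 2 * M - 1\<close>: light sets take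
  away up to \<open>2 * M\<close> vertices, the variance argument one more. \<theta> is the slack in
  \<open>q * c \<le> exp (-1)\<close>.\<close>

locale sparse_graph =
  fixes c :: real and n k M :: nat and q \<theta> :: real
  assumes c: "0 < c" "2 * c \<le> n" and k: "1 \<le> k" and M: "1 \<le> M" "2 * M \<le> n"
    and q: "0 < q" "\<And>m. n \<le> m + 2 * M + 1 \<Longrightarrow> m \<le> n \<Longrightarrow>
      (\<Sum>j<k. (m choose j) * (c / n) ^ j * (1 - c / n) ^ (m - j)) \<le> q"
    and \<theta>: "1 \<le> \<theta>" "\<theta> * q * c \<le> exp (-1)"
begin

definition "p = c / n"
definition "V = {..<n}"
definition "I = [V]\<^bsup>2\<^esup>"
definition "F = core_size k V"
definition "\<mu> = expect p I F"
definition "v = expect p I (\<lambda>x. (F x - \<mu>)\<^sup>2)"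
definition "\<beta> = n * (exp 1 / \<theta> ^ M)"
text \<open>Union bound over at most \<open>n\<^sup>2\<close> choices for each of two edges and four
  pairs of values; overwriting both costs \<open>1 / (p * (1 - p))\<^sup>2\<close>, which is at most
  \<open>(2 * n / c)\<^sup>2\<close>.\<close>

definition "\<eta> = 16 * n ^ 6 * \<beta> / c\<^sup>2"
text \<open>Probability that a given vertex has degree exactly \<open>k\<close>.\<close>

definition "\<pi> = ((n - 1) choose k) * p ^ k * (1 - p) ^ (n - 1 - k)"
text \<open>The size of a difference at a graph with one altered edge is read off from components
  after a second edge is deleted; off \<open>bad\<close> all these graphs have small
  components.\<close>

definition "bad x \<longleftrightarrow> (\<exists>e\<in>I. \<exists>e'\<in>I. \<exists>b\<in>UNIV. \<exists>b'\<in>UNIV. big_light k V M (x(e := b, e' := b')))"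

lemma n: "0 < n" using c by linarith

lemma edge_prob: "0 < p" "p \<le> 1 / 2" "p * n = c" "p \<le> 1"
  using c n by (auto simp: p_def field_simps)

lemma V: "finite V" "card V = n" by (auto simp: V_def)

lemma finI: "finite I" unfolding I_def by (intro finite_imp_finite_nsets V)

lemma cardI: "real (card I) \<le> n\<^sup>2"
  using card_edges_le[of n] by (simp add: I_def V_def flip: of_nat_power)

lemma p_cardI: "p * card I \<le> c * n"
proof -
  have "p * card I \<le> p * n\<^sup>2" using edge_prob cardI by (intro mult_left_mono) auto
  also have "\<dots> = c * n" using edge_prob(3) by (simp add: power2_eq_square)
  finally show ?thesis .
qed

sublocale random_graph p I
  using edge_prob finI by unfold_locales auto

lemma pr_big_light: "pr p I (\<lambda>x. big_light k V M x) \<le> \<beta>"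
proof -
  have "pr p I (\<lambda>x. big_light k V M x) \<le> card V * (exp 1 / \<theta> ^ M)"
  proof (rule pr_big_light_le)
    show "(\<Sum>j<k. (m choose j) * p ^ j * (1 - p) ^ (m - j)) \<le> q" if "card V \<le> m + 2 * M" "m \<le> card V" for m
      using q(2)[of m] that by (simp add: V p_def)
    show "\<theta> * q * p * card V \<le> exp (-1)" using \<theta>(2) edge_prob(3) by (simp add: V mult.assoc)
  qed (use V q \<theta> in \<open>auto simp: I_def\<close>)
  then show ?thesis by (simp add: \<beta>_def V)
qed

lemma pr_notin_kcore:
  assumes a: "a \<in> V" and b: "b \<in> V - {a}"
  shows "pr p I (\<lambda>x. b \<notin> kcore k (V - {a}) x) \<le> \<beta> + q * exp 1"
proof -
  let ?W = "V - {a}"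
  have W: "finite ?W" "card ?W = n - 1" "[?W]\<^bsup>2\<^esup> \<subseteq> I"
    using V a by (auto simp: I_def nsets_def)
  have pn: "p * (real n - 1) \<le> c" using edge_prob by (simp add: algebra_simps)
  have q': "(\<Sum>j<k. (m choose j) * p ^ j * (1 - p) ^ (m - j)) \<le> q" if "card ?W \<le> m + 2 * M" "m \<le> card ?W" for m
    using q(2)[of m] that unfolding W by (simp add: p_def)
  have qpn: "\<theta> * q * p * card ?W \<le> exp (-1)"
  proof -
    have "\<theta> * q * (p * (real n - 1)) \<le> \<theta> * q * c" using pn \<theta> q by (intro mult_left_mono) auto
    then show ?thesis using \<theta>(2) n by (simp add: W mult.assoc of_nat_diff)
  qed
  have "1 * (q * p * card ?W) \<le> \<theta> * (q * p * card ?W)" using \<theta> q edge_prob by (intro mult_right_mono) auto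
  then have "q * p * card ?W \<le> exp (-1)" using qpn by (simp add: mult_ac)
  then have "pr p I (\<lambda>x. b \<notin> kcore k ?W x) \<le> pr p I (\<lambda>x. big_light k ?W M x) + q * exp 1"
    using b W M q q' by (intro pr_notin_kcore_le) auto
  moreover have "pr p I (\<lambda>x. big_light k ?W M x) \<le> card ?W * (exp 1 / \<theta> ^ M)"
    using W q \<theta> qpn q' by (intro pr_big_light_le) auto
  moreover have "\<dots> \<le> n * (exp 1 / \<theta> ^ M)"
    using \<theta> by (intro mult_right_mono) (auto simp: W)
  ultimately show ?thesis unfolding \<beta>_def by linarith
qed

lemma variance_core_ge:
  assumes \<rho>: "k * (\<beta> + q * exp 1) \<le> 1"
  shows "n * ((\<pi> * (1 - k * (\<beta> + q * exp 1)) / 2)\<^sup>2 / (4 * c)) \<le> v"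
proof -
  define \<rho> where "\<rho> = \<beta> + q * exp 1"
  define \<delta> where "\<delta> = \<pi> * (1 - k * \<rho>) / 2"
  define S where "S = (\<Sum>e\<in>I. expect p I (dif e F))"
  have \<pi>0: "0 \<le> \<pi>" unfolding \<pi>_def using edge_prob by simp
  have \<delta>0: "0 \<le> \<delta>" unfolding \<delta>_def \<rho>_def using \<pi>0 \<rho> by simp
  have "n * (\<pi> * (1 - k * \<rho>)) = (\<Sum>a\<in>V. \<pi> * (1 - k * \<rho>))" using V by simp
  also have "\<dots> \<le> (\<Sum>a\<in>V. pr p I (\<lambda>x. card (nb x V a) = k \<and> nb x V a \<subseteq> kcore k (V - {a}) x))"
  proof (rule sum_mono)
    fix a assume a: "a \<in> V"
    have "nb x V a = nb x (V - {a}) a" for x by (auto simp: nb_def)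
    then have "pr p I (\<lambda>x. card (nb x V a) = k) = pr p I (\<lambda>x. card (nb x (V - {a}) a) = k)" by simp
    also have "\<dots> = (card (V - {a}) choose k) * p ^ k * (1 - p) ^ (card (V - {a}) - k)"
      using V a by (intro pr_card_nb) (auto simp: I_def nsets_def card_insert_if)
    also have "\<dots> = \<pi>" using V a by (simp add: \<pi>_def)
    finally have "pr p I (\<lambda>x. card (nb x V a) = k) = \<pi>" .
    then show "\<pi> * (1 - k * \<rho>) \<le> pr p I (\<lambda>x. card (nb x V a) = k \<and> nb x V a \<subseteq> kcore k (V - {a}) x)"
      using pr_neighbours_in_kcore_ge[of V a k \<rho>] V a pr_notin_kcore[OF a] by (simp add: I_def \<rho>_def)
  qed
  also have "\<dots> \<le> 2 * p * S"
    unfolding S_def F_def using V k by (intro sum_dif_core_size_ge) (auto simp: I_def)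
  finally have S: "n * \<delta> \<le> p * S" by (simp add: \<delta>_def)
  \<comment> \<open>Maximises \<open>2 * r * (n * \<delta>) - r\<^sup>2 * (c * n)\<close>.\<close>
  define r where "r = \<delta> / c"
  have r0: "0 \<le> r" using \<delta>0 c by (simp add: r_def)
  have S0: "0 \<le> p * S" using S \<delta>0 by (meson mult_nonneg_nonneg of_nat_0_le_iff order_trans)
  have "2 * r * (p * (1 - p) * S) - r\<^sup>2 * (p * (1 - p) * card I) = (1 - p) * (2 * r * (p * S) - r\<^sup>2 * (p * card I))"
    by (simp add: algebra_simps)
  also have "\<dots> \<ge> (1 - p) * (2 * r * (n * \<delta>) - r\<^sup>2 * (c * n))"
    using S p_cardI r0 edge_prob by (intro mult_left_mono diff_mono) auto
  also have "(1 - p) * (2 * r * (n * \<delta>) - r\<^sup>2 * (c * n)) = (1 - p) * (n * (\<delta>\<^sup>2 / c))"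
    using c by (simp add: r_def power2_eq_square field_simps)
  also have "\<dots> \<ge> (1 / 4) * (n * (\<delta>\<^sup>2 / c))"
    using edge_prob c by (intro mult_right_mono) auto
  finally have "(1 / 4) * (n * (\<delta>\<^sup>2 / c)) \<le> 2 * r * (p * (1 - p) * S) - r\<^sup>2 * (p * (1 - p) * card I)" by simp
  also have "\<dots> \<le> v" unfolding v_def \<mu>_def S_def by (rule variance_ge)
  finally show ?thesis by (simp add: \<delta>_def \<rho>_def)
qed

lemma pr_bad: "pr p I bad \<le> \<eta>"
proof -
  let ?s = "(p * (1 - p))\<^sup>2"
  have s: "0 < p * (1 - p)" using edge_prob by simp
  have one: "pr p I (\<lambda>x. big_light k V M (x(e := b, e' := b'))) \<le> \<beta> / ?s" if e: "e \<in> I" "e' \<in> I" for e e' b b'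
  proof -
    let ?u = "\<lambda>x. of_bool (big_light k V M x) :: real"
    have "p * (1 - p) * (p * (1 - p) * expect p I (\<lambda>x. ?u (x(e := b, e' := b')))) \<le>
        p * (1 - p) * expect p I (\<lambda>x. ?u (x(e' := b')))"
      using s by (intro mult_left_mono expect_upd_le[of e "\<lambda>x. ?u (x(e' := b'))"] e) auto
    also have "\<dots> \<le> expect p I ?u" by (intro expect_upd_le e) auto
    also have "\<dots> \<le> \<beta>" by (rule pr_big_light)
    finally have "pr p I (\<lambda>x. big_light k V M (x(e := b, e' := b'))) * ?s \<le> \<beta>"
      by (simp only: power2_eq_square mult_ac)
    moreover have "0 < ?s" using s by (rule zero_less_power)
    ultimately show ?thesis by (simp only: pos_le_divide_eq)
  qed
  have "pr p I bad \<le> card I * (card I * (card (UNIV :: bool set) * (card (UNIV :: bool set) * (\<beta> / ?s))))"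
    unfolding bad_def by (intro pr_bex_le_const finI one finite)
  also have "\<dots> = 4 * real (card I) ^ 2 * (\<beta> / ?s)" by (simp add: power2_eq_square)
  also have "\<dots> \<le> 4 * (real n ^ 2)\<^sup>2 * (\<beta> * (2 * n / c)\<^sup>2)"
  proof (intro mult_mono)
    show "(real (card I))\<^sup>2 \<le> (real n ^ 2)\<^sup>2" using cardI by (intro power_mono) auto
    have \<beta>0: "0 \<le> \<beta>" using \<theta> by (simp add: \<beta>_def)
    have "c / (2 * n) = p * (1 / 2)" using edge_prob by (simp add: p_def)
    also have "\<dots> \<le> p * (1 - p)" using edge_prob by (intro mult_left_mono) auto
    finally have "inverse (p * (1 - p)) \<le> inverse (c / (2 * n))"
      using c n by (intro le_imp_inverse_le) auto
    then have "(inverse (p * (1 - p)))\<^sup>2 \<le> (2 * n / c)\<^sup>2"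
      using s by (intro power_mono) (auto simp: field_simps)
    then show "\<beta> / ?s \<le> \<beta> * (2 * n / c)\<^sup>2"
      using \<beta>0 unfolding divide_inverse[of \<beta>] power_inverse[symmetric] by (intro mult_left_mono) auto
    show "0 \<le> \<beta> / ?s" using \<beta>0 by simp
  qed auto
  also have "\<dots> = \<eta>" unfolding \<eta>_def by (simp add: power_divide power_mult_distrib field_simps flip: power_mult power_add)
  finally show ?thesis .
qed

text \<open>The first summand is \<open>p\<close> times the bound of
  \<open>sum_dif_dif_core_size_le\<close>, with \<open>p * n = c\<close> and at most
  \<open>c * n\<close> expected edges. The second uses the trivial bound \<open>2 * n\<close> for
  each mixed difference on \<open>bad\<close>, with \<open>p * card I \<le> c * n\<close>.\<close>

definition "Q = 4 * M * c * (2 * M + c) + 2 * c * n\<^sup>2 * \<eta>"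

lemma sum_ex_dif_dif_le:
  assumes e: "e \<in> I"
  shows "(\<Sum>e'\<in>I. p * expect p I (\<lambda>x. \<bar>dif e' (dif e F) x\<bar>)) \<le> Q"
proof -
  define N where "N = (\<lambda>x. real (card {e \<in> I. x e}))"
  have "(\<Sum>e'\<in>I. \<bar>dif e' (dif e F) x\<bar>) \<le> 4 * real M * (2 * real M * n + N x) + real (card I) * (2 * real n) * of_bool (bad x)" for x
  proof (cases "bad x")
    case True
    have "(\<Sum>e'\<in>I. \<bar>dif e' (dif e F) x\<bar>) \<le> (\<Sum>e'\<in>I. 2 * real n)"
    proof (rule sum_mono)
      fix e'
      show "\<bar>dif e' (dif e F) x\<bar> \<le> 2 * real n"
        using dif_core_size_le_card[OF V(1), of e k "x(e' := True)"] dif_core_size_le_card[OF V(1), of e k "x(e' := False)"]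
        by (simp add: dif_def[of e'] F_def V)
    qed
    moreover have "0 \<le> 4 * real M * (2 * real M * n + N x)" by (simp add: N_def)
    ultimately show ?thesis using True by simp
  next
    case False
    have "(\<Sum>e'\<in>I. \<bar>dif e' (dif e F) x\<bar>) \<le> 4 * real M * (2 * real M * card V + card {e \<in> I. x e})"
      unfolding I_def F_def using False e M
      by (intro sum_dif_dif_core_size_le V) (auto simp: bad_def I_def)
    then show ?thesis using False by (simp add: N_def V)
  qed
  then have "expect p I (\<lambda>x. \<Sum>e'\<in>I. \<bar>dif e' (dif e F) x\<bar>) \<le>
      expect p I (\<lambda>x. 4 * real M * (2 * real M * n + N x) + real (card I) * (2 * real n) * of_bool (bad x))"
    by (rule expect_mono)
  also have "\<dots> = 4 * real M * (2 * real M * n + expect p I N) + real (card I) * (2 * real n) * pr p I bad"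
    by (simp only: expect_add expect_cmult expect_const)
  also have "expect p I N = p * card I"
  proof -
    have "N = (\<lambda>x. \<Sum>e\<in>I. of_bool (x e))" using finI by (auto simp: N_def fun_eq_iff Int_def)
    then show ?thesis by (simp add: expect_sum pr_coord)
  qed
  finally have "(\<Sum>e'\<in>I. expect p I (\<lambda>x. \<bar>dif e' (dif e F) x\<bar>)) \<le>
      4 * real M * (2 * real M * n + p * card I) + real (card I) * (2 * real n) * pr p I bad"
    by (simp only: expect_sum)
  then have "p * (\<Sum>e'\<in>I. expect p I (\<lambda>x. \<bar>dif e' (dif e F) x\<bar>)) \<le>
      p * (4 * real M * (2 * real M * n + p * card I) + real (card I) * (2 * real n) * pr p I bad)"
    using edge_prob by (intro mult_left_mono) auto
  also have "\<dots> = 4 * real M * (2 * real M * (p * n) + p * (p * card I)) + p * card I * (2 * real n) * pr p I bad"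
    by (simp add: algebra_simps)
  also have "\<dots> \<le> 4 * real M * (2 * real M * c + p * (c * n)) + c * n * (2 * real n) * \<eta>"
  proof (rule add_mono)
    have "p * (p * card I) \<le> p * (c * n)" using p_cardI edge_prob by (intro mult_left_mono) auto
    then show "4 * real M * (2 * real M * (p * n) + p * (p * card I)) \<le> 4 * real M * (2 * real M * c + p * (c * n))"
      unfolding edge_prob(3) by (intro mult_left_mono) auto
    show "p * card I * (2 * real n) * pr p I bad \<le> c * n * (2 * real n) * \<eta>"
    proof (rule mult_mono)
      show "p * card I * (2 * real n) \<le> c * n * (2 * real n)" using p_cardI by (rule mult_right_mono) simp
    qed (use pr_bad pr_nonneg c in auto)
  qed
  also have "4 * real M * (2 * real M * c + p * (c * n)) + c * n * (2 * real n) * \<eta> = Q"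
  proof -
    have "p * (c * n) = c * (p * n)" by simp
    then have *: "p * (c * n) = c * c" unfolding edge_prob(3) .
    show ?thesis unfolding Q_def * by (simp add: power2_eq_square algebra_simps)
  qed
  finally show ?thesis by (simp add: sum_distrib_left)
qed

text \<open>\<open>sparse_differences\<close> with the trivial bound \<open>n\<close> and the bound
  \<open>2 * M\<close> off \<open>bad\<close>, one component for each endpoint; this is the origin
  of the two constants 8.\<close>

lemma char_core_size_le:
  assumes v: "0 < v"
  shows "norm (measure_pmf.expectation (Pi_pmf I False (\<lambda>_. bernoulli_pmf p))
      (\<lambda>x. exp (\<i> * complex_of_real (t * ((F x - \<mu>) / sqrt v)))) - complex_of_real (exp (- (t\<^sup>2) / 2)))
    \<le> \<bar>t\<bar> ^ 3 * (c * n / sqrt v ^ 3 *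
      (8 * real M ^ 2 * Q + 6 * n ^ 3 * \<eta> * (c * n) + (8 * real M ^ 3 + 2 * n ^ 3 * \<eta>) / 2))"
proof -
  obtain "is" where "is": "distinct is" "set is = I" using finite_distinct_list[OF finI] by auto
  define z :: "nat set \<Rightarrow> bool" where "z = (\<lambda>_. False)"
  have expect: "expect p I u = avl p is u z" for u
    unfolding z_def "is"(2)[symmetric] using "is"(1) edge_prob by (intro expect_avl) auto
  have len: "length is = card I" using "is" distinct_card by fastforce
  interpret sparse_differences p "is" F bad z "real n" "2 * real M" \<eta> Q
  proof unfold_locales
    show "\<bar>dif e F x\<bar> \<le> real n" for e x
      using dif_core_size_le_card[OF V(1), of e k x] by (simp add: F_def V)
    show "\<bar>dif e F (x(e' := b))\<bar> \<le> 2 * real M" if "\<not> bad x" "e \<in> set is" "e' \<in> set is" for e e' x b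
      using sum_dif_dif_core_size_le(1)[OF V(1) M(1), of e k x e' b] that
      by (auto simp: F_def bad_def "is" I_def)
    show "2 * real M \<le> real n" using M(2) by linarith
    show "avl p is (\<lambda>x. of_bool (bad x)) z \<le> \<eta>" using pr_bad by (simp add: expect)
    show "(\<Sum>j\<in>set is. p * avl p is (\<lambda>x. \<bar>dif j (dif e F) x\<bar>) z) \<le> Q" if "e \<in> set is" for e
      using sum_ex_dif_dif_le[of e] that by (simp add: expect "is")
  qed (use edge_prob "is" in auto)
  define h where "h = (\<lambda>t x. exp (\<i> * complex_of_real (t * ((F x - \<mu>) / sqrt v))))"
  define K where "K = p * card I / sqrt v ^ 3 *
    (2 * (2 * real M)\<^sup>2 * Q + 6 * n ^ 3 * \<eta> * (p * card I) + ((2 * real M) ^ 3 + 2 * n ^ 3 * \<eta>) / 2)"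
  have "norm (avl p is (h t) z - complex_of_real (exp (- (t\<^sup>2) / 2))) \<le> \<bar>t\<bar> ^ 3 * K"
  proof (rule norm_minus_gaussian_le)
    fix s
    show "((\<lambda>s. avl p is (h s) z) has_vector_derivative
        avl p is (\<lambda>x. (\<i> * of_real ((F x - \<mu>) / sqrt v)) * h s x) z) (at s)"
    proof (rule avl_has_vector_derivative)
      fix x
      define w where "w = (F x - \<mu>) / sqrt v"
      have "((\<lambda>s. exp (complex_of_real s * (\<i> * of_real w))) has_vector_derivative
          \<i> * of_real w * exp (complex_of_real s * (\<i> * of_real w))) (at s)"
        by (rule has_vector_derivative_real_field) (auto intro!: derivative_eq_intros)
      moreover have "h s x = exp (complex_of_real s * (\<i> * of_real w))" for s
        unfolding h_def w_def[symmetric] by (simp add: mult_ac)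
      ultimately show "((\<lambda>s. h s x) has_vector_derivative (\<i> * of_real ((F x - \<mu>) / sqrt v)) * h s x) (at s)"
        unfolding w_def[symmetric] by simp
    qed
    show "norm (avl p is (\<lambda>x. (\<i> * of_real ((F x - \<mu>) / sqrt v)) * h s x) z + of_real s * avl p is (h s) z)
        \<le> s\<^sup>2 * K"
      using char_derivative_le[of "sqrt v" s] v unfolding h_def K_def \<mu>_def v_def expect len by simp
    show "avl p is (h 0) z = 1" by (simp add: h_def)
  qed
  also have "\<dots> \<le> \<bar>t\<bar> ^ 3 * (c * n / sqrt v ^ 3 *
      (8 * real M ^ 2 * Q + 6 * n ^ 3 * \<eta> * (c * n) + (8 * real M ^ 3 + 2 * n ^ 3 * \<eta>) / 2))"
  proof (rule mult_left_mono)
    have Q0: "0 \<le> Q" "0 \<le> \<eta>" using eta_nonneg c by (auto simp: Q_def)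
    show "K \<le> c * n / sqrt v ^ 3 *
      (8 * real M ^ 2 * Q + 6 * n ^ 3 * \<eta> * (c * n) + (8 * real M ^ 3 + 2 * n ^ 3 * \<eta>) / 2)"
      unfolding K_def
    proof (rule mult_mono)
      show "p * card I / sqrt v ^ 3 \<le> c * n / sqrt v ^ 3" using p_cardI v by (intro divide_right_mono) auto
      have "6 * n ^ 3 * \<eta> * (p * card I) \<le> 6 * n ^ 3 * \<eta> * (c * n)"
        using p_cardI Q0 by (rule_tac mult_left_mono) auto
      then show "2 * (2 * real M)\<^sup>2 * Q + 6 * n ^ 3 * \<eta> * (p * card I) + ((2 * real M) ^ 3 + 2 * n ^ 3 * \<eta>) / 2
          \<le> 8 * real M ^ 2 * Q + 6 * n ^ 3 * \<eta> * (c * n) + (8 * real M ^ 3 + 2 * n ^ 3 * \<eta>) / 2"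
        by (simp add: power_mult_distrib)
    qed (use Q0 v c edge_prob in auto)
  qed simp
  also have "avl p is (h t) z = measure_pmf.expectation (Pi_pmf I False (\<lambda>_. bernoulli_pmf p)) (h t)"
    unfolding z_def "is"(2)[symmetric] using "is"(1) edge_prob by (intro expectation_Pi_bernoulli[symmetric]) auto
  finally show ?thesis unfolding h_def .
qed

end

section \<open>Asymptotics\<close>

definition exp_partial :: "nat \<Rightarrow> real \<Rightarrow> real" where
  "exp_partial k x = (\<Sum>j<k. x ^ j / fact j)"

lemma c_hat_gt:
  assumes "k \<ge> 3"
  shows "real k < c_hat k"
  using theI'[OF ex1_c_hat[OF assms]] by (simp add: c_hat_def)

text \<open>The function \<open>g\<close> tends to 0. If it were still at least
  \<open>exp (-1)\<close> at \<open>c\<close>, the intermediate value theorem would give a root of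
  the defining equation beyond \<open>c_hat k\<close>, against uniqueness.\<close>

lemma poisson_tail_less:
  assumes k: "k \<ge> 3" and c: "c_hat k < c"
  shows "c * exp 1 * (exp (- c) * exp_partial k c) < 1"
proof (rule ccontr)
  define g where "g = (\<lambda>x::real. x * (exp (- x) * exp_partial k x))"
  assume "\<not> c * exp 1 * (exp (- c) * exp_partial k c) < 1"
  then have gc: "exp (-1) \<le> g c" by (simp add: g_def exp_minus field_simps)
  have root: "measure_pmf.prob (poisson_pmf x) {..k - 1} = inverse (exp 1 * x)" if "x > 0" "g x = exp (-1)" for x
    using that k by (subst prob_poisson_atMost) (auto simp: g_def exp_partial_def exp_minus field_simps)
  have "(g \<longlongrightarrow> 0) at_top"
  proof -
    have "((\<lambda>x::real. x ^ Suc j / exp x / fact j) \<longlongrightarrow> 0 / fact j) at_top" for j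
      by (intro tendsto_divide tendsto_power_div_exp_0 tendsto_const) auto
    then have "((\<lambda>x::real. \<Sum>j<k. x ^ Suc j / exp x / fact j) \<longlongrightarrow> (\<Sum>j<k. 0)) at_top"
      by (intro tendsto_sum) simp
    moreover have "g = (\<lambda>x. \<Sum>j<k. x ^ Suc j / exp x / fact j)"
      by (auto simp: g_def exp_partial_def sum_distrib_left exp_minus field_simps)
    ultimately show ?thesis by simp
  qed
  then have "eventually (\<lambda>x. g x < exp (-1)) at_top" by (rule order_tendstoD) simp
  then have "eventually (\<lambda>x. c < x \<and> g x < exp (-1)) at_top"
    using eventually_gt_at_top[of c] by eventually_elim simp
  then obtain b where b: "c < b" "g b < exp (-1)"
    using eventually_happens[of _ "at_top :: real filter"] by fastforce
  have "continuous_on {c..b} g"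
    unfolding g_def exp_partial_def by (intro continuous_intros) auto
  then obtain x where x: "c \<le> x" "x \<le> b" "g x = exp (-1)"
    using IVT2'[of g b "exp (-1)" c] b gc by auto
  have "real k < x" using x c c_hat_gt[OF k] by linarith
  then have "x = c_hat k"
    using root[of x] x ex1_c_hat[OF k] theI'[OF ex1_c_hat[OF k]] unfolding c_hat_def by auto
  then show False using x c by simp
qed

text \<open>Poisson weights arise since the binomial coefficient is at most
  \<open>n ^ j / fact j\<close> and \<open>1 - c / n \<le> exp (- c / n)\<close>. The exponent falls
  short of \<open>n\<close> by at most \<open>2 * M + 1 + k\<close>; the last exponential pays for
  this and tends to 1 for sublinear \<open>M\<close>.\<close>

lemma binomial_cdf_le:
  fixes n m M :: nat and c :: real
  assumes c: "0 < c" "c \<le> n" and m: "n \<le> m + 2 * M + 1" "m \<le> n" and "0 < n"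
  shows "(\<Sum>j<k. (m choose j) * (c / n) ^ j * (1 - c / n) ^ (m - j)) \<le>
    exp (- c) * exp_partial k c * exp (c * (2 * M + 1 + k) / n)"
proof -
  have "(\<Sum>j<k. (m choose j) * (c / n) ^ j * (1 - c / n) ^ (m - j)) \<le>
      (\<Sum>j<k. c ^ j / fact j * (exp (- c) * exp (c * (2 * M + 1 + k) / n)))"
  proof (intro sum_mono mult_mono)
    fix j assume j: "j \<in> {..<k}"
    have "(m choose j) * fact j \<le> n ^ j"
      using binomial_fact_pow[of m j] power_mono[OF m(2), of j] by simp
    then have "real ((m choose j) * fact j) \<le> real (n ^ j)" by (rule of_nat_mono)
    then have "real (m choose j) \<le> n ^ j / fact j" by (simp add: field_simps)
    then have "real (m choose j) * (c / n) ^ j \<le> n ^ j / fact j * (c / n) ^ j"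
      using c by (intro mult_right_mono) auto
    also have "\<dots> = c ^ j / fact j" using \<open>0 < n\<close> by (simp add: power_divide)
    finally show "real (m choose j) * (c / n) ^ j \<le> c ^ j / fact j" .
    have "(1 - c / n) ^ (m - j) \<le> exp (- c / n) ^ (m - j)"
      using exp_ge_add_one_self[of "- c / n"] c \<open>0 < n\<close> by (intro power_mono) (auto simp: field_simps)
    also have "\<dots> = exp (- c / n * real (m - j))" by (simp add: mult.commute flip: exp_of_nat_mult)
    also have "\<dots> \<le> exp (- c / n * (real n - real (2 * M + 1 + k)))"
    proof -
      have "real n - real (2 * M + 1 + k) \<le> real (m - j)" using m j unfolding lessThan_iff by linarith
      then have "c / n * (real n - real (2 * M + 1 + k)) \<le> c / n * real (m - j)"
        using c by (intro mult_left_mono) auto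
      then show ?thesis by simp
    qed
    also have "\<dots> = exp (- c) * exp (c * (2 * M + 1 + k) / n)"
      using \<open>0 < n\<close> by (simp add: field_simps flip: exp_add)
    finally show "(1 - c / n) ^ (m - j) \<le> exp (- c) * exp (c * (2 * M + 1 + k) / n)" .
  qed (use c in auto)
  also have "\<dots> = exp (- c) * exp_partial k c * exp (c * (2 * M + 1 + k) / n)"
    by (simp add: exp_partial_def sum_distrib_left sum_distrib_right mult_ac)
  finally show ?thesis .
qed

lemma binomial_pmf_eventually_ge:
  assumes c: "0 < c" and k: "1 \<le> k"
  shows "\<exists>\<pi>0>0. eventually (\<lambda>n::nat. \<pi>0 \<le> ((n - 1) choose k) * (c / n) ^ k * (1 - c / n) ^ (n - 1 - k)) sequentially"
proof (intro exI conjI)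
  \<comment> \<open>The binomial coefficient is at least \<open>((n - 1) / k) ^ k\<close>, with
    \<open>n - 1\<close> at least \<open>n / 2\<close>, and the power of \<open>1 - c / n\<close> is
    eventually at least half of its limit \<open>exp (- c)\<close>.\<close>
  show "0 < (c / (2 * k)) ^ k * (exp (- c) / 2)" using c k by simp
  have "(\<lambda>n. (1 + (- c) / real n) ^ n) \<longlonglongrightarrow> exp (- c)" by (rule tendsto_exp_limit_sequentially)
  then have "eventually (\<lambda>n. exp (- c) / 2 < (1 + (- c) / real n) ^ n) sequentially"
    by (rule order_tendstoD) simp
  then show "eventually (\<lambda>n::nat. (c / (2 * k)) ^ k * (exp (- c) / 2) \<le>
      ((n - 1) choose k) * (c / n) ^ k * (1 - c / n) ^ (n - 1 - k)) sequentially"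
    using eventually_ge_at_top[of "nat \<lceil>c\<rceil>"] eventually_ge_at_top[of "k + 2"]
  proof eventually_elim
    case (elim n)
    have n: "0 < real n" "c \<le> n" using elim c by linarith+
    have "real n / 2 \<le> real (n - 1)" using elim by linarith
    then have "(real n / 2 / k) ^ k \<le> (real (n - 1) / k) ^ k"
      by (intro power_mono divide_right_mono) auto
    also have "\<dots> \<le> ((n - 1) choose k)" using elim by (intro binomial_ge_n_over_k_pow_k) auto
    finally have "(real n / 2 / k) ^ k * (c / n) ^ k \<le> ((n - 1) choose k) * (c / n) ^ k"
      using c by (intro mult_right_mono) auto
    moreover have "(real n / 2 / k) ^ k * (c / n) ^ k = (c / (2 * k)) ^ k"
      using n by (simp flip: power_mult_distrib)
    ultimately have "(c / (2 * k)) ^ k \<le> ((n - 1) choose k) * (c / n) ^ k" by linarith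
    moreover have "exp (- c) / 2 \<le> (1 - c / n) ^ (n - 1 - k)"
    proof -
      have "(1 - c / n) ^ n \<le> (1 - c / n) ^ (n - 1 - k)"
        using n c by (intro power_decreasing) auto
      then show ?thesis using elim by simp
    qed
    ultimately show ?case using c n by (intro mult_mono) auto
  qed
qed

text \<open>\<open>e\<close> decays faster than every power of \<open>n\<close>, so the terms
  without it dominate: a power of \<open>ln n\<close> divided by \<open>sqrt n\<close>.\<close>

lemma error_term_tendsto_0:
  fixes c s L :: real and l e :: "nat \<Rightarrow> real"
  assumes "0 < c" "0 < s" "0 < L"
  defines "l \<equiv> \<lambda>n::nat. ln (real n) ^ 2 + 1"
    and "e \<equiv> \<lambda>n::nat. 16 * real n ^ 6 * (real n * (exp 1 * exp (- (L * ln (real n) ^ 2)))) / c\<^sup>2"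
  shows "(\<lambda>n. c * n / sqrt (n * s) ^ 3 * (8 * l n ^ 2 * (4 * l n * c * (2 * l n + c) + 2 * c * n\<^sup>2 * e n)
      + 6 * n ^ 3 * e n * (c * n) + (8 * l n ^ 3 + 2 * n ^ 3 * e n) / 2)) \<longlonglongrightarrow> 0"
  unfolding l_def e_def using assms(1-3) by real_asymp

lemma sparse_graph_limit:
  fixes c :: real and k :: nat
  assumes k: "k \<ge> 3" and c: "c_hat k < c"
  defines "W \<equiv> \<lambda>n::nat. [{..<n}]\<^bsup>2\<^esup>"
  defines "F \<equiv> \<lambda>n::nat. core_size k {..<n}"
  defines "\<mu> \<equiv> \<lambda>n. expect (c / n) (W n) (F n)"
  defines "v \<equiv> \<lambda>n. expect (c / n) (W n) (\<lambda>x. (F n x - \<mu> n)\<^sup>2)"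
  shows "(\<lambda>n. measure_pmf.expectation (Pi_pmf (W n) False (\<lambda>_. bernoulli_pmf (c / n)))
      (\<lambda>x. exp (\<i> * complex_of_real (t * ((F n x - \<mu> n) / sqrt (v n))))))
    \<longlonglongrightarrow> complex_of_real (exp (- (t\<^sup>2) / 2))"
proof -
  have ck: "real k < c" using c c_hat_gt[OF k] by linarith
  then have c0: "0 < c" using k by linarith
  define q0 where "q0 = exp (- c) * exp_partial k c"
  define a where "a = 1 / (c * exp 1)"
  \<comment> \<open>Strictly between the Poisson probability \<open>q0\<close> and the critical
    value \<open>a\<close>: the first gap absorbs the binomial error, the second gives \<theta> >
    1.\<close>
  define q where "q = (q0 + a) / 2"
  define \<theta> where "\<theta> = 1 / (q * c * exp 1)"
  define L where "L = ln \<theta>"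
  have q0: "0 \<le> q0" unfolding q0_def exp_partial_def using c0 by (intro mult_nonneg_nonneg sum_nonneg) auto
  have "q0 < a"
    using poisson_tail_less[OF k c] c0 by (simp add: q0_def a_def field_simps)
  then have q: "q0 < q" "q < a" "0 < q" using q0 by (auto simp: q_def)
  have qc: "q * c * exp 1 < 1" using q(2) c0 by (simp add: a_def field_simps)
  have \<theta>: "1 < \<theta>" "\<theta> * q * c = exp (-1)"
    using q(3) c0 qc by (auto simp: \<theta>_def field_simps exp_minus)
  have L: "0 < L" using \<theta> by (simp add: L_def)
  \<comment> \<open>Any \<theta> > 1 then makes \<open>\<theta> ^ M n\<close> larger than every
    power of \<open>n\<close>.\<close>
  define M where "M = (\<lambda>n::nat. Suc (nat \<lfloor>ln (real n) ^ 2\<rfloor>))"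
  define l where "l = (\<lambda>n::nat. ln (real n) ^ 2 + 1)"
  have M_le: "real (M n) \<le> l n" and M_ge: "ln (real n) ^ 2 \<le> M n" for n
    by (auto simp: M_def l_def) linarith+
  define b where "b = (\<lambda>n::nat. real n * (exp 1 * exp (- (L * ln (real n) ^ 2))))"
  have b: "n * (exp 1 / \<theta> ^ M n) \<le> b n" for n
  proof -
    have "\<theta> ^ M n = exp (L * M n)" using \<theta> by (simp add: L_def exp_of_nat2_mult)
    then have "exp 1 / \<theta> ^ M n = exp 1 * exp (- (L * M n))" by (simp add: exp_minus divide_inverse)
    also have "\<dots> \<le> exp 1 * exp (- (L * ln (real n) ^ 2))" using M_ge[of n] L by simp
    finally show ?thesis unfolding b_def by (intro mult_left_mono) auto
  qed
  have "(\<lambda>n. c * (2 * l n + 1 + k) / n) \<longlonglongrightarrow> 0" unfolding l_def by real_asymp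
  then have "(\<lambda>n. q0 * exp (c * (2 * l n + 1 + k) / n)) \<longlonglongrightarrow> q0 * exp 0"
    by (intro tendsto_intros)
  then have ev_q: "eventually (\<lambda>n. q0 * exp (c * (2 * l n + 1 + k) / n) < q) sequentially"
    using q by (intro order_tendstoD) auto
  have ev_M: "eventually (\<lambda>n. 2 * l n \<le> real n) sequentially" unfolding l_def by real_asymp
  \<comment> \<open>Here \<open>k < c\<close> enters: with \<open>q * c * exp 1 < 1\<close> it gives
    \<open>k * (q * exp 1) < 1\<close>, so all \<open>k\<close> neighbours can be in the core
    together with positive probability.\<close>
  define \<delta> where "\<delta> = 1 - k * (q * exp 1)"
  have \<delta>: "0 < \<delta>"
  proof -
    have "k * (q * exp 1) \<le> c * (q * exp 1)" using ck q by (intro mult_right_mono) auto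
    then show ?thesis using qc by (simp add: \<delta>_def mult_ac)
  qed
  have "b \<longlonglongrightarrow> 0" unfolding b_def using L by real_asymp
  then have "(\<lambda>n. real k * b n) \<longlonglongrightarrow> real k * 0" by (intro tendsto_intros)
  then have ev_b: "eventually (\<lambda>n. k * b n < \<delta> / 2) sequentially"
    using \<delta> by (intro order_tendstoD) auto
  obtain \<pi>0 where \<pi>0: "0 < \<pi>0" and ev_\<pi>: "eventually (\<lambda>n::nat. \<pi>0 \<le>
      ((n - 1) choose k) * (c / n) ^ k * (1 - c / n) ^ (n - 1 - k)) sequentially"
    using binomial_pmf_eventually_ge[OF c0, of k] k by auto
  \<comment> \<open>The constant of \<open>variance_core_ge\<close>; half of \<delta> is given up to
    absorb the vanishing term \<open>k * b n\<close>.\<close>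
  define s where "s = (\<pi>0 * (\<delta> / 2) / 2)\<^sup>2 / (4 * c)"
  have s: "0 < s" using \<pi>0 \<delta> c0 by (simp add: s_def)
  define e where "e = (\<lambda>n::nat. 16 * real n ^ 6 * b n / c\<^sup>2)"
  define K where "K = (\<lambda>n::nat. c * n / sqrt (n * s) ^ 3 *
      (8 * l n ^ 2 * (4 * l n * c * (2 * l n + c) + 2 * c * n\<^sup>2 * e n)
      + 6 * n ^ 3 * e n * (c * n) + (8 * l n ^ 3 + 2 * n ^ 3 * e n) / 2))"
  have K: "K \<longlonglongrightarrow> 0"
    unfolding K_def e_def b_def l_def by (rule error_term_tendsto_0[OF c0 s L])
  let ?\<phi> = "\<lambda>n. measure_pmf.expectation (Pi_pmf (W n) False (\<lambda>_. bernoulli_pmf (c / n)))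
      (\<lambda>x. exp (\<i> * complex_of_real (t * ((F n x - \<mu> n) / sqrt (v n)))))"
  have bound: "eventually (\<lambda>n. norm (?\<phi> n - complex_of_real (exp (- (t\<^sup>2) / 2))) \<le> \<bar>t\<bar> ^ 3 * K n) sequentially"
    using ev_q ev_M ev_b ev_\<pi> eventually_ge_at_top[of "nat \<lceil>2 * c\<rceil>"]
  proof eventually_elim
    case (elim n)
    have n: "2 * c \<le> n" using elim(5) by linarith
    have n0: "0 < n" using n c0 by linarith
    have l0: "0 \<le> l n" by (simp add: l_def)
    interpret G: sparse_graph c n k "M n" q \<theta>
    proof
      show "2 * M n \<le> n"
      proof -
        have "2 * real (M n) \<le> real n" using M_le[of n] elim(2) by linarith
        then show ?thesis by linarith
      qed
      show "(\<Sum>j<k. (m choose j) * (c / n) ^ j * (1 - c / n) ^ (m - j)) \<le> q"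
        if "n \<le> m + 2 * M n + 1" "m \<le> n" for m
      proof -
        have "(\<Sum>j<k. (m choose j) * (c / n) ^ j * (1 - c / n) ^ (m - j)) \<le>
            q0 * exp (c * (2 * M n + 1 + k) / n)"
          unfolding q0_def using that n n0 c0 by (intro binomial_cdf_le) auto
        also have "\<dots> \<le> q0 * exp (c * (2 * l n + 1 + k) / n)"
          using q0 c0 M_le[of n] by (intro mult_left_mono) (auto intro!: divide_right_mono mult_left_mono)
        finally show ?thesis using elim(1) by linarith
      qed
    qed (use c0 k n q \<theta> in \<open>auto simp: M_def\<close>)
    have WI: "G.I = W n" "G.p = c / n" "G.F = F n" "G.\<mu> = \<mu> n" "G.v = v n"
      unfolding G.I_def G.V_def G.p_def G.F_def G.\<mu>_def G.v_def W_def F_def \<mu>_def v_def by simp_all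
    have \<beta>: "G.\<beta> \<le> b n" unfolding G.\<beta>_def by (rule b)
    have \<eta>: "G.\<eta> \<le> e n" unfolding G.\<eta>_def e_def using \<beta>
      by (intro divide_right_mono) (auto intro: mult_left_mono)
    have \<eta>0: "0 \<le> G.\<eta>" using G.pr_bad G.pr_nonneg order_trans by blast
    have "k * G.\<beta> \<le> k * b n" using \<beta> by (intro mult_left_mono) auto
    then have \<rho>: "\<delta> / 2 \<le> 1 - k * (G.\<beta> + q * exp 1)"
      using elim(3) unfolding \<delta>_def distrib_left
      by (smt (verit) field_sum_of_halves)
    have "\<pi>0 * (\<delta> / 2) / 2 \<le> G.\<pi> * (1 - k * (G.\<beta> + q * exp 1)) / 2"
      using \<rho> elim(4) \<pi>0 \<delta> unfolding G.\<pi>_def G.p_def by (intro divide_right_mono mult_mono) auto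
    then have sq: "(\<pi>0 * (\<delta> / 2) / 2)\<^sup>2 \<le> (G.\<pi> * (1 - k * (G.\<beta> + q * exp 1)) / 2)\<^sup>2"
      by (rule power_mono) (use \<pi>0 \<delta> in simp)
    have "n * s \<le> n * ((G.\<pi> * (1 - k * (G.\<beta> + q * exp 1)) / 2)\<^sup>2 / (4 * c))"
      unfolding s_def using c0 by (intro mult_left_mono divide_right_mono sq) auto
    also have "\<dots> \<le> v n" using G.variance_core_ge \<rho> \<delta> unfolding WI by simp
    finally have v: "n * s \<le> v n" .
    then have v0: "0 < v n" using s n0 by (smt (verit) mult_pos_pos of_nat_0_less_iff)
    have "norm (?\<phi> n - complex_of_real (exp (- (t\<^sup>2) / 2))) \<le> \<bar>t\<bar> ^ 3 * (c * n / sqrt (v n) ^ 3 *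
        (8 * real (M n) ^ 2 * G.Q + 6 * n ^ 3 * G.\<eta> * (c * n) + (8 * real (M n) ^ 3 + 2 * n ^ 3 * G.\<eta>) / 2))"
      using G.char_core_size_le[of t] v0 unfolding WI by simp
    also have "\<dots> \<le> \<bar>t\<bar> ^ 3 * K n"
      unfolding K_def
    proof (intro mult_left_mono mult_mono)
      show "c * n / sqrt (v n) ^ 3 \<le> c * n / sqrt (n * s) ^ 3"
        using v v0 s n0 c0 by (intro divide_left_mono power_mono mult_pos_pos) auto
      have e0: "0 \<le> e n" using \<eta> \<eta>0 by linarith
      have "G.Q \<le> 4 * l n * c * (2 * l n + c) + 2 * c * n\<^sup>2 * e n"
        unfolding G.Q_def using M_le[of n] \<eta> \<eta>0 c0 l0 e0
        by (intro add_mono mult_mono mult_left_mono) auto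
      moreover have Q0: "0 \<le> G.Q" unfolding G.Q_def using c0 \<eta>0 by simp
      moreover have "8 * real (M n) ^ 2 \<le> 8 * l n ^ 2" using M_le[of n] by (intro mult_left_mono power_mono) auto
      ultimately have 1: "8 * real (M n) ^ 2 * G.Q \<le> 8 * l n ^ 2 * (4 * l n * c * (2 * l n + c) + 2 * c * n\<^sup>2 * e n)"
        using l0 by (intro mult_mono) auto
      have 2: "6 * n ^ 3 * G.\<eta> * (c * n) \<le> 6 * n ^ 3 * e n * (c * n)"
        using \<eta> c0 by (intro mult_right_mono mult_left_mono) auto
      have 3: "8 * real (M n) ^ 3 \<le> 8 * l n ^ 3" using M_le[of n] by (intro mult_left_mono power_mono) auto
      have 4: "2 * n ^ 3 * G.\<eta> \<le> 2 * n ^ 3 * e n" using \<eta> by (intro mult_left_mono) auto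
      show "8 * real (M n) ^ 2 * G.Q + 6 * n ^ 3 * G.\<eta> * (c * n) + (8 * real (M n) ^ 3 + 2 * n ^ 3 * G.\<eta>) / 2
          \<le> 8 * l n ^ 2 * (4 * l n * c * (2 * l n + c) + 2 * c * n\<^sup>2 * e n)
            + 6 * n ^ 3 * e n * (c * n) + (8 * l n ^ 3 + 2 * n ^ 3 * e n) / 2"
        by (intro add_mono divide_right_mono 1 2 3 4) simp
      show "0 \<le> 8 * real (M n) ^ 2 * G.Q + 6 * n ^ 3 * G.\<eta> * (c * n) + (8 * real (M n) ^ 3 + 2 * n ^ 3 * G.\<eta>) / 2"
        using Q0 \<eta>0 c0 by simp
    qed (use c0 s in auto)
    finally show ?case .
  qed
  have "(\<lambda>n. \<bar>t\<bar> ^ 3 * K n) \<longlonglongrightarrow> \<bar>t\<bar> ^ 3 * 0" using K by (intro tendsto_intros)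
  then have "(\<lambda>n. \<bar>t\<bar> ^ 3 * K n) \<longlonglongrightarrow> 0" by simp
  then show ?thesis using Lim_null_comparison[OF bound] by (simp add: LIM_zero_iff)
qed

section \<open>Passage to \<open>gnp\<close> by Levy's continuity theorem\<close>

theorem theorem1p2:
  fixes k :: nat and c :: real
  assumes "k \<ge> 3" and "c > c_hat k"
  shows "weak_conv_m
    (\<lambda>n. let G = gnp n (c / real n); X = (\<lambda>g. real (card (verts (k_core k g)))) in
       distr (measure_pmf G) borel
         (\<lambda>g. (X g - measure_pmf.expectation G X) / sqrt (measure_pmf.variance G X)))
    std_normal_distribution"
proof -
  define X where "X = (\<lambda>g :: nat ugraph. real (card (verts (k_core k g))))"
  define G where "G = (\<lambda>n. gnp n (c / real n))"
  define D where "D = (\<lambda>n. distr (measure_pmf (G n)) borel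
      (\<lambda>g. (X g - measure_pmf.expectation (G n) X) / sqrt (measure_pmf.variance (G n) X)))"
  have "weak_conv_m D std_normal_distribution"
  proof (rule levy_continuity)
    show "real_distribution (D n)" for n
      unfolding D_def by (intro prob_space.real_distribution_distr prob_space_measure_pmf) simp
    show "real_distribution std_normal_distribution" by (rule real_dist_normal_dist)
    fix t
    define W where "W n = [{..<n}]\<^bsup>2\<^esup>" for n :: nat
    define F where "F n = core_size k {..<n}" for n :: nat
    have XF: "X (Ugraph {..<n} {e \<in> W n. x e}) = F n x" for n x
      unfolding X_def F_def W_def core_size_def by (simp add: verts_k_core_eq_kcore)
    \<comment> \<open>Real values serve the mean and the variance; the complex version
      \<open>G'\<close> serves the characteristic function.\<close>
    have G: "measure_pmf.expectation (G n) (\<lambda>g. h (X g)) =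
        measure_pmf.expectation (Pi_pmf (W n) False (\<lambda>_. bernoulli_pmf (c / n))) (\<lambda>x. h (F n x))"
      for n and h :: "real \<Rightarrow> real"
      unfolding G_def gnp_def W_def[symmetric] by (simp add: XF)
    have G': "measure_pmf.expectation (G n) (\<lambda>g. h (X g)) =
        measure_pmf.expectation (Pi_pmf (W n) False (\<lambda>_. bernoulli_pmf (c / n))) (\<lambda>x. h (F n x))"
      for n and h :: "real \<Rightarrow> complex"
      unfolding G_def gnp_def W_def[symmetric] by (simp add: XF)
    define \<mu> where "\<mu> n = expect (c / n) (W n) (F n)" for n
    define v where "v n = expect (c / n) (W n) (\<lambda>x. (F n x - \<mu> n)\<^sup>2)" for n
    have \<mu>: "measure_pmf.expectation (G n) X = \<mu> n" for n
      using G[where h = "\<lambda>y. y"] by (simp add: \<mu>_def expect_def)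
    have v: "measure_pmf.expectation (G n) (\<lambda>g. (X g - \<mu> n)\<^sup>2) = v n" for n
      using G[where h = "\<lambda>y. (y - \<mu> n)\<^sup>2"] by (simp add: v_def expect_def)
    have char: "char (D n) t = measure_pmf.expectation (G n)
        (\<lambda>g. exp (\<i> * complex_of_real (t * ((X g - \<mu> n) / sqrt (v n)))))" for n
      unfolding D_def char_def \<mu> v by (subst integral_distr) simp_all
    have "char (D n) t = measure_pmf.expectation (Pi_pmf (W n) False (\<lambda>_. bernoulli_pmf (c / n)))
        (\<lambda>x. exp (\<i> * complex_of_real (t * ((F n x - \<mu> n) / sqrt (v n)))))" for n
      unfolding char by (rule G')
    then show "(\<lambda>n. char (D n) t) \<longlonglongrightarrow> char std_normal_distribution t"
      using sparse_graph_limit[OF assms(1,2), of t]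
      unfolding char_std_normal_distribution \<mu>_def v_def W_def F_def by simp
  qed
  then show ?thesis unfolding D_def G_def X_def Let_def .
qed

end
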